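(* Let $n$ and $D$ be integers such that $D>0$ and $n>1$ is a power of two. Given $nD$ finite Borel measures $\mu_1,\mu_2,\ldots,\mu_{nD}$ on $\mathbb{R}^n$, there exists an arrangement of at most $D$ hyperplanes in $\mathbb{R}^n$ that bisects each of the measures $\mu_1,\ldots,\mu_{nD}$.
   Context: An arrangement of at most $D$ hyperplanes in $\mathbb{R}^n$ is $\mathcal{H}=\{H_1,\ldots,H_m\}$ with $1\le m\le D$, where the $H_i$ are (affine) hyperplanes of $\mathbb{R}^n$ listed with repetitions allowed. Let $A_i:\mathbb{R}^n\to\mathbb{R}$ be an affine function whose zero set is $H_i$, and let $P^{\mathcal{H}}=A_1A_2\cdots A_m$ be the product of these affine functions. A finite measure $\mu$ on $\mathbb{R}^n$ is bisected by $\mathcal{H}$ if $$\mu\{v\in\mathbb{R}^n : P^{\mathcal{H}}(v)>0\}\le \frac{\mu(\mathbb{R}^n)}{2}\quad\text{and}\quad \mu\{v\in\mathbb{R}^n : P^{\mathcal{H}}(v)<0\}\le \frac{\mu(\mathbb{R}^n)}{2}.$$ (This does not depend on the choice of the $A_i$.) *)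

theory Defs
  imports "HOL-Analysis.Analysis"
begin

definition hyperplane :: "'a::euclidean_space set \<Rightarrow> bool" where
  "hyperplane H \<longleftrightarrow> (\<exists>a b. a \<noteq> 0 \<and> H = {x. a \<bullet> x = b})"

definition affine_function :: "('a::euclidean_space \<Rightarrow> real) \<Rightarrow> bool" where
  "affine_function A \<longleftrightarrow> (\<exists>a b. \<forall>x. A x = a \<bullet> x + b)"

text \<open>Arrangements are lists of hyperplanes, so that repetitions are allowed.\<close>

definition arrangement :: "nat \<Rightarrow> 'a::euclidean_space set list \<Rightarrow> bool" where
  "arrangement D Hs \<longleftrightarrow> 1 \<le> length Hs \<and> length Hs \<le> D \<and> (\<forall>H\<in>set Hs. hyperplane H)"

definition defining_functions ::
    "('a::euclidean_space \<Rightarrow> real) list \<Rightarrow> 'a set list \<Rightarrow> bool" where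
  "defining_functions As Hs \<longleftrightarrow>
     list_all2 (\<lambda>A H. affine_function A \<and> {x. A x = 0} = H) As Hs"

definition bisected_by :: "'a::euclidean_space measure \<Rightarrow> 'a set list \<Rightarrow> bool" where
  "bisected_by M Hs \<longleftrightarrow>
     (\<exists>As. defining_functions As Hs \<and>
        measure M {v. (\<Prod>A\<leftarrow>As. A v) > 0} \<le> measure M UNIV / 2 \<and>
        measure M {v. (\<Prod>A\<leftarrow>As. A v) < 0} \<le> measure M UNIV / 2)"

text \<open>
  For hyperplanes the existential quantifier over the defining functions may be replaced by a
  universal one: defining functions of the same hyperplane differ by a nonzero factor, so a
  different choice at most swaps the sets where the product is positive and negative.
\<close>

lemma ex_defining_functions:
  assumes "\<forall>H\<in>set Hs. hyperplane H"
  shows "\<exists>As. defining_functions As Hs"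
  using assms
proof (induction Hs)
  case Nil
  then show ?case by (auto simp: defining_functions_def)
next
  case (Cons H Hs)
  then obtain As a b where As: "defining_functions As Hs" and "H = {x. a \<bullet> x = b}"
    by (auto simp: hyperplane_def)
  moreover have "affine_function (\<lambda>x. a \<bullet> x + (- b))"
    unfolding affine_function_def by blast
  ultimately have "defining_functions ((\<lambda>x. a \<bullet> x + (- b)) # As) (H # Hs)"
    by (simp add: defining_functions_def)
  then show ?case ..
qed

lemma affine_function_proportional:
  assumes "hyperplane H"
    and A: "affine_function A" "{x. A x = 0} = H"
    and B: "affine_function B" "{x. B x = 0} = H"
  shows "\<exists>c. c \<noteq> 0 \<and> (\<forall>x. B x = c * A x)"
proof -
  obtain h k where h: "h \<noteq> 0" and H: "H = {x. h \<bullet> x = k}"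
    using assms(1) by (auto simp: hyperplane_def)
  obtain a p where a: "\<And>x. A x = a \<bullet> x + p" using A(1) by (auto simp: affine_function_def)
  obtain b q where b: "\<And>x. B x = b \<bullet> x + q" using B(1) by (auto simp: affine_function_def)
  define x0 where "x0 = (k / (h \<bullet> h)) *\<^sub>R h"
  have x0: "x0 \<in> H" and "x0 + h \<notin> H" using h by (auto simp: H x0_def inner_add_right)
  have A0: "A x0 = 0" and B0: "B x0 = 0" using x0 A(2) B(2) by auto
  have AB: "A x = 0 \<longleftrightarrow> B x = 0" for x using A(2) B(2) by blast
  have Ay: "A (x0 + y) = a \<bullet> y" and By: "B (x0 + y) = b \<bullet> y" for y
    using A0 B0 by (simp_all add: a b inner_add_right)
  have "a \<noteq> 0" using \<open>x0 + h \<notin> H\<close> A(2) Ay[of h] by auto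
  define c where "c = (b \<bullet> a) / (a \<bullet> a)"
  have "b \<bullet> a \<noteq> 0" using AB[of "x0 + a"] \<open>a \<noteq> 0\<close> by (simp add: Ay By)
  then have "c \<noteq> 0" using \<open>a \<noteq> 0\<close> by (simp add: c_def)
  moreover have "B x = c * A x" for x
  proof -
    let ?y = "x - x0"
    let ?z = "?y - ((a \<bullet> ?y) / (a \<bullet> a)) *\<^sub>R a"
    have "a \<bullet> ?z = 0" using \<open>a \<noteq> 0\<close> by (simp add: inner_diff_right)
    then have "b \<bullet> ?z = 0" using AB[of "x0 + ?z"] unfolding Ay By by simp
    then have "b \<bullet> ?y = c * (a \<bullet> ?y)" by (simp add: inner_diff_right c_def)
    then show ?thesis using Ay[of ?y] By[of ?y] by simp
  qed
  ultimately show ?thesis by blast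
qed

lemma prod_defining_functions_proportional:
  assumes "\<forall>H\<in>set Hs. hyperplane H" "defining_functions As Hs" "defining_functions Bs Hs"
  shows "\<exists>c. c \<noteq> 0 \<and> (\<forall>x. (\<Prod>B\<leftarrow>Bs. B x) = c * (\<Prod>A\<leftarrow>As. A x))"
  using assms
proof (induction Hs arbitrary: As Bs)
  case Nil
  then have "As = []" "Bs = []" by (auto simp: defining_functions_def)
  then show ?case by (auto intro: exI[of _ 1])
next
  case (Cons H Hs)
  obtain A As' where As: "As = A # As'" "affine_function A" "{x. A x = 0} = H"
      "defining_functions As' Hs"
    using Cons.prems(2) by (auto simp: defining_functions_def list_all2_Cons2)
  obtain B Bs' where Bs: "Bs = B # Bs'" "affine_function B" "{x. B x = 0} = H"
      "defining_functions Bs' Hs"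
    using Cons.prems(3) by (auto simp: defining_functions_def list_all2_Cons2)
  obtain c where c: "c \<noteq> 0" "\<And>x. B x = c * A x"
    using affine_function_proportional[of H A B] As Bs Cons.prems(1) by auto
  obtain d where d: "d \<noteq> 0" "\<And>x. (\<Prod>B\<leftarrow>Bs'. B x) = d * (\<Prod>A\<leftarrow>As'. A x)"
    using Cons.IH[OF _ As(4) Bs(4)] Cons.prems(1) by auto
  have "c * d \<noteq> 0 \<and> (\<forall>x. (\<Prod>B\<leftarrow>Bs. B x) = (c * d) * (\<Prod>A\<leftarrow>As. A x))"
    using c d by (simp add: As(1) Bs(1))
  then show ?case by blast
qed

lemma bisected_by_iff_all:
  assumes hyp: "\<forall>H\<in>set Hs. hyperplane H"
  shows "bisected_by M Hs \<longleftrightarrow>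
     (\<forall>As. defining_functions As Hs \<longrightarrow>
        measure M {v. (\<Prod>A\<leftarrow>As. A v) > 0} \<le> measure M UNIV / 2 \<and>
        measure M {v. (\<Prod>A\<leftarrow>As. A v) < 0} \<le> measure M UNIV / 2)"
    (is "_ \<longleftrightarrow> (\<forall>As. _ \<longrightarrow> ?bis As)")
proof
  assume "bisected_by M Hs"
  then obtain As where As: "defining_functions As Hs" "?bis As"
    by (auto simp: bisected_by_def)
  show "\<forall>Bs. defining_functions Bs Hs \<longrightarrow> ?bis Bs"
  proof (intro allI impI)
    fix Bs assume "defining_functions Bs Hs"
    then obtain c where c: "c \<noteq> 0" "\<And>x. (\<Prod>B\<leftarrow>Bs. B x) = c * (\<Prod>A\<leftarrow>As. A x)"
      using prod_defining_functions_proportional[OF hyp As(1)] by blast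
    show "?bis Bs"
    proof (cases "c > 0")
      case True
      then show ?thesis using As(2) by (simp add: c(2) zero_less_mult_iff mult_less_0_iff)
    next
      case False
      then have "c < 0" using c(1) by simp
      then show ?thesis using As(2) by (simp add: c(2) zero_less_mult_iff mult_less_0_iff)
    qed
  qed
next
  assume "\<forall>As. defining_functions As Hs \<longrightarrow> ?bis As"
  then show "bisected_by M Hs"
    using ex_defining_functions[OF hyp] by (auto simp: bisected_by_def)
qed

end

theory Submission
  imports Defs "HOL-Combinatorics.Permutations"
begin

text \<open>
  The test map sends a tuple of affine functions \<open>A\<^sub>1, \<dots>, A\<^sub>D\<close>, a point of \<open>(S\<^sup>n)\<^sup>D\<close>, to the
  \<open>n * D\<close> integrals of a clamped multiple of their product. It is equivariant under signed
  permutations of the factors. Its zeros are compared with those of the evaluation map at \<open>n * D\<close>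
  generic points: there the zeros modulo symmetry are the partitions of the points into \<open>D\<close> blocks
  of size \<open>n\<close>, and their number is odd precisely because \<open>n\<close> is a power of two.

  The parity is transported by a version of Fan's lemma. The sphere \<open>S\<^sup>n\<close> is cut into small cells by the
  hyperplanes dual to many points in general position, and \<open>X\<^sub>k\<close> is the complex of those tuples of
  cells whose product vanishes at all but the last \<open>k\<close> of the first \<open>n * D\<close> points. If the test map
  had no zero, then the cells would carry labels \<open>\<plusminus>1, \<dots>, \<plusminus>(n * D)\<close> without complementary neighbours, and
  the number of maximal flags of \<open>X\<^sub>k\<close> with alternating labels, modulo symmetry, would have a parity
  independent of \<open>k\<close>. It is odd for \<open>k = 0\<close>, but a flag for \<open>k = n * D\<close> has too many vertices to
  alternate. The symmetries act freely on flags and on their facets as \<open>n \<ge> 2\<close>, although they fix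
  tuples with repeated entries.
\<close>

section \<open>Alternating labels\<close>

text \<open>The quantity that is followed is the number of alternating flags divided by the group
  order \<open>fact D * 2 ^ D\<close>, of which only the parity matters. For \<open>k = 0\<close>
  this quotient is (nD)! / ((n!)^D D!). Raising \<open>k\<close> by one drops a single equation, and
  the sign of its column divides the larger complex into two halves with the smaller one as common
  boundary, as an equator divides a sphere in the classical proof of Fan's lemma. Flags are used
  instead of cells because cells with nontrivial stabilisers have orbits of different sizes, and a
  count of cells modulo symmetry would say nothing about parity. The products are clamped because
  integrals of their signs do not depend continuously on the factors; signs are recovered by letting
  the multiplier tend to infinity. A point of the sphere may have zero linear part; such a factor is
  a nonzero constant and is discarded at the very end, which is why fewer than \<open>D\<close>
  hyperplanes may result.\<close>

fun altl :: "int \<Rightarrow> int list \<Rightarrow> bool" where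
  "altl s [] = True"
| "altl s (x # xs) = (sgn x = s \<and> altl (- s) xs)"

text \<open>These are the alternating simplices of Fan's lemma. Sorting by absolute value makes the
  notion independent of any order of the vertices.\<close>

definition alternating :: "int \<Rightarrow> ('a \<Rightarrow> int) \<Rightarrow> 'a set \<Rightarrow> bool" where
  "alternating s l L \<longleftrightarrow> inj_on l L \<and>
     (\<exists>xs. set xs = l ` L \<and> sorted_wrt (\<lambda>a b. \<bar>a\<bar> < \<bar>b\<bar>) xs \<and> altl s xs)"

text \<open>Number of positions whose deletion leaves a list alternating from \<open>s\<close>:
  either the head goes, or it stays with sign \<open>s\<close> and the deletion happens
  later.\<close>

fun delete_count :: "int \<Rightarrow> int list \<Rightarrow> nat" where
  "delete_count s [] = 0"
| "delete_count s (x # xs) = of_bool (altl s xs) + (if sgn x = s then delete_count (- s) xs else 0)"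

text \<open>A nonempty list alternating from \<open>s\<close> admits only the deletion of its last
  entry, one alternating from \<open>- s\<close> only that of its first. Any other list admits none,
  or exactly two: the neighbours of equal sign at a single defect. The empty list alternates from
  both signs.\<close>

lemma even_delete_count:
  assumes "s \<in> {1, -1}" "0 \<notin> set xs"
  shows "even (delete_count s xs + of_bool (altl s xs) + of_bool (altl (- s) xs))"
  using assms
proof (induction xs arbitrary: s)
  case (Cons x xs)
  have "sgn x = s \<or> sgn x = - s" using Cons.prems by (auto simp: sgn_if)
  moreover have "s \<noteq> - s" using Cons.prems by auto
  moreover have "even (delete_count (- s) xs + of_bool (altl (- s) xs) + of_bool (altl s xs))"
    using Cons.IH[of "- s"] Cons.prems by auto
  ultimately show ?case by (auto split: if_splits)
qed auto

lemma abs_sorted_unique: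
  fixes xs ys :: "int list"
  assumes "sorted_wrt (\<lambda>a b. \<bar>a\<bar> < \<bar>b\<bar>) xs" "sorted_wrt (\<lambda>a b. \<bar>a\<bar> < \<bar>b\<bar>) ys" "set xs = set ys"
  shows "xs = ys"
  using assms
proof (induction xs arbitrary: ys)
  case (Cons x xs)
  then obtain y ys' where ys: "ys = y # ys'" by (cases ys) auto
  have xy: "x = y"
  proof (rule ccontr)
    assume ne: "x \<noteq> y"
    then have "x \<in> set ys'" "y \<in> set xs" using Cons.prems(3) ys by auto
    then have "\<bar>y\<bar> < \<bar>x\<bar>" "\<bar>x\<bar> < \<bar>y\<bar>" using Cons.prems ys by auto
    then show False by simp
  qed
  have "x \<notin> set xs" "x \<notin> set ys'" using Cons.prems ys xy by auto
  then have "set xs = set ys'" using Cons.prems(3) ys xy by auto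
  then show ?case using Cons ys xy by auto
qed auto

text \<open>A set of labels has only one list sorted strictly by absolute value, so deleting an
  entry of \<open>xs\<close> amounts to passing to the face without that label.\<close>

lemma delete_count_eq_card:
  assumes "sorted_wrt (\<lambda>a b. \<bar>a\<bar> < \<bar>b\<bar>) xs"
  shows "delete_count s xs = card {x \<in> set xs. \<exists>ys. set ys = set xs - {x} \<and>
            sorted_wrt (\<lambda>a b. \<bar>a\<bar> < \<bar>b\<bar>) ys \<and> altl s ys}"
  using assms
proof (induction xs arbitrary: s)
  case (Cons x xs)
  let ?S = "sorted_wrt (\<lambda>a b::int. \<bar>a\<bar> < \<bar>b\<bar>)"
  let ?R = "\<lambda>s xs z. \<exists>ys. set ys = set xs - {z} \<and> ?S ys \<and> altl s ys"
  have xxs: "x \<notin> set xs" "?S xs" using Cons.prems by auto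
  have 1: "?R s (x # xs) x \<longleftrightarrow> altl s xs"
  proof
    assume "?R s (x # xs) x"
    then obtain ys where "set ys = set xs" "?S ys" "altl s ys" using xxs by auto
    then show "altl s xs" using abs_sorted_unique[of ys xs] xxs by auto
  qed (use xxs in auto)
  have 2: "?R s (x # xs) z \<longleftrightarrow> sgn x = s \<and> ?R (- s) xs z" if z: "z \<in> set xs" for z
  proof
    assume "?R s (x # xs) z"
    then obtain ys where ys: "set ys = insert x (set xs - {z})" "?S ys" "altl s ys"
      using xxs z by auto
    then obtain y ys' where yy: "ys = y # ys'" by (cases ys) auto
    have "y = x"
    proof (rule ccontr)
      assume "y \<noteq> x"
      then have "x \<in> set ys'" "y \<in> set xs" using ys yy by auto
      then have "\<bar>y\<bar> < \<bar>x\<bar>" "\<bar>x\<bar> < \<bar>y\<bar>" using ys yy Cons.prems by auto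
      then show False by simp
    qed
    moreover have "y \<notin> set ys'" using ys yy by auto
    ultimately have "set ys' = set xs - {z}" using ys yy xxs by auto
    then show "sgn x = s \<and> ?R (- s) xs z" using ys yy \<open>y = x\<close> by auto
  next
    assume "sgn x = s \<and> ?R (- s) xs z"
    then obtain ys where "sgn x = s" "set ys = set xs - {z}" "?S ys" "altl (- s) ys" by auto
    then have "set (x # ys) = set (x # xs) - {z} \<and> ?S (x # ys) \<and> altl s (x # ys)"
      using z xxs Cons.prems by auto
    then show "?R s (x # xs) z" by blast
  qed
  define R where "R = ?R"
  have R: "R s (x # xs) x \<longleftrightarrow> altl s xs"
    "\<And>z. z \<in> set xs \<Longrightarrow> R s (x # xs) z \<longleftrightarrow> sgn x = s \<and> R (- s) xs z"
    unfolding R_def by (fact 1) (fact 2)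
  have IH: "delete_count (- s) xs = card {z \<in> set xs. R (- s) xs z}"
    unfolding R_def using Cons.IH xxs by blast
  have "{z \<in> set (x # xs). R s (x # xs) z} =
      (if altl s xs then {x} else {}) \<union> (if sgn x = s then {z \<in> set xs. R (- s) xs z} else {})"
    using R xxs by auto
  moreover have "card \<dots> = of_bool (altl s xs) + (if sgn x = s then delete_count (- s) xs else 0)"
    unfolding IH using xxs by (subst card_Un_disjoint) auto
  ultimately have "delete_count s (x # xs) = card {z \<in> set (x # xs). R s (x # xs) z}" by simp
  then show ?case unfolding R_def .
qed auto

lemma alternating_uminus: "alternating s (\<lambda>x. - l x) L \<longleftrightarrow> alternating (- s) l L"
proof -
  have altl: "altl s (map uminus xs) \<longleftrightarrow> altl (- s) xs" for s xs
  proof (induction xs arbitrary: s)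
    case (Cons x xs)
    have "sgn (- x) = s \<longleftrightarrow> sgn x = - s" by (auto simp: sgn_if)
    then show ?case using Cons[of "- s"] by simp
  qed simp
  have sorted: "sorted_wrt (\<lambda>a b::int. \<bar>a\<bar> < \<bar>b\<bar>) (map uminus xs) \<longleftrightarrow> sorted_wrt (\<lambda>a b. \<bar>a\<bar> < \<bar>b\<bar>) xs" for xs
    by (simp add: sorted_wrt_map)
  have *: "alternating (- s) l L" if "alternating s (\<lambda>x. - l x) L" for s and l :: "'a \<Rightarrow> int"
  proof -
    from that obtain xs where xs: "set xs = (\<lambda>x. - l x) ` L"
      "sorted_wrt (\<lambda>a b. \<bar>a\<bar> < \<bar>b\<bar>) xs" "altl s xs" and inj: "inj_on (\<lambda>x. - l x) L"
      by (auto simp: alternating_def)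
    have "set (map uminus xs) = l ` L" by (auto simp: xs(1) image_image)
    moreover have "inj_on l L" using inj by (auto simp: inj_on_def)
    moreover have "altl (- s) (map uminus xs)" by (simp add: altl xs)
    ultimately show ?thesis unfolding alternating_def using sorted xs(2) by blast
  qed
  show ?thesis using *[of s l] *[of "- s" "\<lambda>x. - l x"] by auto
qed

lemma alternating_cong:
  assumes "\<And>x. x \<in> L \<Longrightarrow> l x = l' x"
  shows "alternating s l L \<longleftrightarrow> alternating s l' L"
proof -
  have "l ` L = l' ` L" "inj_on l L \<longleftrightarrow> inj_on l' L" using assms by (auto simp: inj_on_def image_iff)
  then show ?thesis by (simp add: alternating_def)
qed

lemma alternating_inj_abs:
  assumes "alternating s l L"
  shows "inj_on (\<lambda>x. \<bar>l x\<bar>) L"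
proof (rule inj_onI)
  fix x y assume xy: "x \<in> L" "y \<in> L" "\<bar>l x\<bar> = \<bar>l y\<bar>"
  obtain xs where xs: "set xs = l ` L" "sorted_wrt (\<lambda>a b. \<bar>a\<bar> < \<bar>b\<bar>) xs" "inj_on l L"
    using assms by (auto simp: alternating_def)
  have "a = b" if "a \<in> set xs" "b \<in> set xs" "\<bar>a\<bar> = \<bar>b\<bar>" for a b
    using xs(2) that by (induction xs) fastforce+
  then show "x = y" using xy xs by (auto dest: inj_onD)
qed

lemma not_alternating_both:
  assumes "alternating s l L" "alternating (- s) l L" "L \<noteq> {}" "s \<in> {1, -1}"
  shows False
proof -
  obtain xs ys where xs: "set xs = l ` L" "sorted_wrt (\<lambda>a b. \<bar>a\<bar> < \<bar>b\<bar>) xs" "altl s xs"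
    and ys: "set ys = l ` L" "sorted_wrt (\<lambda>a b. \<bar>a\<bar> < \<bar>b\<bar>) ys" "altl (- s) ys"
    using assms unfolding alternating_def by blast
  have "xs = ys" using abs_sorted_unique xs ys by auto
  moreover obtain z zs where "xs = z # zs" using xs(1) assms(3) by (cases xs) auto
  ultimately show False using xs ys assms(4) by auto
qed

text \<open>The local step of Fan's lemma.\<close>

lemma even_alternating_faces:
  assumes L: "finite L" "L \<noteq> {}" and s: "s \<in> {1, -1}"
    and nz: "\<And>x. x \<in> L \<Longrightarrow> l x \<noteq> 0"
    and compl: "\<And>x y. x \<in> L \<Longrightarrow> y \<in> L \<Longrightarrow> l x + l y \<noteq> 0"
  shows "even (card {m \<in> L. alternating s l (L - {m})} +
           of_bool (alternating s l L \<or> alternating (- s) l L))"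
proof (cases "inj_on l L")
  case False
  then obtain a b where ab: "a \<in> L" "b \<in> L" "a \<noteq> b" "l a = l b" by (auto simp: inj_on_def)
  \<comment> \<open>An alternating face must omit one of two vertices with equal labels. Omitting
    either leaves the same label set, so such faces occur as a pair or not at all.\<close>
  have sub: "{m \<in> L. alternating s l (L - {m})} \<subseteq> {a, b}"
  proof
    fix m assume "m \<in> {m \<in> L. alternating s l (L - {m})}"
    then have inj: "inj_on l (L - {m})" by (simp add: alternating_def)
    show "m \<in> {a, b}"
    proof (rule ccontr)
      assume "m \<notin> {a, b}"
      then show False using inj_onD[OF inj ab(4)] ab(1-3) by auto
    qed
  qed
  have im: "l ` (L - {a}) = l ` (L - {b})"
  proof -
    have "L - {a} = insert b (L - {a, b})" "L - {b} = insert a (L - {a, b})" using ab by auto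
    then show ?thesis using ab(4) by simp
  qed
  have "inj_on l (L - {a}) \<longleftrightarrow> inj_on l (L - {b})"
    using L ab by (simp add: inj_on_iff_eq_card im card_Diff_singleton)
  then have "alternating s l (L - {a}) \<longleftrightarrow> alternating s l (L - {b})"
    by (simp add: alternating_def im)
  then have "{m \<in> L. alternating s l (L - {m})} \<in> {{}, {a, b}}"
    using sub ab by auto
  then have "card {m \<in> L. alternating s l (L - {m})} \<in> card ` {{}, {a, b}}"
    by (rule imageI)
  then have "even (card {m \<in> L. alternating s l (L - {m})})" using ab(3) by auto
  then show ?thesis using False by (simp add: alternating_def)
next
  case inj: True
  \<comment> \<open>Distinct labels of equal absolute value would be opposite, and opposite labels
    are excluded.\<close>
  have inj_abs: "inj_on abs (l ` L)"
  proof (rule inj_onI)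
    fix a b assume ab: "a \<in> l ` L" "b \<in> l ` L" "\<bar>a\<bar> = \<bar>b\<bar>"
    then have "a + b \<noteq> 0" using compl by auto
    then show "a = b" using ab(3) by linarith
  qed
  define xs where "xs = sort_key abs (sorted_list_of_set (l ` L))"
  have sx: "set xs = l ` L" "sorted_wrt (\<lambda>a b. \<bar>a\<bar> < \<bar>b\<bar>) xs"
  proof -
    show set: "set xs = l ` L" unfolding xs_def using L by simp
    have "distinct xs" unfolding xs_def by simp
    then have "distinct (map abs xs)" using inj_abs by (simp add: distinct_map set)
    moreover have "sorted (map abs xs)" unfolding xs_def by simp
    ultimately have "sorted_wrt (<) (map abs xs)" by (simp add: strict_sorted_iff)
    then show "sorted_wrt (\<lambda>a b. \<bar>a\<bar> < \<bar>b\<bar>) xs" by (simp add: sorted_wrt_map)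
  qed
  have alt: "alternating s' l L \<longleftrightarrow> altl s' xs" for s'
  proof
    assume "alternating s' l L"
    then obtain ys where "set ys = l ` L" "sorted_wrt (\<lambda>a b. \<bar>a\<bar> < \<bar>b\<bar>) ys" "altl s' ys"
      by (auto simp: alternating_def)
    then show "altl s' xs" using abs_sorted_unique[of ys xs] sx by simp
  next
    assume "altl s' xs"
    then show "alternating s' l L" unfolding alternating_def using inj sx by blast
  qed
  have "{x \<in> set xs. \<exists>ys. set ys = set xs - {x} \<and> sorted_wrt (\<lambda>a b. \<bar>a\<bar> < \<bar>b\<bar>) ys \<and> altl s ys}
      = l ` {m \<in> L. alternating s l (L - {m})}"
  proof -
    have "l ` (L - {m}) = l ` L - {l m}" if "m \<in> L" for m
      using inj that by (auto dest: inj_onD)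
    moreover have "inj_on l (L - {m})" for m using inj by (rule inj_on_subset) auto
    ultimately have "(\<exists>ys. set ys = l ` L - {l m} \<and> sorted_wrt (\<lambda>a b. \<bar>a\<bar> < \<bar>b\<bar>) ys \<and> altl s ys)
        \<longleftrightarrow> alternating s l (L - {m})" if "m \<in> L" for m
      using that by (simp add: alternating_def)
    then show ?thesis unfolding sx(1) by blast
  qed
  then have "delete_count s xs = card (l ` {m \<in> L. alternating s l (L - {m})})"
    using delete_count_eq_card[OF sx(2), of s] by simp
  also have "\<dots> = card {m \<in> L. alternating s l (L - {m})}"
    by (rule card_image) (rule inj_on_subset[OF inj], auto)
  finally have dc: "delete_count s xs = card {m \<in> L. alternating s l (L - {m})}" .
  have "0 \<notin> set xs" using sx nz by auto
  then have "even (delete_count s xs + of_bool (altl s xs) + of_bool (altl (- s) xs))"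
    using even_delete_count[OF s] by blast
  moreover have "\<not> (altl s xs \<and> altl (- s) xs)"
    using not_alternating_both[OF _ _ L(2) s, of l] alt by blast
  ultimately show ?thesis unfolding dc alt by (cases "altl s xs"; cases "altl (- s) xs") simp_all
qed

section \<open>Counting modulo a free group action\<close>

text \<open>\<open>S\<close> splits into orbits of size \<open>card I\<close>, and \<open>w\<close>
  is constant on each: the inequality for a group element and the one for its inverse force
  equality. The induction removes one orbit at a time.\<close>

lemma free_action_dvd_sum:
  fixes w :: "'x \<Rightarrow> nat"
  assumes "finite S" "finite I" "I \<noteq> {}"
    and closed: "\<And>g x. g \<in> I \<Longrightarrow> x \<in> S \<Longrightarrow> act g x \<in> S"
    and free: "\<And>x. x \<in> S \<Longrightarrow> inj_on (\<lambda>g. act g x) I"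
    and inverse: "\<And>g x. g \<in> I \<Longrightarrow> x \<in> S \<Longrightarrow> \<exists>h\<in>I. act h (act g x) = x"
    and comp: "\<And>g h x. g \<in> I \<Longrightarrow> h \<in> I \<Longrightarrow> x \<in> S \<Longrightarrow> \<exists>k\<in>I. act g (act h x) = act k x"
    and w: "\<And>g x. g \<in> I \<Longrightarrow> x \<in> S \<Longrightarrow> w x \<le> w (act g x)"
    and e: "\<And>x. x \<in> S \<Longrightarrow> e dvd w x"
  shows "e * card I dvd sum w S"
  using \<open>finite S\<close> closed free inverse comp w e
proof (induction "card S" arbitrary: S rule: less_induct)
  case less
  show ?case
  proof (cases "S = {}")
    case True
    then show ?thesis by simp
  next
    case False
    then obtain x where x: "x \<in> S" by auto
    define Q where "Q = (\<lambda>g. act g x) ` I"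
    have QS: "Q \<subseteq> S" using x less.prems by (auto simp: Q_def)
    have stable: "y \<in> Q" if y: "y \<in> S" "g \<in> I" "act g y \<in> Q" for y g
    proof -
      obtain h where h: "h \<in> I" "act h (act g y) = y" using less.prems(4)[OF y(2,1)] by blast
      obtain k where k: "k \<in> I" "act g y = act k x" using y by (auto simp: Q_def)
      obtain k' where "k' \<in> I" "act h (act k x) = act k' x" using less.prems(5)[OF h(1) k(1) x] by blast
      then have "y = act k' x" "k' \<in> I" using h k by auto
      then show ?thesis by (auto simp: Q_def)
    qed
    have wQ: "w y = w x" if y: "y \<in> Q" for y
    proof -
      obtain g where g: "g \<in> I" "y = act g x" using y by (auto simp: Q_def)
      obtain h where h: "h \<in> I" "act h y = x" using less.prems(4) g x by blast
      have "w x \<le> w y" using less.prems(6)[OF g(1) x] g by simp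
      moreover have "w y \<le> w (act h y)" using less.prems(6)[OF h(1), of y] QS y by auto
      ultimately show ?thesis using h by simp
    qed
    have "sum w Q = card I * w x"
      using wQ card_image[OF less.prems(3)[OF x]] by (simp add: Q_def)
    then have 1: "e * card I dvd sum w Q" using less.prems(7)[OF x] by (simp add: mult.commute mult_dvd_mono)
    have "Q \<noteq> {}" using \<open>I \<noteq> {}\<close> by (auto simp: Q_def)
    then have "card (S - Q) < card S" using QS less.prems(1) by (intro psubset_card_mono) auto
    moreover have "act g y \<in> S - Q" if "g \<in> I" "y \<in> S - Q" for g y
      using that stable[of y g] less.prems(2) by auto
    ultimately have "e * card I dvd sum w (S - Q)"
      using less.prems by (intro less.hyps) auto
    then show ?thesis using 1 sum.subset_diff[OF QS less.prems(1), of w] by simp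
  qed
qed

text \<open>The two-element group acts freely, with \<open>True\<close> acting as
  \<open>f\<close>.\<close>

lemma even_card_involution:
  assumes "finite S" "\<And>x. x \<in> S \<Longrightarrow> f x \<in> S \<and> f x \<noteq> x \<and> f (f x) = x"
  shows "even (card S)"
proof -
  have "1 * card {True, False} dvd sum (\<lambda>_. 1) S"
  proof (rule free_action_dvd_sum[where act = "\<lambda>b x. if b then f x else x"])
    show "\<exists>k\<in>{True, False}. (if g then f (if h then f x else x) else if h then f x else x)
         = (if k then f x else x)"
      if "x \<in> S" for g h x using assms that by (cases g; cases h) auto
      show "inj_on (\<lambda>b. if b then f x else x) {True, False}" if "x \<in> S" for x
      using assms(2)[OF that] by (auto simp: inj_on_def)
  qed (use assms in auto)
  then show ?thesis by (simp add: numeral_2_eq_2)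
qed

section \<open>Parity of binomial and multinomial coefficients\<close>

text \<open>Lucas's theorem modulo 2 for the last binary digit. The four parities are proved
  together because Pascal's rule relates them.\<close>

lemma lucas_two:
  "even ((2 * a) choose (2 * b)) = even (a choose b) \<and>
   even ((2 * a) choose Suc (2 * b)) \<and>
   even (Suc (2 * a) choose (2 * b)) = even (a choose b) \<and>
   even (Suc (2 * a) choose Suc (2 * b)) = even (a choose b)"
proof (induction a arbitrary: b)
  case 0
  show ?case by (cases b) auto
next
  case (Suc a)
  show ?case
  proof (cases b)
    case 0
    then show ?thesis using Suc[of 0] by auto
  next
    case (Suc b')
    then show ?thesis using Suc.IH[of b'] Suc.IH[of "Suc b'"] by auto
  qed
qed

text \<open>In binary both arguments end in \<open>l\<close> ones; stripping them leaves a binomial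
  coefficient with lower index 0.\<close>

lemma odd_binomial_power_of_two:
  assumes "m > 0"
  shows "odd ((2 ^ l * m - 1) choose (2 ^ l - 1))"
proof (induction l)
  case (Suc l)
  obtain a where a: "2 ^ l * m = Suc a" using assms by (metis not0_implies_Suc mult_is_0 power_not_zero numeral_2_eq_2 nat.distinct(1) less_numeral_extra(3))
  obtain b where b: "(2::nat) ^ l = Suc b" by (metis not0_implies_Suc power_not_zero zero_neq_numeral)
  have "2 ^ Suc l * m - 1 = Suc (2 * a)" "(2::nat) ^ Suc l - 1 = Suc (2 * b)" using a b by auto
  then show ?case using Suc lucas_two[of a b] a b by simp
qed auto

section \<open>Sign systems and signed permutations\<close>

text \<open>A multinomial coefficient, counting ordered partitions into blocks of size
  \<open>n\<close>. It appears as a product because the induction chooses the last block and is left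
  with a partition of the same kind.\<close>

lemma card_equal_size_families:
  assumes "finite A" "card A = n * d" "n > 0"
  shows "card {F \<in> {..<d} \<rightarrow>\<^sub>E Pow A. (\<forall>i<d. card (F i) = n) \<and> disjoint_family_on F {..<d} \<and>
    (\<Union>i<d. F i) = A} = (\<Prod>i<d. (n * Suc i) choose n)" (is "card (?Fam A d) = _")
  using assms
proof (induction d arbitrary: A)
  case 0
  then have "?Fam A 0 = {\<lambda>_. undefined}" by (auto simp: disjoint_family_on_def)
  then show ?case by simp
next
  case (Suc d)
  let ?B = "{B. B \<subseteq> A \<and> card B = n}"
  let ?f = "\<lambda>(B, F). F(d := B)"
  have bij: "bij_betw ?f (SIGMA B:?B. ?Fam (A - B) d) (?Fam A (Suc d))"
  proof (rule bij_betwI[where g = "\<lambda>F. (F d, F(d := undefined))"])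
    show "?f \<in> (SIGMA B:?B. ?Fam (A - B) d) \<rightarrow> ?Fam A (Suc d)"
    proof
      fix x assume x: "x \<in> (SIGMA B:?B. ?Fam (A - B) d)"
      obtain B F where BF: "x = (B, F)" by (cases x)
      have B: "B \<subseteq> A" "card B = n" and F: "F \<in> {..<d} \<rightarrow>\<^sub>E Pow (A - B)" "\<forall>i<d. card (F i) = n"
        "disjoint_family_on F {..<d}" "(\<Union>i<d. F i) = A - B"
        using x unfolding BF by auto
      have FB: "F i \<subseteq> A - B" if "i < d" for i using F(1) that by (auto simp: PiE_iff)
      have "F(d := B) \<in> {..<Suc d} \<rightarrow>\<^sub>E Pow A"
        using F(1) B by (auto simp: PiE_iff lessThan_Suc extensional_def)
      moreover have "disjoint_family_on (F(d := B)) {..<Suc d}"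
        unfolding disjoint_family_on_def
      proof (intro ballI impI)
        fix i i' assume "i \<in> {..<Suc d}" "i' \<in> {..<Suc d}" "i \<noteq> i'"
        then consider "i < d" "i' < d" | "i < d" "i' = d" | "i = d" "i' < d" by (simp add: less_Suc_eq) blast
        then show "(F(d := B)) i \<inter> (F(d := B)) i' = {}"
        proof cases
          case 1
          then show ?thesis using F(3) \<open>i \<noteq> i'\<close> by (simp add: disjoint_family_on_def)
        next
          case 2
          then show ?thesis using FB[of i] by auto
        next
          case 3
          then show ?thesis using FB[of i'] by auto
        qed
      qed
      moreover have "(\<Union>i<Suc d. (F(d := B)) i) = A"
      proof -
        have "(\<Union>i<Suc d. (F(d := B)) i) = B \<union> (\<Union>i<d. F i)"
          by (auto simp: lessThan_Suc)
        then show ?thesis using F(4) B by auto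
      qed
      moreover have "\<forall>i<Suc d. card ((F(d := B)) i) = n" using F(2) B by auto
      ultimately show "?f x \<in> ?Fam A (Suc d)" by (simp only: BF prod.case mem_Collect_eq simp_thms)
    qed
    show "(\<lambda>F. (F d, F(d := undefined))) \<in> ?Fam A (Suc d) \<rightarrow> (SIGMA B:?B. ?Fam (A - B) d)"
    proof
      fix F assume F: "F \<in> ?Fam A (Suc d)"
      have Fd: "F d \<subseteq> A" "card (F d) = n" using F by (auto simp: PiE_iff)
      have disj: "F i \<inter> F d = {}" if "i < d" for i
        using F that by (auto simp: disjoint_family_on_def)
      have un: "A = (\<Union>i<d. F i) \<union> F d" using F by (auto simp: lessThan_Suc)
      have "F(d := undefined) \<in> {..<d} \<rightarrow>\<^sub>E Pow (A - F d)"
        using F disj un by (auto simp: PiE_iff extensional_def lessThan_Suc)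
      moreover have "disjoint_family_on (F(d := undefined)) {..<d}"
        using F by (auto simp: disjoint_family_on_def)
      moreover have "(\<Union>i<d. (F(d := undefined)) i) = A - F d"
        using un disj by auto
      moreover have "\<forall>i<d. card ((F(d := undefined)) i) = n" using F by auto
      ultimately show "(F d, F(d := undefined)) \<in> (SIGMA B:?B. ?Fam (A - B) d)"
        using Fd by simp
    qed
    show "(\<lambda>F. (F d, F(d := undefined))) (?f x) = x" if "x \<in> (SIGMA B:?B. ?Fam (A - B) d)" for x
    proof -
      obtain B F where x: "x = (B, F)" by (cases x)
      then have "F d = undefined" using that by (auto simp: PiE_iff extensional_def)
      then show ?thesis by (simp add: x fun_upd_idem)
    qed
    show "?f ((\<lambda>F. (F d, F(d := undefined))) F) = F" for F by auto
  qed
  have fam: "card (?Fam (A - B) d) = (\<Prod>i<d. (n * Suc i) choose n)" if "B \<in> ?B" for B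
  proof (rule Suc.IH)
    show "card (A - B) = n * d" using that Suc.prems
      finite_subset[of B A] by (simp add: card_Diff_subset)
  qed (use Suc.prems in auto)
  have fin: "finite (?Fam (A - B) d)" for B
    by (rule finite_subset[of _ "{..<d} \<rightarrow>\<^sub>E Pow (A - B)"]) (use Suc.prems in \<open>auto intro!: finite_PiE\<close>)
  have "card (?Fam A (Suc d)) = card (SIGMA B:?B. ?Fam (A - B) d)"
    using bij_betw_same_card[OF bij] by simp
  also have "\<dots> = (\<Sum>B\<in>?B. card (?Fam (A - B) d))"
    using Suc.prems fin by (intro card_SigmaI) auto
  also have "\<dots> = card ?B * (\<Prod>i<d. (n * Suc i) choose n)" using fam by simp
  also have "card ?B = (n * Suc d) choose n" using Suc.prems n_subsets[of A n] by simp
  finally show ?case by (simp add: mult.commute)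
qed

text \<open>Absorption turns each factor into \<open>Suc i\<close> times the binomial coefficient
  with both arguments lowered by one, which is odd for a power of two. The factors
  \<open>Suc i\<close> make up the factorial.\<close>

lemma odd_multinomial_div_fact:
  assumes "n = 2 ^ l"
  shows "\<exists>q. odd q \<and> (\<Prod>i<d. (n * Suc i) choose n) = fact d * q"
proof (induction d)
  case (Suc d)
  obtain q where q: "odd q" "(\<Prod>i<d. (n * Suc i) choose n) = fact d * q" using Suc by blast
  obtain m where m: "n = Suc m" using assms by (metis not0_implies_Suc power_not_zero zero_neq_numeral)
  obtain a where a: "n * Suc d = Suc a" using m by simp
  have eq: "n * (n * Suc d choose n) = n * (Suc d * (a choose m))"
    using Suc_times_binomial[of m a] unfolding a m[symmetric] by (simp only: a[symmetric] mult.assoc)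
  have "n \<noteq> 0" using m by simp
  have "(n * Suc d choose n) = Suc d * (a choose m)"
    by (rule iffD1[OF mult_left_cancel[OF \<open>n \<noteq> 0\<close>] eq])
  moreover have "odd (a choose m)"
    using odd_binomial_power_of_two[of "Suc d" l] a m by (simp add: assms[symmetric])
  ultimately show ?case using q by (intro exI[of _ "q * (a choose m)"]) (simp add: algebra_simps)
qed auto

text \<open>Inclusion of a face in the closure of another: a nonzero sign is kept, a zero may become
  any sign.\<close>

definition face_le :: "(nat \<Rightarrow> int) \<Rightarrow> (nat \<Rightarrow> int) \<Rightarrow> bool" where
  "face_le s t \<longleftrightarrow> (\<forall>j. s j \<noteq> 0 \<longrightarrow> t j = s j)"

definition zeros :: "nat \<Rightarrow> (nat \<Rightarrow> int) \<Rightarrow> nat set" where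
  "zeros M s = {j. j < M \<and> s j = 0}"

lemma finite_zeros [simp]: "finite (zeros M s)"
  by (simp add: zeros_def)

lemma face_le_refl [simp]: "face_le s s"
  by (simp add: face_le_def)

lemma face_le_trans: "face_le s t \<Longrightarrow> face_le t u \<Longrightarrow> face_le s u"
  by (simp add: face_le_def)

lemma zeros_antimono: "face_le s t \<Longrightarrow> zeros M t \<subseteq> zeros M s"
  by (auto simp: face_le_def zeros_def)

text \<open>
  The faces of a central arrangement of \<open>M\<close> hyperplanes in general position in dimension
  \<open>n + 1\<close>, encoded by their sign vectors, which are extended by \<open>0\<close> beyond \<open>M\<close>.
\<close>

locale sign_system =
  fixes n l D M :: nat and P :: "(nat \<Rightarrow> int) set"
  assumes n_power: "n = 2 ^ l" and n_ge_2: "n \<ge> 2" and D_pos: "D > 0" and M_gt: "n * D < M"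
    and signs: "s \<in> P \<Longrightarrow> s j \<in> {-1, 0, 1}"
    and outside: "s \<in> P \<Longrightarrow> j \<ge> M \<Longrightarrow> s j = 0"
    and card_zeros_le: "s \<in> P \<Longrightarrow> card (zeros M s) \<le> n"
    and fill: "s \<in> P \<Longrightarrow> face_le s t \<Longrightarrow> (\<And>j. t j \<in> {-1, 0, 1}) \<Longrightarrow> (\<And>j. j \<ge> M \<Longrightarrow> t j = 0) \<Longrightarrow> t \<in> P"
    and uminus: "s \<in> P \<Longrightarrow> (\<lambda>j. - s j) \<in> P"
    and card_vertices: "Z \<subseteq> {..<M} \<Longrightarrow> card Z = n \<Longrightarrow> card {s \<in> P. zeros M s = Z} = 2"
    and card_endpoints: "s \<in> P \<Longrightarrow> card (zeros M s) = n - 1 \<Longrightarrow>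
      card {t \<in> P. face_le t s \<and> card (zeros M t) = n} = 2"
begin

lemma finite_P: "finite P"
proof (rule finite_subset)
  show "P \<subseteq> {f. \<forall>x. (x \<in> {..<M} \<longrightarrow> f x \<in> {-1, 0, 1}) \<and> (x \<notin> {..<M} \<longrightarrow> f x = 0)}"
    using signs outside by auto
  show "finite \<dots>" by (rule finite_set_of_finite_funs) auto
qed

text \<open>Rows beyond \<open>D\<close> are set to the zero vector, which is not in
  \<open>P\<close>, so that equality of functions is equality of \<open>D\<close>-tuples.\<close>

definition cells :: "(nat \<Rightarrow> nat \<Rightarrow> int) set" where
  "cells = {Q. (\<forall>i<D. Q i \<in> P) \<and> (\<forall>i\<ge>D. Q i = (\<lambda>_. 0))}"

definition cell_le :: "(nat \<Rightarrow> nat \<Rightarrow> int) \<Rightarrow> (nat \<Rightarrow> nat \<Rightarrow> int) \<Rightarrow> bool" where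
  "cell_le Q R \<longleftrightarrow> (\<forall>i. face_le (Q i) (R i))"

text \<open>The equations satisfied by a cell. Their number is its codimension in the product of the
  spheres, so the dimension is \<open>n * D - card (cell_zeros Q)\<close>.\<close>

definition cell_zeros :: "(nat \<Rightarrow> nat \<Rightarrow> int) \<Rightarrow> (nat \<times> nat) set" where
  "cell_zeros Q = (SIGMA i:{..<D}. zeros M (Q i))"

text \<open>The sign of the product of all factors at the \<open>j\<close>-th point.\<close>

definition column :: "(nat \<Rightarrow> nat \<Rightarrow> int) \<Rightarrow> nat \<Rightarrow> int" where
  "column Q j = (\<Prod>i<D. Q i j)"

lemma finite_cells: "finite cells"
proof (rule finite_subset)
  show "cells \<subseteq> {f. \<forall>x. (x \<in> {..<D} \<longrightarrow> f x \<in> P) \<and> (x \<notin> {..<D} \<longrightarrow> f x = (\<lambda>_. 0))}"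
    by (auto simp: cells_def)
  show "finite \<dots>" by (rule finite_set_of_finite_funs) (auto simp: finite_P)
qed

lemma cells_sign: "Q \<in> cells \<Longrightarrow> Q i j \<in> {-1, 0, 1}"
  using signs by (cases "i < D") (auto simp: cells_def)

lemma cells_outside: "Q \<in> cells \<Longrightarrow> j \<ge> M \<Longrightarrow> Q i j = 0"
  using outside by (cases "i < D") (auto simp: cells_def)

lemma cells_outside': "Q \<in> cells \<Longrightarrow> i \<ge> D \<Longrightarrow> Q i j = 0"
  by (auto simp: cells_def)

lemma cells_nonzero:
  assumes "Q \<in> cells" "i < D"
  shows "\<exists>j<M. Q i j \<noteq> 0"
proof (rule ccontr)
  assume "\<not> (\<exists>j<M. Q i j \<noteq> 0)"
  then have "zeros M (Q i) = {..<M}" by (auto simp: zeros_def)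
  then have "M \<le> n" using card_zeros_le[of "Q i"] assms by (simp add: cells_def)
  moreover have "n * 1 \<le> n * D" using D_pos by (intro mult_le_mono) auto
  ultimately show False using M_gt by linarith
qed

lemma cells_fill:
  assumes "Q \<in> cells" "cell_le Q R" "\<And>i j. R i j \<in> {-1, 0, 1}"
    "\<And>i j. j \<ge> M \<Longrightarrow> R i j = 0" "\<And>i j. i \<ge> D \<Longrightarrow> R i j = 0"
  shows "R \<in> cells"
  using assms fill[of "Q i" "R i" for i] by (auto simp: cells_def cell_le_def fun_eq_iff)

lemma finite_cell_zeros [simp]: "finite (cell_zeros Q)"
  by (simp add: cell_zeros_def)

lemma mem_cell_zeros: "(i, j) \<in> cell_zeros Q \<longleftrightarrow> i < D \<and> j < M \<and> Q i j = 0"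
  by (auto simp: cell_zeros_def zeros_def)

lemma card_cell_zeros: "card (cell_zeros Q) = (\<Sum>i<D. card (zeros M (Q i)))"
  by (simp add: cell_zeros_def)

lemma cell_le_refl [simp]: "cell_le Q Q"
  by (simp add: cell_le_def)

lemma cell_le_trans: "cell_le Q R \<Longrightarrow> cell_le R T \<Longrightarrow> cell_le Q T"
  unfolding cell_le_def using face_le_trans by blast

lemma cell_leD: "cell_le Q R \<Longrightarrow> Q i j \<noteq> 0 \<Longrightarrow> R i j = Q i j"
  by (simp add: cell_le_def face_le_def)

lemma cell_zeros_antimono: "cell_le Q R \<Longrightarrow> cell_zeros R \<subseteq> cell_zeros Q"
  using cell_leD by (auto simp: mem_cell_zeros) (metis)

lemma column_eq_0_iff: "column Q j = 0 \<longleftrightarrow> (\<exists>i<D. Q i j = 0)"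
  by (auto simp: column_def)

lemma column_mono: "cell_le Q R \<Longrightarrow> column R j = 0 \<Longrightarrow> column Q j = 0"
  using cell_leD by (auto simp: column_eq_0_iff) (metis)

lemma column_cong_le:
  assumes "cell_le Q R" "column Q j \<noteq> 0"
  shows "column R j = column Q j"
  unfolding column_def using assms(2) cell_leD[OF assms(1)]
  by (intro prod.cong) (auto simp: column_eq_0_iff)

lemma column_sign:
  assumes "Q \<in> cells" "column Q j \<noteq> 0"
  shows "column Q j \<in> {1, -1}"
proof -
  have "\<bar>Q i j\<bar> = 1" if "i < D" for i
    using cells_sign[OF assms(1), of i j] assms(2) that by (auto simp: column_eq_0_iff)
  then have "\<bar>column Q j\<bar> = 1" by (simp add: column_def abs_prod)
  then show ?thesis by auto
qed

text \<open>Pigeonhole: \<open>q\<close> zeros that meet all of the first \<open>q\<close> columns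
  meet each of them once and no other column.\<close>

lemma covered_columns:
  assumes "card (cell_zeros Q) = q" "\<And>j. j < q \<Longrightarrow> column Q j = 0" "q \<le> M"
  shows "snd ` cell_zeros Q = {..<q}" "inj_on snd (cell_zeros Q)"
proof -
  have sub: "{..<q} \<subseteq> snd ` cell_zeros Q"
  proof
    fix j assume "j \<in> {..<q}"
    then obtain i where "i < D" "Q i j = 0" using assms(2)[of j] by (auto simp: column_eq_0_iff)
    then have "(i, j) \<in> cell_zeros Q" using \<open>j \<in> _\<close> assms(3) by (simp add: mem_cell_zeros)
    then show "j \<in> snd ` cell_zeros Q" by force
  qed
  have le: "card (snd ` cell_zeros Q) \<le> q" using card_image_le[of "cell_zeros Q" snd] assms(1) by simp
  then have eq: "card (snd ` cell_zeros Q) = q"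
    using card_mono[OF _ sub] by simp
  then show "snd ` cell_zeros Q = {..<q}" using card_subset_eq[OF _ sub] by simp
  show "inj_on snd (cell_zeros Q)" using eq assms(1) by (simp add: inj_on_iff_eq_card)
qed

lemma column_after_covered:
  assumes "card (cell_zeros Q) = q" "\<And>j. j < q \<Longrightarrow> column Q j = 0" "q < M"
  shows "column Q q \<noteq> 0"
proof
  assume "column Q q = 0"
  then obtain i where "i < D" "Q i q = 0" by (auto simp: column_eq_0_iff)
  then have "(i, q) \<in> cell_zeros Q" using assms by (simp add: mem_cell_zeros)
  then have "q \<in> {..<q}" using covered_columns(1)[of Q q] assms by force
  then show False by simp
qed

text \<open>
  Flags of the subcomplex of cells whose first \<open>n * D - k\<close> columns vanish; the entries above the
  top index are the junk value \<open>0\<close>, which is not a cell.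
\<close>

definition flags :: "nat \<Rightarrow> (nat \<Rightarrow> nat \<Rightarrow> nat \<Rightarrow> int) set" where
  "flags k = {c. (\<forall>r\<le>k. c r \<in> cells \<and> card (cell_zeros (c r)) + r = n * D) \<and>
     (\<forall>r<k. cell_le (c r) (c (Suc r))) \<and> (\<forall>r>k. c r = (\<lambda>_ _. 0)) \<and>
     (\<forall>j<n * D - k. column (c k) j = 0)}"

definition flag_sign :: "nat \<Rightarrow> (nat \<Rightarrow> nat \<Rightarrow> nat \<Rightarrow> int) \<Rightarrow> int" where
  "flag_sign k c = column (c k) (n * D - k)"

lemma finite_flags: "finite (flags k)"
proof (rule finite_subset)
  show "flags k \<subseteq> {f. \<forall>x. (x \<in> {..k} \<longrightarrow> f x \<in> cells) \<and> (x \<notin> {..k} \<longrightarrow> f x = (\<lambda>_ _. 0))}"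
    by (auto simp: flags_def)
  show "finite \<dots>" by (rule finite_set_of_finite_funs) (auto simp: finite_cells)
qed

lemma flagsD:
  assumes "c \<in> flags k"
  shows "r \<le> k \<Longrightarrow> c r \<in> cells" "r \<le> k \<Longrightarrow> card (cell_zeros (c r)) = n * D - r"
    "r < k \<Longrightarrow> cell_le (c r) (c (Suc r))" "r > k \<Longrightarrow> c r = (\<lambda>_ _. 0)"
    "j < n * D - k \<Longrightarrow> column (c k) j = 0" "k \<le> n * D"
proof -
  have *: "r \<le> k \<Longrightarrow> card (cell_zeros (c r)) + r = n * D" for r using assms by (simp add: flags_def)
  show "r \<le> k \<Longrightarrow> card (cell_zeros (c r)) = n * D - r" using *[of r] by linarith
  show "k \<le> n * D" using *[of k] by linarith
qed (use assms in \<open>auto simp: flags_def\<close>)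

lemma flags_le:
  assumes "c \<in> flags k" "r \<le> r'" "r' \<le> k"
  shows "cell_le (c r) (c r')"
  using assms(2,3)
proof (induction rule: dec_induct)
  case (step m)
  then show ?case using flagsD(3)[OF assms(1), of m] cell_le_trans by auto
qed simp

lemma flag_sign_neq_0:
  assumes "c \<in> flags k"
  shows "flag_sign k c \<noteq> 0"
  unfolding flag_sign_def
  using flagsD[OF assms] M_gt by (intro column_after_covered) auto

lemma flag_sign:
  assumes "c \<in> flags k"
  shows "flag_sign k c \<in> {1, -1}"
  using column_sign flag_sign_neq_0[OF assms] flagsD(1)[OF assms, of k] by (simp add: flag_sign_def)

section \<open>The hyperoctahedral group and its action on cells\<close>

definition signed_perms :: "((nat \<Rightarrow> nat) \<times> (nat \<Rightarrow> int)) set" where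
  "signed_perms = {\<pi>. \<pi> permutes {..<D}} \<times> ({..<D} \<rightarrow>\<^sub>E {1, -1})"

definition act :: "(nat \<Rightarrow> nat) \<times> (nat \<Rightarrow> int) \<Rightarrow> (nat \<Rightarrow> nat \<Rightarrow> int) \<Rightarrow> nat \<Rightarrow> nat \<Rightarrow> int" where
  "act g Q = (\<lambda>i j. if i < D then snd g i * Q (fst g i) j else 0)"

definition act_flag where "act_flag g c = (\<lambda>r. act g (c r))"

text \<open>The character of the group by which columns, and later labels, are multiplied.\<close>

definition chi :: "(nat \<Rightarrow> nat) \<times> (nat \<Rightarrow> int) \<Rightarrow> int" where
  "chi g = (\<Prod>i<D. snd g i)"

lemma finite_signed_perms: "finite signed_perms"
  unfolding signed_perms_def by (intro finite_cartesian_product finite_PiE) (auto simp: finite_permutations)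

lemma card_signed_perms: "card signed_perms = fact D * 2 ^ D"
  by (simp add: signed_perms_def card_cartesian_product card_permutations[of _ D] card_PiE numeral_2_eq_2)

lemma signed_perms_nonempty: "signed_perms \<noteq> {}"
  using card_signed_perms finite_signed_perms by (metis card.empty fact_nonzero mult_eq_0_iff power_not_zero zero_neq_numeral)

lemma signed_permsD:
  assumes "g \<in> signed_perms"
  shows "fst g permutes {..<D}" "i < D \<Longrightarrow> snd g i \<in> {1, -1}" "i < D \<Longrightarrow> fst g i < D"
    "i < D \<Longrightarrow> snd g i * snd g i = 1"
proof -
  show perm: "fst g permutes {..<D}" using assms by (simp add: signed_perms_def mem_Times_iff)
  have "snd g \<in> {..<D} \<rightarrow>\<^sub>E {1, -1}" using assms by (simp add: signed_perms_def mem_Times_iff)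
  from PiE_mem[OF this, of i] show sign: "snd g i \<in> {1, -1}" if "i < D" using that by simp
  show "fst g i < D" if "i < D" using permutes_in_image[OF perm, of i] that by simp
  show "snd g i * snd g i = 1" if "i < D" using sign[OF that] by (elim insertE) simp_all
qed

lemma chi_sign: "g \<in> signed_perms \<Longrightarrow> chi g \<in> {1, -1}"
proof -
  assume "g \<in> signed_perms"
  then have "\<bar>snd g i\<bar> = 1" if "i < D" for i using signed_permsD(2)[of g i] that by auto
  then have "\<bar>chi g\<bar> = 1" by (simp add: chi_def abs_prod)
  then show ?thesis by auto
qed

lemma act_cells:
  assumes "g \<in> signed_perms" "Q \<in> cells"
  shows "act g Q \<in> cells"
proof -
  have "act g Q i \<in> P" if "i < D" for i
  proof -
    have "Q (fst g i) \<in> P" using assms that signed_permsD(3) by (auto simp: cells_def)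
    then show ?thesis using signed_permsD(2)[OF assms(1) that] that uminus by (auto simp: act_def)
  qed
  then show ?thesis by (auto simp: cells_def act_def)
qed

lemma act_eq_0_iff: "g \<in> signed_perms \<Longrightarrow> i < D \<Longrightarrow> act g Q i j = 0 \<longleftrightarrow> Q (fst g i) j = 0"
  using signed_permsD(2)[of g i] by (auto simp: act_def)

lemma zeros_act: "g \<in> signed_perms \<Longrightarrow> i < D \<Longrightarrow> zeros M (act g Q i) = zeros M (Q (fst g i))"
  by (simp add: zeros_def act_eq_0_iff)

lemma card_cell_zeros_act:
  assumes "g \<in> signed_perms"
  shows "card (cell_zeros (act g Q)) = card (cell_zeros Q)"
proof -
  have "card (cell_zeros (act g Q)) = (\<Sum>i<D. card (zeros M (Q (fst g i))))"
    using assms by (simp add: card_cell_zeros zeros_act)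
  also have "\<dots> = (\<Sum>i<D. card (zeros M (Q i)))"
    using sum.permute[OF signed_permsD(1)[OF assms], of "\<lambda>i. card (zeros M (Q i))"] by (simp add: o_def)
  finally show ?thesis by (simp add: card_cell_zeros)
qed

lemma act_le: "g \<in> signed_perms \<Longrightarrow> cell_le Q R \<Longrightarrow> cell_le (act g Q) (act g R)"
  using signed_permsD(2)[of g] by (fastforce simp: cell_le_def face_le_def act_def)

lemma column_act:
  assumes "g \<in> signed_perms"
  shows "column (act g Q) j = chi g * column Q j"
proof -
  have "column (act g Q) j = (\<Prod>i<D. snd g i * Q (fst g i) j)" by (simp add: column_def act_def)
  also have "\<dots> = chi g * (\<Prod>i<D. Q (fst g i) j)" by (simp add: prod.distrib chi_def)
  also have "(\<Prod>i<D. Q (fst g i) j) = column Q j"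
    using prod.permute[OF signed_permsD(1)[OF assms], of "\<lambda>i. Q i j"] by (simp add: o_def column_def)
  finally show ?thesis .
qed

lemma act_zero [simp]: "act g (\<lambda>_ _. 0) = (\<lambda>_ _. 0)"
  by (auto simp: act_def)

lemma act_flags: "g \<in> signed_perms \<Longrightarrow> c \<in> flags k \<Longrightarrow> act_flag g c \<in> flags k"
  by (auto simp: flags_def act_flag_def act_cells card_cell_zeros_act act_le column_act)

lemma act_comp:
  assumes "g \<in> signed_perms" "h \<in> signed_perms"
  shows "\<exists>k\<in>signed_perms. \<forall>Q. act g (act h Q) = act k Q"
proof
  \<comment> \<open>Rows are pulled back along the permutations, so these compose in reverse
    order.\<close>
  let ?k = "(fst h \<circ> fst g, restrict (\<lambda>i. snd g i * snd h (fst g i)) {..<D})"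
  have "snd g i * snd h (fst g i) \<in> {1, -1}" if "i < D" for i
    using signed_permsD(2)[OF assms(1) that] signed_permsD(2)[OF assms(2) signed_permsD(3)[OF assms(1) that]] by auto
  then show "?k \<in> signed_perms"
    using signed_permsD(1)[OF assms(1)] signed_permsD(1)[OF assms(2)] by (auto simp: signed_perms_def permutes_compose)
  show "\<forall>Q. act g (act h Q) = act ?k Q"
    using signed_permsD(3)[OF assms(1)] by (auto simp: act_def fun_eq_iff)
qed

lemma act_inverse:
  assumes "g \<in> signed_perms"
  shows "\<exists>h\<in>signed_perms. \<forall>Q. (\<forall>i\<ge>D. \<forall>j. Q i j = 0) \<longrightarrow> act h (act g Q) = Q"
proof
  let ?\<pi> = "inv (fst g)"
  let ?h = "(?\<pi>, restrict (\<lambda>i. snd g (?\<pi> i)) {..<D})"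
  have p: "?\<pi> permutes {..<D}" using signed_permsD(1)[OF assms] by (rule permutes_inv)
  have lt: "?\<pi> i < D" if "i < D" for i using permutes_in_image[OF p, of i] that by simp
  have fix_inv: "fst g (?\<pi> i) = i" for i by (rule permutes_inverses[OF signed_permsD(1)[OF assms]])
  show "?h \<in> signed_perms" using p signed_permsD(2)[OF assms lt] by (auto simp: signed_perms_def)
  show "\<forall>Q. (\<forall>i\<ge>D. \<forall>j. Q i j = 0) \<longrightarrow> act ?h (act g Q) = Q"
  proof (intro allI impI ext)
    fix Q :: "nat \<Rightarrow> nat \<Rightarrow> int" and i j assume "\<forall>i\<ge>D. \<forall>j. Q i j = 0"
    moreover have "act ?h (act g Q) i j = (snd g (?\<pi> i) * snd g (?\<pi> i)) * Q i j" if "i < D"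
      using lt[OF that] that by (simp add: act_def fix_inv)
    ultimately show "act ?h (act g Q) i j = Q i j"
      using signed_permsD(4)[OF assms lt, of i] by (cases "i < D") (auto simp: act_def)
  qed
qed

end

section \<open>Flags of cells\<close>

text \<open>A discrete intermediate value theorem: a sequence that drops by at most one at a time
  cannot skip \<open>v\<close> on its way down.\<close>

lemma nat_descent:
  fixes u :: "nat \<Rightarrow> nat"
  assumes "v \<le> u 0" "u k \<le> v" "\<And>r. r < k \<Longrightarrow> u r \<le> Suc (u (Suc r))"
  shows "\<exists>r\<le>k. u r = v"
  using assms
proof (induction k)
  case (Suc k)
  show ?case
  proof (cases "u k \<le> v")
    case True
    then obtain r where "r \<le> k" "u r = v" using Suc by auto
    then show ?thesis by (intro exI[of _ r]) auto
  next
    case False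
    then have "u (Suc k) = v" using Suc.prems(2) Suc.prems(3)[of k] by auto
    then show ?thesis by blast
  qed
qed auto

context sign_system
begin

text \<open>The bottom cell has \<open>n * D\<close> zeros and no row has more than
  \<open>n\<close>, so all rows are vertices.\<close>

lemma card_zeros_bottom:
  assumes "c \<in> flags k" "i < D"
  shows "card (zeros M (c 0 i)) = n"
proof (rule ccontr)
  assume "card (zeros M (c 0 i)) \<noteq> n"
  have le: "card (zeros M (c 0 i)) \<le> n" if "i < D" for i
    using flagsD(1)[OF assms(1), of 0] card_zeros_le that by (simp add: cells_def)
  then have "card (zeros M (c 0 i)) < n" using assms(2) \<open>_ \<noteq> n\<close> by (simp add: order_less_le)
  then have "(\<Sum>i<D. card (zeros M (c 0 i))) < (\<Sum>i<D. n)"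
    using le assms(2) by (intro sum_strict_mono_ex1) auto
  then show False using flagsD(2)[OF assms(1), of 0] by (simp add: card_cell_zeros mult.commute)
qed

text \<open>One step removes exactly one zero in total and no row gains any, so two rows together
  lose at most one.\<close>

lemma card_zeros_pair_step:
  assumes "c \<in> flags k" "r < k" "p < D" "q < D" "p \<noteq> q"
  shows "card (zeros M (c r p)) + card (zeros M (c r q)) \<le>
    Suc (card (zeros M (c (Suc r) p)) + card (zeros M (c (Suc r) q)))"
proof -
  let ?z = "\<lambda>r i. card (zeros M (c r i))"
  have split: "(\<Sum>i<D. ?z r i) = ?z r p + ?z r q + (\<Sum>i\<in>{..<D} - {p, q}. ?z r i)" for r
    using sum.subset_diff[of "{p, q}" "{..<D}" "?z r"] assms(3-5) by simp
  have "(\<Sum>i<D. ?z r i) = n * D - r" "(\<Sum>i<D. ?z (Suc r) i) = n * D - Suc r"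
    using flagsD(2)[OF assms(1)] assms(2) by (simp_all add: card_cell_zeros)
  moreover have "(\<Sum>i\<in>{..<D} - {p, q}. ?z (Suc r) i) \<le> (\<Sum>i\<in>{..<D} - {p, q}. ?z r i)"
    using flagsD(3)[OF assms(1,2)]
    by (intro sum_mono card_mono zeros_antimono) (auto simp: cell_le_def)
  ultimately show ?thesis using split[of r] split[of "Suc r"] by linarith
qed

text \<open>
  Passing from \<open>2 * n\<close> zeros at the bottom to at most one zero at the top in steps of size at
  most one, two rows have an odd total number of zeros at two indices; \<open>m\<close> is only one of them.
\<close>

lemma rows_differ:
  assumes c: "c \<in> flags k" and pq: "p < D" "q < D" "p \<noteq> q" and m: "m \<noteq> k \<or> k > 0"
  shows "\<exists>r\<le>k. r \<noteq> m \<and> zeros M (c r p) \<noteq> zeros M (c r q)"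
proof (rule ccontr)
  assume "\<not> ?thesis"
  then have eq: "zeros M (c r p) = zeros M (c r q)" if "r \<le> k" "r \<noteq> m" for r using that by blast
  let ?u = "\<lambda>r. card (zeros M (c r p)) + card (zeros M (c r q))"
  have step: "?u r \<le> Suc (?u (Suc r))" if "r < k" for r
    using card_zeros_pair_step[OF c that pq] .
  have u0: "?u 0 = 2 * n" using card_zeros_bottom[OF c] pq by simp
  have disj: "zeros M (c k p) \<inter> zeros M (c k q) = {}"
  proof (rule ccontr)
    assume "zeros M (c k p) \<inter> zeros M (c k q) \<noteq> {}"
    then obtain j where j: "(p, j) \<in> cell_zeros (c k)" "(q, j) \<in> cell_zeros (c k)"
      using pq by (auto simp: cell_zeros_def)
    have "inj_on snd (cell_zeros (c k))"
      using flagsD[OF c] M_gt by (intro covered_columns(2)[where q = "n * D - k"]) auto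
    from inj_onD[OF this _ j] show False using pq(3) by simp
  qed
  have uk: "?u k \<le> 1"
  proof (cases "m = k")
    case False
    then have "zeros M (c k p) = {}" "zeros M (c k q) = {}" using eq[of k] disj by auto
    then show ?thesis by simp
  next
    case True
    then obtain k' where k': "k = Suc k'" using m gr0_implies_Suc by blast
    \<comment> \<open>Here the top level is exempt, so the level below is used: its common zero set
      \<open>?Y\<close> contains the disjoint zero sets of both top rows. Hence \<open>?u k\<close>
      is at most \<open>card ?Y\<close>, while \<open>2 * card ?Y\<close> is at most
      \<open>Suc (?u k)\<close>; together they leave at most one zero.\<close>
    let ?Y = "zeros M (c k' p)"
    have Y: "zeros M (c k' q) = ?Y" using eq[of k'] k' True by simp
    have "cell_le (c k') (c k)" using flagsD(3)[OF c, of k'] k' by simp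
    then have "zeros M (c k p) \<subseteq> ?Y" "zeros M (c k q) \<subseteq> zeros M (c k' q)"
      by (simp_all add: cell_le_def zeros_antimono)
    then have "zeros M (c k p) \<union> zeros M (c k q) \<subseteq> ?Y" unfolding Y by (rule Un_least)
    then have "card (zeros M (c k p) \<union> zeros M (c k q)) \<le> card ?Y"
      by (intro card_mono) auto
    then have "?u k \<le> card ?Y" using disj by (simp add: card_Un_disjoint)
    moreover have "2 * card ?Y \<le> Suc (?u k)" using step[of k'] k' Y by simp
    ultimately show ?thesis by linarith
  qed
  \<comment> \<open>Both odd values lie between the top value, at most 1, and the bottom value
    \<open>2 * n\<close>, because n \<ge> 2. An odd total excludes equal zero sets, so both would
    have to be attained at the one exempt index.\<close>
  obtain r1 where r1: "r1 \<le> k" "?u r1 = 2 * n - 1"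
    using nat_descent[of "2 * n - 1" ?u k] u0 uk n_ge_2 step by fastforce
  obtain r2 where r2: "r2 \<le> k" "?u r2 = 2 * n - 3"
    using nat_descent[of "2 * n - 3" ?u k] u0 uk n_ge_2 step by fastforce
  have odd: "odd (2 * n - 1)" "odd (2 * n - 3)" using n_ge_2 by auto
  have even: "even (?u r)" if "r \<le> k" "r \<noteq> m" for r using eq[OF that] by simp
  have "r1 = m" using even[OF r1(1)] odd(1) unfolding r1(2) by blast
  moreover have "r2 = m" using even[OF r2(1)] odd(2) unfolding r2(2) by blast
  ultimately show False using r1 r2 n_ge_2 by auto
qed

text \<open>The deleted level receives the default value that flags have above their top, so
  deleting the top of a member of \<open>flags (Suc k)\<close> can give a member of
  \<open>flags k\<close> itself.\<close>

definition face :: "nat \<Rightarrow> (nat \<Rightarrow> nat \<Rightarrow> nat \<Rightarrow> int) \<Rightarrow> nat \<Rightarrow> nat \<Rightarrow> nat \<Rightarrow> int" where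
  "face m c = c(m := (\<lambda>_ _. 0))"

lemma act_flag_face: "act_flag g (face m c) = face m (act_flag g c)"
  by (auto simp: act_flag_def face_def)

lemma act_flag_comp:
  assumes "g \<in> signed_perms" "h \<in> signed_perms"
  shows "\<exists>k\<in>signed_perms. act_flag g (act_flag h c) = act_flag k c"
  using act_comp[OF assms] by (auto simp: act_flag_def)

lemma act_flag_inverse:
  assumes "g \<in> signed_perms"
  shows "\<exists>h\<in>signed_perms. \<forall>k. \<forall>c\<in>flags k. act_flag h (act_flag g c) = c"
proof -
  obtain h where h: "h \<in> signed_perms" "\<And>Q. (\<forall>i\<ge>D. \<forall>j. Q i j = 0) \<Longrightarrow> act h (act g Q) = Q"
    using act_inverse[OF assms] by blast
  have "act_flag h (act_flag g c) = c" if "c \<in> flags k" for c k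
  proof
    fix r
    have "\<forall>i\<ge>D. \<forall>j. c r i j = 0"
      using flagsD(1)[OF that, of r] flagsD(4)[OF that, of r] cells_outside' by (cases "r \<le> k") auto
    then show "act_flag h (act_flag g c) r = c r" using h(2) by (simp add: act_flag_def)
  qed
  then show ?thesis using h(1) by blast
qed

text \<open>Zero sets do not see signs, so by \<open>rows_differ\<close> two group elements that
  agree on the facet permute the rows alike; nonzero entries of a surviving level then determine the
  signs. For \<open>m = k = 0\<close> no level would survive.\<close>

lemma free_on_faces:
  assumes c: "c \<in> flags k" and m: "m \<noteq> k \<or> k > 0"
  shows "inj_on (\<lambda>g. act_flag g (face m c)) signed_perms"
proof (rule inj_onI)
  fix g h assume g: "g \<in> signed_perms" and h: "h \<in> signed_perms"
    and eq: "act_flag g (face m c) = act_flag h (face m c)"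
  have eq': "act g (c r) = act h (c r)" if "r \<noteq> m" for r
    using fun_cong[OF eq, of r] that by (simp add: act_flag_def face_def)
  have fst: "fst g i = fst h i" for i
  proof (cases "i < D")
    case True
    show ?thesis
    proof (rule ccontr)
      assume "fst g i \<noteq> fst h i"
      then obtain r where r: "r \<noteq> m" "zeros M (c r (fst g i)) \<noteq> zeros M (c r (fst h i))"
        using rows_differ[OF c signed_permsD(3)[OF g True] signed_permsD(3)[OF h True] _ m] by blast
      have "zeros M (act g (c r) i) = zeros M (act h (c r) i)" by (simp add: eq'[OF r(1)])
      then show False using r(2) unfolding zeros_act[OF g True] zeros_act[OF h True] by blast
    qed
  next
    case False
    then show ?thesis using signed_permsD(1)[OF g] signed_permsD(1)[OF h] by (simp add: permutes_not_in)
  qed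
  \<comment> \<open>A surviving level: the bottom if the top is deleted, and the top
    otherwise.\<close>
  have "(if m = k then 0 else k) \<le> k \<and> (if m = k then 0 else k) \<noteq> m" using m by auto
  then obtain r where r: "r \<le> k" "r \<noteq> m" by blast
  have "snd g i = snd h i" if i: "i < D" for i
  proof -
    obtain j where j: "c r (fst g i) j \<noteq> 0"
      using cells_nonzero[OF flagsD(1)[OF c r(1)] signed_permsD(3)[OF g i]] by blast
    have "act g (c r) i j = act h (c r) i j" using eq'[OF r(2)] by simp
    then show ?thesis using i j fst[of i] by (simp add: act_def)
  qed
  moreover have "snd g \<in> extensional {..<D}" "snd h \<in> extensional {..<D}"
    using g h by (simp_all add: signed_perms_def mem_Times_iff PiE_def)
  ultimately have "snd g = snd h" by (intro extensionalityI) auto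
  then show "g = h" using fst by (auto simp: prod_eq_iff)
qed

text \<open>Deleting a level above the top changes nothing, so this is an instance of freeness on
  facets.\<close>

lemma free_on_flags:
  assumes "c \<in> flags k"
  shows "inj_on (\<lambda>g. act_flag g c) signed_perms"
proof -
  have "face (Suc k) c = c" using flagsD(4)[OF assms, of "Suc k"] by (simp add: face_def fun_upd_idem)
  then show ?thesis using free_on_faces[OF assms, of "Suc k"] by simp
qed

text \<open>The diamond property: if \<open>Q\<close> and \<open>T\<close> are two levels apart,
  \<open>R'\<close> is the other cell between them. The zeros of \<open>Q\<close> that
  \<open>R\<close> releases become zeros again, and those that \<open>R\<close> keeps take the
  values of \<open>T\<close>.\<close>

lemma reflect_interior:
  fixes Q R T
  defines "R' \<equiv> \<lambda>i j. Q i j + T i j - R i j"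
  assumes Q: "Q \<in> cells" and R: "R \<in> cells" and T: "T \<in> cells" and QR: "cell_le Q R" and RT: "cell_le R T"
  shows "R' \<in> cells" "cell_le Q R'" "cell_le R' T"
    "card (cell_zeros R') + card (cell_zeros R) = card (cell_zeros Q) + card (cell_zeros T)"
proof -
  have cases: "(Q i j \<noteq> 0 \<and> R i j = Q i j \<and> T i j = Q i j) \<or> (Q i j = 0 \<and> R i j = 0) \<or>
      (Q i j = 0 \<and> R i j \<noteq> 0 \<and> T i j = R i j)" for i j
    using cell_leD[OF QR, of i j] cell_leD[OF RT, of i j] by auto
  show QR': "cell_le Q R'"
    unfolding cell_le_def face_le_def
  proof (intro allI impI)
    show "R' i j = Q i j" if "Q i j \<noteq> 0" for i j using cases[of i j] that by (auto simp: R'_def)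
  qed
  show "cell_le R' T"
    unfolding cell_le_def face_le_def
  proof (intro allI impI)
    show "T i j = R' i j" if "R' i j \<noteq> 0" for i j using cases[of i j] that by (auto simp: R'_def)
  qed
  have "R' i j \<in> {-1, 0, 1}" for i j
    using cases[of i j] cells_sign[OF T, of i j] cells_sign[OF Q, of i j] by (auto simp: R'_def)
  then show "R' \<in> cells"
    using cells_fill[OF Q QR'] cells_outside[OF Q] cells_outside[OF R] cells_outside[OF T]
      cells_outside'[OF Q] cells_outside'[OF R] cells_outside'[OF T] by (simp add: R'_def)
  have RQ: "cell_zeros R \<subseteq> cell_zeros Q" by (rule cell_zeros_antimono[OF QR])
  have TR: "cell_zeros T \<subseteq> cell_zeros R" by (rule cell_zeros_antimono[OF RT])
  have "cell_zeros R' = cell_zeros T \<union> (cell_zeros Q - cell_zeros R)"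
  proof (rule set_eqI)
    fix x :: "nat \<times> nat"
    obtain i j where x: "x = (i, j)" by (cases x)
    show "x \<in> cell_zeros R' \<longleftrightarrow> x \<in> cell_zeros T \<union> (cell_zeros Q - cell_zeros R)"
      using cases[of i j] unfolding x Un_iff Diff_iff mem_cell_zeros R'_def by auto
  qed
  then have "card (cell_zeros R') = card (cell_zeros T) + card (cell_zeros Q - cell_zeros R)"
    using TR by (simp add: card_Un_disjoint disjoint_iff subset_iff)
  moreover have "card (cell_zeros Q - cell_zeros R) = card (cell_zeros Q) - card (cell_zeros R)"
    using RQ by (simp add: card_Diff_subset)
  moreover have "card (cell_zeros R) \<le> card (cell_zeros Q)" using RQ by (simp add: card_mono)
  ultimately show "card (cell_zeros R') + card (cell_zeros R) = card (cell_zeros Q) + card (cell_zeros T)"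
    by linarith
qed

text \<open>The reflection of \<open>R\<close> through \<open>Q\<close>: entries at the zeros of
  \<open>Q\<close> change sign, all others stay. It exchanges the top cells on opposite sides of
  \<open>Q\<close>.\<close>

lemma reflect_top:
  fixes Q R
  defines "R' \<equiv> \<lambda>i j. 2 * Q i j - R i j"
  assumes Q: "Q \<in> cells" and R: "R \<in> cells" and QR: "cell_le Q R"
  shows "R' \<in> cells" "cell_le Q R'" "cell_zeros R' = cell_zeros R"
    "\<And>j. column R' j = 0 \<longleftrightarrow> column R j = 0"
proof -
  have cases: "(Q i j \<noteq> 0 \<and> R i j = Q i j \<and> R' i j = Q i j) \<or> (Q i j = 0 \<and> R' i j = - R i j)" for i j
    using cell_leD[OF QR, of i j] by (auto simp: R'_def)
  show QR': "cell_le Q R'"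
    unfolding cell_le_def face_le_def
  proof (intro allI impI)
    show "R' i j = Q i j" if "Q i j \<noteq> 0" for i j using cases[of i j] that by auto
  qed
  have "R' i j \<in> {-1, 0, 1}" for i j
    using cases[of i j] cells_sign[OF R, of i j] by auto
  then show "R' \<in> cells"
    using cells_fill[OF Q QR'] cells_outside[OF Q] cells_outside[OF R]
      cells_outside'[OF Q] cells_outside'[OF R] by (simp add: R'_def)
  have 0: "R' i j = 0 \<longleftrightarrow> R i j = 0" for i j using cases[of i j] by auto
  show "cell_zeros R' = cell_zeros R" by (auto simp: mem_cell_zeros 0)
  show "column R' j = 0 \<longleftrightarrow> column R j = 0" for j by (simp add: column_eq_0_iff 0)
qed

end

section \<open>Equivariant labellings of a sign system\<close>

lemma sum_card_fibres:
  assumes "finite S"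
  shows "(\<Sum>y\<in>f ` S. card {x \<in> S. f x = y}) = card S"
  using sum.image_gen[OF assms, of "\<lambda>_. 1::nat" f] by simp

locale labelled_sign_system = sign_system +
  fixes lab :: "(nat \<Rightarrow> nat \<Rightarrow> int) \<Rightarrow> int"
  assumes lab_nonzero: "Q \<in> cells \<Longrightarrow> lab Q \<noteq> 0"
    and lab_le: "Q \<in> cells \<Longrightarrow> \<bar>lab Q\<bar> \<le> int (n * D)"
    and lab_act: "g \<in> signed_perms \<Longrightarrow> Q \<in> cells \<Longrightarrow> lab (act g Q) = chi g * lab Q"
    and lab_compl: "Q \<in> cells \<Longrightarrow> R \<in> cells \<Longrightarrow> cell_le Q R \<Longrightarrow> lab Q + lab R \<noteq> 0"
begin

definition alternating_flags where
  "alternating_flags k = {c \<in> flags k. alternating 1 (\<lambda>r. lab (c r)) {..k} \<or> alternating (- 1) (\<lambda>r. lab (c r)) {..k}}"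

text \<open>The starting sign is prescribed by the side of the flag. Labels and side change by the
  same factor \<open>chi g\<close>, so the condition is invariant; and of the two sides that meet in
  the smaller subcomplex it selects one.\<close>

definition critical_flags where
  "critical_flags k m = {c \<in> flags k. alternating (flag_sign k c) (\<lambda>r. lab (c r)) ({..k} - {m})}"

lemma flag_sign_act: "g \<in> signed_perms \<Longrightarrow> flag_sign k (act_flag g c) = chi g * flag_sign k c"
  by (simp add: flag_sign_def act_flag_def column_act)

lemma alternating_act:
  assumes "g \<in> signed_perms" "c \<in> flags k" "L \<subseteq> {..k}"
  shows "alternating (chi g * s) (\<lambda>r. lab (act_flag g c r)) L \<longleftrightarrow> alternating s (\<lambda>r. lab (c r)) L"
proof -
  have "alternating (chi g * s) (\<lambda>r. lab (act_flag g c r)) L \<longleftrightarrow>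
      alternating (chi g * s) (\<lambda>r. chi g * lab (c r)) L"
    using assms by (intro alternating_cong) (auto simp: act_flag_def lab_act flagsD(1))
  also have "\<dots> \<longleftrightarrow> alternating s (\<lambda>r. lab (c r)) L"
    using chi_sign[OF assms(1)] alternating_uminus[of "- s" "\<lambda>r. lab (c r)" L] by auto
  finally show ?thesis .
qed

lemma act_alternating_flags:
  assumes "g \<in> signed_perms" "c \<in> flags k"
  shows "act_flag g c \<in> alternating_flags k \<longleftrightarrow> c \<in> alternating_flags k"
  using alternating_act[OF assms order_refl, of 1] alternating_act[OF assms order_refl, of "- 1"]
    chi_sign[OF assms(1)] assms act_flags[OF assms] by (auto simp: alternating_flags_def)

lemma act_critical_flags:
  assumes "g \<in> signed_perms" "c \<in> flags k"
  shows "act_flag g c \<in> critical_flags k m \<longleftrightarrow> c \<in> critical_flags k m"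
  using alternating_act[OF assms, of "{..k} - {m}" "flag_sign k c"] assms act_flags[OF assms]
  by (simp add: critical_flags_def flag_sign_act)

text \<open>The local step of Fan's lemma for the levels of one flag: they are pairwise comparable,
  so no two labels are complementary.\<close>

lemma even_critical_faces:
  assumes "c \<in> flags k"
  shows "even (card {m \<in> {..k}. c \<in> critical_flags k m} + of_bool (c \<in> alternating_flags k))"
proof -
  have "even (card {m \<in> {..k}. alternating (flag_sign k c) (\<lambda>r. lab (c r)) ({..k} - {m})} +
     of_bool (alternating (flag_sign k c) (\<lambda>r. lab (c r)) {..k} \<or>
       alternating (- flag_sign k c) (\<lambda>r. lab (c r)) {..k}))"
  proof (rule even_alternating_faces)
    show "lab (c x) + lab (c y) \<noteq> 0" if "x \<in> {..k}" "y \<in> {..k}" for x y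
      using that flags_le[OF assms, of x y] flags_le[OF assms, of y x] flagsD(1)[OF assms]
        lab_compl[of "c x" "c y"] lab_compl[of "c y" "c x"]
      by (cases "x \<le> y") (auto simp: add.commute)
  qed (use flag_sign[OF assms] flagsD(1)[OF assms] lab_nonzero in auto)
  then show ?thesis using flag_sign[OF assms] assms
    by (auto simp: critical_flags_def alternating_flags_def disj_commute)
qed

lemma replace_level:
  assumes c: "c \<in> flags k" and m: "m \<le> k" and Q: "Q \<in> cells"
    and card: "card (cell_zeros Q) = card (cell_zeros (c m))"
    and below: "m > 0 \<Longrightarrow> cell_le (c (m - 1)) Q" and above: "m < k \<Longrightarrow> cell_le Q (c (Suc m))"
    and col: "m = k \<Longrightarrow> (\<And>j. j < n * D - k \<Longrightarrow> column Q j = 0)"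
  shows "c(m := Q) \<in> flags k"
proof -
  have "cell_le ((c(m := Q)) r) ((c(m := Q)) (Suc r))" if "r < k" for r
    using flagsD(3)[OF c that] below above that by auto
  moreover have "column ((c(m := Q)) k) j = 0" if "j < n * D - k" for j
    using flagsD(5)[OF c that] col that by auto
  ultimately show ?thesis
    using c Q m card unfolding flags_def by auto
qed

lemma critical_replace:
  assumes c: "c \<in> critical_flags k m" and c': "c(m := Q) \<in> flags k"
    and sign: "flag_sign k (c(m := Q)) = flag_sign k c"
  shows "c(m := Q) \<in> critical_flags k m"
proof -
  have "alternating (flag_sign k c) (\<lambda>r. lab ((c(m := Q)) r)) ({..k} - {m}) \<longleftrightarrow>
      alternating (flag_sign k c) (\<lambda>r. lab (c r)) ({..k} - {m})"
    by (rule alternating_cong) auto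
  then show ?thesis using c c' by (simp add: critical_flags_def sign)
qed

section \<open>Flags sharing a facet\<close>

text \<open>The two fillings of level \<open>m\<close> are exchanged by the diamond involution.
  Being critical at \<open>m\<close> does not involve the label at \<open>m\<close>, and the top,
  hence the side, is unchanged.\<close>

lemma even_fibre_interior:
  assumes m: "0 < m" "m < k"
  shows "even (card {c \<in> critical_flags k m. face m c = \<sigma>})" (is "even (card ?S)")
proof (rule even_card_involution)
  define f where "f c = c(m := (\<lambda>i j. c (m - 1) i j + c (Suc m) i j - c m i j))"
    for c :: "nat \<Rightarrow> nat \<Rightarrow> nat \<Rightarrow> int"
  show "finite ?S" using finite_flags[of k] by (auto simp: critical_flags_def)
  show "f c \<in> ?S \<and> f c \<noteq> c \<and> f (f c) = c" if cS: "c \<in> ?S" for c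
  proof (intro conjI)
    have c: "c \<in> flags k" and crit: "c \<in> critical_flags k m" and face: "face m c = \<sigma>"
      using cS by (auto simp: critical_flags_def)
    note cells = flagsD(1)[OF c, of "m - 1"] flagsD(1)[OF c, of m] flagsD(1)[OF c, of "Suc m"]
    have le: "cell_le (c (m - 1)) (c m)" "cell_le (c m) (c (Suc m))"
      using flagsD(3)[OF c, of "m - 1"] flagsD(3)[OF c, of m] m by auto
    have card: "card (cell_zeros (c (m - 1))) + card (cell_zeros (c (Suc m))) = 2 * card (cell_zeros (c m))"
      "card (cell_zeros (c (m - 1))) \<noteq> card (cell_zeros (c m))"
      using flagsD(2)[OF c, of "m - 1"] flagsD(2)[OF c, of "Suc m"] flagsD(2)[OF c, of m]
        flagsD(6)[OF c] m by auto
    note refl = reflect_interior[OF _ _ _ le]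
    have fc: "f c \<in> flags k"
      unfolding f_def using refl cells card m by (intro replace_level[OF c]) auto
    have "flag_sign k (f c) = flag_sign k c" using m by (simp add: flag_sign_def f_def)
    then have "f c \<in> critical_flags k m" using critical_replace[OF crit] fc by (simp add: f_def)
    moreover have "face m (f c) = \<sigma>" using face by (simp add: face_def f_def)
    ultimately show "f c \<in> ?S" by simp
    show "f (f c) = c" using m by (auto simp: f_def fun_eq_iff)
    show "f c \<noteq> c"
    proof
      assume "f c = c"
      then have eq: "c (m - 1) i j + c (Suc m) i j - c m i j = c m i j" for i j
      proof -
        have "f c m i j = c m i j" by (simp only: \<open>f c = c\<close>)
        then show ?thesis by (simp add: f_def)
      qed
      \<comment> \<open>A fixed cell would have the same zeros as the level below, although a zero
        is lost at every level.\<close>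
      have "c (m - 1) i j = 0 \<longleftrightarrow> c m i j = 0" for i j
        using eq[of i j] cell_leD[OF le(1), of i j] cell_leD[OF le(2), of i j]
        by (smt (verit))
      then have "cell_zeros (c (m - 1)) = cell_zeros (c m)" by (auto simp: mem_cell_zeros)
      then show False using card by simp
    qed
  qed
qed

text \<open>The top is reflected through the level below. A column that is nonzero there keeps its
  value in both tops, so the extra condition ensures that they lie on the same side.\<close>

lemma even_fibre_top:
  assumes k: "0 < k"
  shows "even (card {c \<in> critical_flags k k. face k c = \<sigma> \<and> column (c (k - 1)) (n * D - k) \<noteq> 0})"
    (is "even (card ?S)")
proof (rule even_card_involution)
  define f where "f c = c(k := (\<lambda>i j. 2 * c (k - 1) i j - c k i j))" for c :: "nat \<Rightarrow> nat \<Rightarrow> nat \<Rightarrow> int"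
  show "finite ?S" using finite_flags[of k] by (auto simp: critical_flags_def)
  show "f c \<in> ?S \<and> f c \<noteq> c \<and> f (f c) = c" if cS: "c \<in> ?S" for c
  proof (intro conjI)
    have c: "c \<in> flags k" and crit: "c \<in> critical_flags k k" and face: "face k c = \<sigma>"
      and col: "column (c (k - 1)) (n * D - k) \<noteq> 0"
      using cS by (auto simp: critical_flags_def)
    note cells = flagsD(1)[OF c, of "k - 1"] flagsD(1)[OF c, of k]
    have le: "cell_le (c (k - 1)) (c k)"
      using flagsD(3)[OF c, of "k - 1"] k by auto
    have card: "card (cell_zeros (c (k - 1))) \<noteq> card (cell_zeros (c k))"
      using flagsD(2)[OF c, of "k - 1"] flagsD(2)[OF c, of k] flagsD(6)[OF c] k by auto
    note refl = reflect_top[OF _ _ le]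
    have fc: "f c \<in> flags k"
      unfolding f_def using refl cells flagsD(5)[OF c] by (intro replace_level[OF c]) auto
    have "column (f c k) (n * D - k) = column (c (k - 1)) (n * D - k)"
      unfolding f_def using refl(2) cells col by (intro column_cong_le) auto
    moreover have "column (c k) (n * D - k) = column (c (k - 1)) (n * D - k)"
      using le col by (intro column_cong_le) auto
    ultimately have "flag_sign k (f c) = flag_sign k c" by (simp add: flag_sign_def)
    then have "f c \<in> critical_flags k k" using critical_replace[OF crit] fc by (simp add: f_def)
    moreover have "face k (f c) = \<sigma>" using face by (simp add: face_def f_def)
    moreover have "f c (k - 1) = c (k - 1)" using k by (simp add: f_def)
    ultimately show "f c \<in> ?S" using col by simp
    show "f (f c) = c" using k by (auto simp: f_def fun_eq_iff)
    show "f c \<noteq> c"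
    proof
      assume "f c = c"
      then have eq: "2 * c (k - 1) i j - c k i j = c k i j" for i j
      proof -
        have "f c k i j = c k i j" by (simp only: \<open>f c = c\<close>)
        then show ?thesis by (simp add: f_def)
      qed
      have "c (k - 1) i j = 0 \<longleftrightarrow> c k i j = 0" for i j using eq[of i j] by auto
      then have "cell_zeros (c (k - 1)) = cell_zeros (c k)" by (auto simp: mem_cell_zeros)
      then show False using card by simp
    qed
  qed
qed

text \<open>Level 1 has one zero fewer than a tuple of vertices, so it has one edge, in row
  \<open>i0\<close>, and vertices elsewhere. A bottom cell below it only chooses an end of this
  edge, so a nonempty fibre has exactly two elements.\<close>

lemma even_fibre_bottom:
  assumes k: "0 < k"
  shows "even (card {c \<in> critical_flags k 0. face 0 c = \<sigma>})" (is "even (card ?S)")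
proof (cases "?S = {}")
  case False
  then obtain c where crit: "c \<in> critical_flags k 0" and face: "face 0 c = \<sigma>" by blast
  have c: "c \<in> flags k" using crit by (simp add: critical_flags_def)
  have c0: "c 0 \<in> cells" and c1: "c 1 \<in> cells" using flagsD(1)[OF c] k by auto
  have le: "cell_le (c 0) (c 1)" using flagsD(3)[OF c, of 0] k by simp
  have z0: "card (zeros M (c 0 i)) = n" if "i < D" for i using card_zeros_bottom[OF c that] .
  have z1: "card (zeros M (c 1 i)) \<le> n" if "i < D" for i
    using card_zeros_le c1 that by (simp add: cells_def)
  have sum1: "(\<Sum>i<D. card (zeros M (c 1 i))) = n * D - 1"
    using flagsD(2)[OF c, of 1] k by (simp add: card_cell_zeros)
  have "n * D > 0" using n_ge_2 D_pos by simp
  have "\<exists>i<D. card (zeros M (c 1 i)) < n"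
  proof (rule ccontr)
    assume "\<not> ?thesis"
    then have "(\<Sum>i<D. card (zeros M (c 1 i))) = (\<Sum>i<D. n)" using z1 by (intro sum.cong) (auto simp: order_less_le)
    moreover have "(\<Sum>i<D. n) = n * D" by simp
    ultimately show False using sum1 \<open>n * D > 0\<close> by linarith
  qed
  then obtain i0 where i0: "i0 < D" "card (zeros M (c 1 i0)) < n" by blast
  have split: "(\<Sum>i<D. card (zeros M (c 1 i))) = card (zeros M (c 1 i0)) + (\<Sum>i\<in>{..<D} - {i0}. card (zeros M (c 1 i)))"
    using i0 by (simp add: sum.remove)
  have rest_le: "(\<Sum>i\<in>{..<D} - {i0}. card (zeros M (c 1 i))) \<le> (\<Sum>i\<in>{..<D} - {i0}. n)"
    using z1 by (intro sum_mono) auto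
  have nD: "(\<Sum>i\<in>{..<D} - {i0}. n) = n * D - n" using i0 by (simp add: diff_mult_distrib2 mult.commute)
  have "n \<le> n * D" using D_pos by simp
  have edge: "card (zeros M (c 1 i0)) = n - 1"
    and rest: "(\<Sum>i\<in>{..<D} - {i0}. card (zeros M (c 1 i))) = (\<Sum>i\<in>{..<D} - {i0}. n)"
    using split rest_le nD sum1 i0(2) \<open>n \<le> n * D\<close> n_ge_2 by linarith+
  have other: "card (zeros M (c 1 i)) = n" if "i < D" "i \<noteq> i0" for i
  proof (rule ccontr)
    assume "card (zeros M (c 1 i)) \<noteq> n"
    then have "(\<Sum>i\<in>{..<D} - {i0}. card (zeros M (c 1 i))) < (\<Sum>i\<in>{..<D} - {i0}. n)"
      using z1 that by (intro sum_strict_mono_ex1) (auto simp: order_less_le)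
    then show False using rest by simp
  qed
  \<comment> \<open>The other rows leave no choice: equal numbers of zeros force equal zero sets,
    and nonzero signs are inherited.\<close>
  have same: "Q i = c 1 i" if Q: "Q \<in> cells" "cell_le Q (c 1)" "card (zeros M (Q i)) = n" "i < D" "i \<noteq> i0" for Q i
  proof
    have "zeros M (c 1 i) \<subseteq> zeros M (Q i)" using Q(2) zeros_antimono by (auto simp: cell_le_def)
    then have eq: "zeros M (c 1 i) = zeros M (Q i)" using other[OF Q(4,5)] Q(3) by (intro card_subset_eq) auto
    show "Q i j = c 1 i j" for j
    proof (cases "j < M \<and> Q i j = 0")
      case True
      then have "j \<in> zeros M (c 1 i)" unfolding eq by (simp add: zeros_def)
      then show ?thesis using True by (simp add: zeros_def)
    next
      case False
      then show ?thesis using cell_leD[OF Q(2), of i j] cells_outside[OF Q(1), of j i] cells_outside[OF c1, of j i]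
        by (cases "j < M") auto
    qed
  qed
  let ?V = "{t \<in> P. face_le t (c 1 i0) \<and> card (zeros M t) = n}"
  let ?h = "\<lambda>t. c(0 := (c 0)(i0 := t))"
  have "?S = ?h ` ?V"
  proof (intro subset_antisym subsetI)
    fix c' assume c': "c' \<in> ?S"
    then have cf': "c' \<in> flags k" by (simp add: critical_flags_def)
    have eq: "c' r = c r" if "r \<noteq> 0" for r
    proof -
      have "face 0 c' r = face 0 c r" using c' face by simp
      then show ?thesis using that by (simp add: face_def)
    qed
    have c0': "c' 0 \<in> cells" using flagsD(1)[OF cf', of 0] by simp
    have le': "cell_le (c' 0) (c 1)" using flagsD(3)[OF cf', of 0] k eq[of 1] by simp
    have "c' 0 i0 \<in> ?V"
      using c0' i0 le' card_zeros_bottom[OF cf' i0(1)] by (auto simp: cells_def cell_le_def)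
    moreover have "c' = ?h (c' 0 i0)"
    proof (intro ext)
      fix r i j
      show "c' r i j = ?h (c' 0 i0) r i j"
      proof (cases "r = 0 \<and> i \<noteq> i0 \<and> i < D")
        case True
        then have "c' 0 i = c 1 i" "c 0 i = c 1 i"
          using same[OF c0' le' card_zeros_bottom[OF cf']] same[OF c0 le z0] by auto
        then show ?thesis using True by simp
      next
        case False
        then show ?thesis using eq[of r] i0 cells_outside'[OF c0', of i j] cells_outside'[OF c0, of i j] by auto
      qed
    qed
    ultimately show "c' \<in> ?h ` ?V" by blast
  next
    fix c' assume "c' \<in> ?h ` ?V"
    then obtain t where t: "t \<in> ?V" and c': "c' = ?h t" by blast
    let ?Q = "(c 0)(i0 := t)"
    have Q: "?Q \<in> cells" using c0 t i0 by (auto simp: cells_def)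
    have "card (cell_zeros ?Q) = (\<Sum>i<D. n)" unfolding card_cell_zeros using t z0 by (intro sum.cong) auto
    then have cardQ: "card (cell_zeros ?Q) = card (cell_zeros (c 0))"
      using flagsD(2)[OF c, of 0] by (simp add: mult.commute)
    have leQ: "cell_le ?Q (c 1)" using le t by (auto simp: cell_le_def)
    have "c' \<in> flags k" unfolding c' using Q cardQ leQ k by (intro replace_level[OF c]) auto
    moreover have "flag_sign k c' = flag_sign k c" using k by (simp add: flag_sign_def c')
    ultimately have "c' \<in> critical_flags k 0" using critical_replace[OF crit] c' by simp
    then show "c' \<in> ?S" using face by (simp add: c' face_def)
  qed
  moreover have "inj_on ?h ?V"
  proof (rule inj_onI)
    fix t t' assume "?h t = ?h t'"
    then have "?h t 0 i0 = ?h t' 0 i0" by simp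
    then show "t = t'" by simp
  qed
  ultimately have "card ?S = card ?V" by (simp add: card_image)
  also have "\<dots> = 2" using card_endpoints[of "c 1 i0"] c1 i0 edge by (simp add: cells_def)
  finally show ?thesis by simp
qed (simp only: card.empty even_zero)

end

lemma card_Collect_eq_sum:
  assumes "finite B"
  shows "card {y \<in> B. R y} = (\<Sum>y\<in>B. of_bool (R y))"
proof -
  have "B \<inter> {y. R y} = {y \<in> B. R y}" by blast
  then show ?thesis using sum_of_bool_eq[of B R, where ?'a = nat] assms by simp
qed

lemma card_Collect_swap:
  assumes "finite A" "finite B"
  shows "(\<Sum>x\<in>A. card {y \<in> B. R x y}) = (\<Sum>y\<in>B. card {x \<in> A. R x y})"
  unfolding card_Collect_eq_sum[OF assms(1)] card_Collect_eq_sum[OF assms(2)] by (rule sum.swap)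

context labelled_sign_system
begin

text \<open>
  The critical pairs \<open>(c, m)\<close> for which deleting the top of \<open>c\<close> does not lead to a flag of the next
  smaller subcomplex; they cancel in pairs.
\<close>

definition cancelling_flags where
  "cancelling_flags k m = {c \<in> critical_flags k m. m = k \<longrightarrow> column (c (k - 1)) (n * D - k) \<noteq> 0}"

text \<open>Grouped by facets, the flags form fibres of even size. The group acts freely on the
  facets and carries fibres into fibres, so fibre sizes serve as the weights in
  \<open>free_action_dvd_sum\<close>.\<close>

lemma dvd_card_cancelling_flags:
  assumes k: "0 < k" and m: "m \<le> k"
  shows "2 * card signed_perms dvd card (cancelling_flags k m)"
proof -
  let ?B = "cancelling_flags k m"
  let ?w = "\<lambda>\<sigma>. card {c \<in> ?B. face m c = \<sigma>}"
  have fin: "finite ?B" using finite_flags[of k] by (auto simp: cancelling_flags_def critical_flags_def)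
  have flags: "c \<in> flags k" if "c \<in> ?B" for c
    using that by (auto simp: cancelling_flags_def critical_flags_def)
  have actB: "act_flag g c \<in> ?B" if "g \<in> signed_perms" "c \<in> ?B" for g c
  proof -
    have "column (act_flag g c (k - 1)) (n * D - k) \<noteq> 0 \<longleftrightarrow> column (c (k - 1)) (n * D - k) \<noteq> 0"
      using column_act[OF that(1)] chi_sign[OF that(1)] by (auto simp: act_flag_def)
    then show ?thesis
      using act_critical_flags[OF that(1) flags[OF that(2)]] that(2) by (simp add: cancelling_flags_def)
  qed
  have "2 * card signed_perms dvd sum ?w (face m ` ?B)"
  proof (rule free_action_dvd_sum[where act = act_flag])
    show "finite (face m ` ?B)" using fin by simp
    show "finite signed_perms" "signed_perms \<noteq> {}" by (fact finite_signed_perms, fact signed_perms_nonempty)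
    show "act_flag g \<sigma> \<in> face m ` ?B" if g: "g \<in> signed_perms" and \<sigma>: "\<sigma> \<in> face m ` ?B" for g \<sigma>
    proof -
      obtain c where "c \<in> ?B" "\<sigma> = face m c" using \<sigma> by blast
      then show ?thesis using actB[OF g] by (simp add: act_flag_face)
    qed
    show "inj_on (\<lambda>g. act_flag g \<sigma>) signed_perms" if "\<sigma> \<in> face m ` ?B" for \<sigma>
      using that free_on_faces flags k by auto
    show "\<exists>h\<in>signed_perms. act_flag h (act_flag g \<sigma>) = \<sigma>" if g: "g \<in> signed_perms" and \<sigma>: "\<sigma> \<in> face m ` ?B" for g \<sigma>
    proof -
      obtain c where c: "c \<in> ?B" "\<sigma> = face m c" using \<sigma> by blast
      obtain h where h: "h \<in> signed_perms" "act_flag h (act_flag g c) = c"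
        using act_flag_inverse[OF g] flags[OF c(1)] by blast
      have "act_flag h (act_flag g \<sigma>) = \<sigma>" using h(2) by (simp add: c(2) act_flag_face)
      then show ?thesis using h(1) by blast
    qed
    show "\<exists>k\<in>signed_perms. act_flag g (act_flag h \<sigma>) = act_flag k \<sigma>" if "g \<in> signed_perms" "h \<in> signed_perms" for g h \<sigma>
      using act_flag_comp[OF that] .
    show "?w \<sigma> \<le> ?w (act_flag g \<sigma>)" if g: "g \<in> signed_perms" for g \<sigma>
    proof (rule card_inj_on_le)
      obtain h where h: "\<And>c. c \<in> flags k \<Longrightarrow> act_flag h (act_flag g c) = c"
        using act_flag_inverse[OF g] by blast
      show "inj_on (act_flag g) {c \<in> ?B. face m c = \<sigma>}"
        using h flags by (intro inj_on_inverseI[where g = "act_flag h"]) auto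
      show "act_flag g ` {c \<in> ?B. face m c = \<sigma>} \<subseteq> {c \<in> ?B. face m c = act_flag g \<sigma>}"
        using actB[OF g] by (auto simp: act_flag_face)
      show "finite {c \<in> ?B. face m c = act_flag g \<sigma>}" using fin by simp
    qed
    show "2 dvd ?w \<sigma>" for \<sigma>
    proof (cases "m = k")
      case True
      have "{c \<in> ?B. face m c = \<sigma>} =
        {c \<in> critical_flags k k. face k c = \<sigma> \<and> column (c (k - 1)) (n * D - k) \<noteq> 0}"
        using True by (auto simp: cancelling_flags_def)
      then show ?thesis using even_fibre_top[OF k, of \<sigma>] by simp
    next
      case False
      then have "{c \<in> ?B. face m c = \<sigma>} = {c \<in> critical_flags k m. face m c = \<sigma>}"
        by (auto simp: cancelling_flags_def)
      then show ?thesis using even_fibre_bottom[OF k, of \<sigma>] even_fibre_interior[of m k \<sigma>] False m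
        by (cases "m = 0") auto
    qed
  qed
  then show ?thesis using sum_card_fibres[OF fin, of "face m"] by simp
qed

lemma column_zero_unique:
  assumes "card (cell_zeros Q) = q" "\<And>j. j < q \<Longrightarrow> column Q j = 0" "q \<le> M"
    "Q i j = 0" "Q i' j = 0" "i < D" "i' < D" "j < M"
  shows "i = i'" "j < q"
proof -
  have mem: "(i, j) \<in> cell_zeros Q" "(i', j) \<in> cell_zeros Q" using assms by (auto simp: mem_cell_zeros)
  have "inj_on snd (cell_zeros Q)" "snd ` cell_zeros Q = {..<q}"
    using covered_columns[OF assms(1-3)] by blast+
  then show "i = i'" "j < q" using inj_onD[of snd "cell_zeros Q" "(i, j)" "(i', j)"] mem by force+
qed

lemma drop_top_in_flags:
  assumes c: "c \<in> flags (Suc k)" and col: "column (c k) (n * D - Suc k) = 0"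
  shows "c(Suc k := (\<lambda>_ _. 0)) \<in> flags k"
proof -
  have le: "cell_le (c k) (c (Suc k))" using flagsD(3)[OF c, of k] by simp
  have "column (c k) j = 0" if "j < n * D - k" for j
  proof (cases "j = n * D - Suc k")
    case False
    then have "j < n * D - Suc k" using that by auto
    then show ?thesis using column_mono[OF le] flagsD(5)[OF c] by blast
  qed (use col in simp)
  then show ?thesis using c by (auto simp: flags_def)
qed

text \<open>The critical flags that \<open>cancelling_flags\<close> leaves over: the level below the
  top already satisfies the dropped equation.\<close>

definition descending_flags where
  "descending_flags k = {c \<in> critical_flags (Suc k) (Suc k). column (c k) (n * D - Suc k) = 0}"

text \<open>
  A flag of the smaller subcomplex extends uniquely: the new top cell has to lose the only zero in
  column \<open>n * D - k - 1\<close>, with the sign dictated by the labels.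
\<close>

lemma card_descending_flags:
  assumes k: "Suc k \<le> n * D"
  shows "card (descending_flags k) = card (alternating_flags k)"
proof (rule bij_betw_same_card)
  define q where "q = n * D - Suc k"
  have Sq: "n * D - k = Suc q" and qM: "Suc q \<le> M" "q < M" using k M_gt by (auto simp: q_def)
  have atMost: "{..Suc k} - {Suc k} = {..k}" by auto
  have C: "c \<in> flags (Suc k)" "c(Suc k := (\<lambda>_ _. 0)) \<in> flags k"
      "alternating (flag_sign (Suc k) c) (\<lambda>r. lab (c r)) {..k}" "column (c k) q = 0"
      if "c \<in> descending_flags k" for c
    using that drop_top_in_flags by (auto simp: descending_flags_def critical_flags_def q_def atMost)
  have uniq: "i = i' \<and> j < Suc q"
    if "\<sigma> \<in> flags k" "\<sigma> k i j = 0" "\<sigma> k i' j = 0" "i < D" "i' < D" "j < M" for \<sigma> i i' j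
    using column_zero_unique[of "\<sigma> k" "Suc q" i j i'] flagsD[OF that(1)] that qM by (simp add: Sq)
  show "bij_betw (face (Suc k)) (descending_flags k) (alternating_flags k)"
  proof (rule bij_betw_imageI)
    show "inj_on (face (Suc k)) (descending_flags k)"
    proof (rule inj_onI)
      fix c c' assume c: "c \<in> descending_flags k" and c': "c' \<in> descending_flags k"
        and eq: "face (Suc k) c = face (Suc k) c'"
      have below: "c r = c' r" if "r \<noteq> Suc k" for r
        using fun_cong[OF eq, of r] that by (simp add: face_def)
      define a where "a = c k"
      have a: "a i j = 0 \<Longrightarrow> a i' j = 0 \<Longrightarrow> i < D \<Longrightarrow> i' < D \<Longrightarrow> j < M \<Longrightarrow> i = i' \<and> j < Suc q" for i i' j
        using uniq[OF C(2)[OF c]] by (simp add: a_def)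
      have le: "cell_le a (c (Suc k))" "cell_le a (c' (Suc k))"
        using flagsD(3)[OF C(1)[OF c], of k] flagsD(3)[OF C(1)[OF c'], of k] below[of k] by (auto simp: a_def)
      \<comment> \<open>Otherwise the common levels would alternate from both signs.\<close>
      have sign: "flag_sign (Suc k) c = flag_sign (Suc k) c'"
      proof (rule ccontr)
        assume "flag_sign (Suc k) c \<noteq> flag_sign (Suc k) c'"
        then have "flag_sign (Suc k) c' = - flag_sign (Suc k) c"
          using flag_sign[OF C(1)[OF c]] flag_sign[OF C(1)[OF c']] by auto
        moreover have "alternating (flag_sign (Suc k) c') (\<lambda>r. lab (c r)) {..k}"
          using C(3)[OF c'] below alternating_cong[of "{..k}" "\<lambda>r. lab (c r)" "\<lambda>r. lab (c' r)"] by auto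
        ultimately show False
          using not_alternating_both[OF C(3)[OF c]] flag_sign[OF C(1)[OF c]] by auto
      qed
      have "c (Suc k) i j = c' (Suc k) i j" for i j
      proof (cases "a i j = 0 \<and> i < D \<and> j < M")
        case False
        have top: "c (Suc k) \<in> cells" "c' (Suc k) \<in> cells"
          using flagsD(1)[OF C(1)[OF c]] flagsD(1)[OF C(1)[OF c']] by auto
        show ?thesis
        proof (cases "a i j = 0")
          case True
          then have "i \<ge> D \<or> j \<ge> M" using False by auto
          then show ?thesis
            using cells_outside[OF top(1), of j i] cells_outside[OF top(2), of j i]
              cells_outside'[OF top(1), of i j] cells_outside'[OF top(2), of i j] by auto
        next
          case False
          then show ?thesis using cell_leD[OF le(1), of i j] cell_leD[OF le(2), of i j] by simp
        qed
      next
        case True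
        then have j: "j < Suc q" using a[of i j i] by simp
        \<comment> \<open>Row \<open>i\<close> holds the only zero of \<open>a\<close> in column
          \<open>j\<close>, and a larger cell has no new zeros; if its column vanishes, this zero
          has survived.\<close>
        have zero: "d i j = 0" if "cell_le a d" "column d j = 0" for d
        proof -
          obtain i' where i': "i' < D" "d i' j = 0" using \<open>column d j = 0\<close> by (auto simp: column_eq_0_iff)
          then have "a i' j = 0" using cell_leD[OF that(1), of i' j] by auto
          then show ?thesis using a[of i j i'] i' True by auto
        qed
        show ?thesis
        proof (cases "j = q")
          case False
          then have "j < n * D - Suc k" using j by (simp add: q_def)
          then have "c (Suc k) i j = 0" "c' (Suc k) i j = 0"
            using zero[OF le(1)] zero[OF le(2)] flagsD(5)[OF C(1)[OF c], of j]
              flagsD(5)[OF C(1)[OF c'], of j] by blast+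
          then show ?thesis by simp
        next
          case jq: True
          \<comment> \<open>In column \<open>q\<close> all rows but \<open>i\<close> are nonzero in
            \<open>a\<close> and persist, so the sign of the column determines the released
            entry.\<close>
          have col: "column d q = d i q * (\<Prod>i'\<in>{..<D} - {i}. a i' q)" if "cell_le a d" for d
          proof -
            have "column d q = d i q * (\<Prod>i'\<in>{..<D} - {i}. d i' q)"
              unfolding column_def using True by (intro prod.remove) auto
            also have "(\<Prod>i'\<in>{..<D} - {i}. d i' q) = (\<Prod>i'\<in>{..<D} - {i}. a i' q)"
              using cell_leD[OF that] a[of i q] True jq by (intro prod.cong) auto
            finally show ?thesis .
          qed
          have "column (c (Suc k)) q = column (c' (Suc k)) q" "column (c (Suc k)) q \<noteq> 0"
            using sign flag_sign_neq_0[OF C(1)[OF c]] by (auto simp: flag_sign_def q_def)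
          then show ?thesis using col[OF le(1)] col[OF le(2)] jq by simp
        qed
      qed
      then have "c (Suc k) = c' (Suc k)" by auto
      then show "c = c'" using below by (metis ext)
    qed
    show "face (Suc k) ` descending_flags k = alternating_flags k"
    proof (intro subset_antisym subsetI)
      fix \<sigma> assume "\<sigma> \<in> face (Suc k) ` descending_flags k"
      then obtain c where c: "c \<in> descending_flags k" and \<sigma>: "\<sigma> = c(Suc k := (\<lambda>_ _. 0))"
        by (auto simp: face_def)
      have "alternating (flag_sign (Suc k) c) (\<lambda>r. lab (\<sigma> r)) {..k}"
        using C(3)[OF c] alternating_cong[of "{..k}" "\<lambda>r. lab (c r)" "\<lambda>r. lab (\<sigma> r)"] by (simp add: \<sigma>)
      then show "\<sigma> \<in> alternating_flags k"
        using C(2)[OF c] flag_sign[OF C(1)[OF c]] by (auto simp: alternating_flags_def \<sigma>)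
    next
      fix \<sigma> assume "\<sigma> \<in> alternating_flags k"
      then obtain s where \<sigma>: "\<sigma> \<in> flags k" and s: "s \<in> {1, -1}" and alt: "alternating s (\<lambda>r. lab (\<sigma> r)) {..k}"
        by (auto simp: alternating_flags_def)
      define a where "a = \<sigma> k"
      have a: "a \<in> cells" using flagsD(1)[OF \<sigma>] by (simp add: a_def)
      have cola: "column a j = 0" if "j \<le> q" for j using flagsD(5)[OF \<sigma>, of j] that by (simp add: Sq a_def)
      then obtain i0 where i0: "i0 < D" "a i0 q = 0" using column_eq_0_iff by blast
      \<comment> \<open>\<open>R\<close> is the product of the other entries of column
        \<open>q\<close>. Putting \<open>s * R\<close> in place of the zero gives the column the
        sign \<open>s\<close>, because \<open>R * R = 1\<close>.\<close>
      define R where "R = (\<Prod>i\<in>{..<D} - {i0}. a i q)"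
      have "\<bar>a i q\<bar> = 1" if "i < D" "i \<noteq> i0" for i
        using uniq[OF \<sigma>, of i0 q i] cells_sign[OF a, of i q] i0 that qM by (auto simp: a_def)
      then have "\<bar>R\<bar> = 1" by (simp add: R_def abs_prod)
      then have R: "R \<in> {1, -1}" by auto
      define b where "b = a(i0 := (a i0)(q := s * R))"
      have sR: "s * R \<noteq> 0" "s * R \<in> {-1, 0, 1}" using s R by auto
      have ab: "cell_le a b" using i0 by (auto simp: cell_le_def face_le_def b_def)
      have b: "b \<in> cells"
        using sR i0 qM cells_sign[OF a] cells_outside[OF a] cells_outside'[OF a]
        by (intro cells_fill[OF a ab]) (auto simp: b_def)
      have "cell_zeros b = cell_zeros a - {(i0, q)}"
        using sR by (auto simp: mem_cell_zeros b_def split: if_splits)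
      then have "card (cell_zeros b) = card (cell_zeros a) - 1"
        using i0 qM by (simp add: mem_cell_zeros)
      then have cardb: "card (cell_zeros b) + Suc k = n * D"
        using flagsD(2)[OF \<sigma>, of k] k by (simp add: a_def)
      have colb: "column b j = 0" if "j < q" for j
        using cola[of j] that by (auto simp: column_eq_0_iff b_def)
      have "column b q = b i0 q * (\<Prod>i\<in>{..<D} - {i0}. b i q)"
        unfolding column_def using i0 by (intro prod.remove) auto
      also have "(\<Prod>i\<in>{..<D} - {i0}. b i q) = R"
        unfolding R_def by (intro prod.cong) (auto simp: b_def)
      also have "b i0 q = s * R" by (simp add: b_def)
      also have "s * R * R = s" using R by auto
      finally have colq: "column b q = s" .
      define c where "c = \<sigma>(Suc k := b)"
      have "cell_le (c r) (c (Suc r))" if "r < Suc k" for r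
        using flagsD(3)[OF \<sigma>, of r] that ab by (cases "r = k") (auto simp: c_def a_def)
      then have c: "c \<in> flags (Suc k)"
        using \<sigma> b cardb colb unfolding flags_def q_def[symmetric] by (auto simp: c_def le_Suc_eq)
      have "flag_sign (Suc k) c = s" using colq by (simp add: flag_sign_def c_def q_def)
      moreover have "alternating s (\<lambda>r. lab (c r)) {..k}"
        using alt alternating_cong[of "{..k}" "\<lambda>r. lab (c r)" "\<lambda>r. lab (\<sigma> r)"] by (simp add: c_def)
      moreover have "column (c k) q = 0" using cola by (simp add: c_def a_def)
      ultimately have "c \<in> descending_flags k"
        using c by (simp add: descending_flags_def critical_flags_def q_def atMost)
      moreover have "face (Suc k) c = \<sigma>"
        using flagsD(4)[OF \<sigma>, of "Suc k"] by (simp add: face_def c_def fun_upd_idem)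
      ultimately show "\<sigma> \<in> face (Suc k) ` descending_flags k" by blast
    qed
  qed
qed

text \<open>Sum the local parity over all flags and exchange the order of summation. The cancelling
  flags disappear modulo twice the group order, and the descending ones are as many as the
  alternating flags one stage below.\<close>

lemma dvd_alternating_flags_step:
  assumes k: "Suc k \<le> n * D"
  shows "2 * card signed_perms dvd card (alternating_flags (Suc k)) + card (alternating_flags k)"
proof -
  let ?K = "Suc k"
  let ?w = "\<lambda>c. card {m \<in> {..?K}. c \<in> critical_flags ?K m}"
  have "2 * card signed_perms dvd (\<Sum>c\<in>flags ?K. ?w c + of_bool (c \<in> alternating_flags ?K))"
  proof (rule free_action_dvd_sum[where act = act_flag])
    show "\<exists>h\<in>signed_perms. act_flag h (act_flag g c) = c" if "g \<in> signed_perms" "c \<in> flags ?K" for g c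
      using act_flag_inverse[OF that(1)] that(2) by blast
    show "\<exists>k\<in>signed_perms. act_flag g (act_flag h c) = act_flag k c" if "g \<in> signed_perms" "h \<in> signed_perms" for g h c
      using act_flag_comp[OF that] .
    show "?w c + of_bool (c \<in> alternating_flags ?K) \<le>
        ?w (act_flag g c) + of_bool (act_flag g c \<in> alternating_flags ?K)"
      if "g \<in> signed_perms" "c \<in> flags ?K" for g c
      using act_critical_flags[OF that] act_alternating_flags[OF that] by simp
  qed (use finite_flags finite_signed_perms signed_perms_nonempty act_flags free_on_flags even_critical_faces in auto)
  also have "(\<Sum>c\<in>flags ?K. ?w c + of_bool (c \<in> alternating_flags ?K)) =
      (\<Sum>m\<le>?K. card {c \<in> flags ?K. c \<in> critical_flags ?K m}) + card (alternating_flags ?K)"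
  proof -
    have "flags ?K \<inter> {c. c \<in> alternating_flags ?K} = alternating_flags ?K"
      by (auto simp: alternating_flags_def)
    then have "(\<Sum>c\<in>flags ?K. of_bool (c \<in> alternating_flags ?K)) = card (alternating_flags ?K)"
      using finite_flags by (simp add: sum_of_bool_eq)
    then show ?thesis
      using card_Collect_swap[OF finite_flags[of ?K] finite_atMost[of ?K], where R = "\<lambda>c m. c \<in> critical_flags ?K m"]
      by (simp only: sum.distrib)
  qed
  also have "(\<Sum>m\<le>?K. card {c \<in> flags ?K. c \<in> critical_flags ?K m}) =
      (\<Sum>m\<le>?K. card (cancelling_flags ?K m)) + card (descending_flags k)"
  proof -
    have crit: "{c \<in> flags ?K. c \<in> critical_flags ?K m} = critical_flags ?K m" for m
      by (auto simp: critical_flags_def)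
    have "critical_flags ?K m = cancelling_flags ?K m" if "m \<le> k" for m
      using that by (auto simp: cancelling_flags_def)
    moreover have "critical_flags ?K ?K = cancelling_flags ?K ?K \<union> descending_flags k"
      by (auto simp: cancelling_flags_def descending_flags_def)
    moreover have "finite (critical_flags ?K ?K)" using finite_flags by (auto simp: critical_flags_def)
    moreover have "cancelling_flags ?K ?K \<inter> descending_flags k = {}"
      by (auto simp: cancelling_flags_def descending_flags_def)
    ultimately have "card (critical_flags ?K ?K) = card (cancelling_flags ?K ?K) + card (descending_flags k)"
      by (simp add: card_Un_disjoint)
    then show ?thesis unfolding crit using \<open>\<And>m. m \<le> k \<Longrightarrow> _\<close> by simp
  qed
  finally have "2 * card signed_perms dvd (\<Sum>m\<le>?K. card (cancelling_flags ?K m)) +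
      (card (descending_flags k) + card (alternating_flags ?K))"
    by (simp add: ac_simps)
  moreover have "2 * card signed_perms dvd (\<Sum>m\<le>?K. card (cancelling_flags ?K m))"
    using dvd_card_cancelling_flags[of ?K] by (intro dvd_sum) auto
  ultimately have "2 * card signed_perms dvd card (descending_flags k) + card (alternating_flags ?K)"
    using dvd_add_right_iff by blast
  then show ?thesis using card_descending_flags[OF k] by (simp add: add.commute)
qed

section \<open>The base count and the contradiction\<close>

text \<open>A tuple of vertices whose zeros cover the first \<open>n * D\<close> columns is an
  ordered partition of these columns into blocks of size \<open>n\<close>, together with one of two
  antipodal vertices for each block.\<close>

lemma card_flags_0: "card (flags 0) = 2 ^ D * (\<Prod>i<D. (n * Suc i) choose n)"
proof -
  let ?Fam = "{F \<in> {..<D} \<rightarrow>\<^sub>E Pow {..<n * D}. (\<forall>i<D. card (F i) = n) \<and>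
    disjoint_family_on F {..<D} \<and> (\<Union>i<D. F i) = {..<n * D}}"
  let ?V = "\<lambda>F. \<Pi>\<^sub>E i\<in>{..<D}. {s \<in> P. zeros M s = F i}"
  let ?to = "\<lambda>c. (restrict (\<lambda>i. zeros M (c 0 i)) {..<D}, restrict (c (0::nat)) {..<D})"
  let ?from = "\<lambda>(F :: nat \<Rightarrow> nat set, Q) r i. if r = (0::nat) \<and> i < D then Q i else (\<lambda>_. 0 :: int)"
  have "bij_betw ?to (flags 0) (SIGMA F:?Fam. ?V F)"
  proof (rule bij_betwI[where g = ?from])
    show "?to \<in> flags 0 \<rightarrow> (SIGMA F:?Fam. ?V F)"
    proof
      fix c assume c: "c \<in> flags 0"
      define F where "F = restrict (\<lambda>i. zeros M (c 0 i)) {..<D}"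
      have F: "F i = zeros M (c 0 i)" if "i < D" for i using that by (simp add: F_def)
      have cov: "snd ` cell_zeros (c 0) = {..<n * D}" "inj_on snd (cell_zeros (c 0))"
        using covered_columns[of "c 0" "n * D"] flagsD[OF c] M_gt by auto
      have mem: "j \<in> F i \<longleftrightarrow> (i, j) \<in> cell_zeros (c 0)" if "i < D" for i j
        using that by (simp add: F cell_zeros_def)
      have sub: "F i \<subseteq> {..<n * D}" if "i < D" for i
        using cov(1) mem[OF that] by force
      have "disjoint_family_on F {..<D}"
        unfolding disjoint_family_on_def
      proof (intro ballI impI)
        fix i i' assume i: "i \<in> {..<D}" "i' \<in> {..<D}" "i \<noteq> i'"
        have False if "j \<in> F i" "j \<in> F i'" for j
          using inj_onD[OF cov(2), of "(i, j)" "(i', j)"] that mem i by auto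
        then show "F i \<inter> F i' = {}" by blast
      qed
      moreover have "(\<Union>i<D. F i) = {..<n * D}"
      proof (rule subset_antisym)
        show "{..<n * D} \<subseteq> (\<Union>i<D. F i)"
        proof
          fix j assume "j \<in> {..<n * D}"
          then have "j \<in> snd ` cell_zeros (c 0)" by (simp only: cov(1))
          then obtain i where "(i, j) \<in> cell_zeros (c 0)" by auto
          then show "j \<in> (\<Union>i<D. F i)" using mem[of i j] by (auto simp: mem_cell_zeros)
        qed
      qed (use sub in auto)
      moreover have "\<forall>i<D. card (F i) = n" using card_zeros_bottom[OF c] F by simp
      moreover have "F \<in> {..<D} \<rightarrow>\<^sub>E Pow {..<n * D}" using sub by (auto simp: F_def PiE_def)
      ultimately have "F \<in> ?Fam" by blast
      moreover have "restrict (c 0) {..<D} \<in> ?V F"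
        using flagsD(1)[OF c, of 0] by (auto simp: cells_def F)
      ultimately show "?to c \<in> (SIGMA F:?Fam. ?V F)" by (simp add: F_def)
    qed
    show "?from \<in> (SIGMA F:?Fam. ?V F) \<rightarrow> flags 0"
    proof
      fix x assume x: "x \<in> (SIGMA F:?Fam. ?V F)"
      obtain F Q where FQ: "x = (F, Q)" by (cases x)
      define c where "c = ?from (F, Q)"
      have Q: "Q i \<in> P" "zeros M (Q i) = F i" if "i < D" for i
        using PiE_mem[of Q "{..<D}" "\<lambda>i. {s \<in> P. zeros M s = F i}" i] x that by (simp_all add: FQ)
      have F: "card (F i) = n" if "i < D" for i using x that by (simp add: FQ)
      have un: "(\<Union>i<D. F i) = {..<n * D}" using x by (simp add: FQ)
      have c0: "c 0 i = Q i" if "i < D" for i using that by (simp add: c_def)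
      have "c 0 \<in> cells" using Q by (auto simp: cells_def c_def)
      moreover have "card (cell_zeros (c 0)) = (\<Sum>i<D. n)"
        unfolding card_cell_zeros using Q F c0 by (intro sum.cong) auto
      moreover have "column (c 0) j = 0" if "j < n * D" for j
      proof -
        have "j \<in> (\<Union>i<D. F i)" using that un by simp
        then obtain i where "i < D" "j \<in> zeros M (Q i)" using Q by auto
        then show ?thesis by (auto simp: column_eq_0_iff zeros_def c0)
      qed
      ultimately have "c \<in> flags 0" by (auto simp: flags_def c_def mult.commute)
      then show "?from x \<in> flags 0" by (simp add: FQ c_def)
    qed
    show "?from (?to c) = c" if "c \<in> flags 0" for c
    proof (intro ext)
      fix r i j
      show "?from (?to c) r i j = c r i j"
        using flagsD(1)[OF that, of 0] flagsD(4)[OF that, of r] by (cases "r = 0") (auto simp: cells_def)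
    qed
    show "?to (?from x) = x" if x: "x \<in> (SIGMA F:?Fam. ?V F)" for x
    proof -
      obtain F Q where FQ: "x = (F, Q)" by (cases x)
      have Q: "zeros M (Q i) = F i" if "i < D" for i
        using PiE_mem[of Q "{..<D}" "\<lambda>i. {s \<in> P. zeros M s = F i}" i] x that by (simp_all add: FQ)
      have "F \<in> extensional {..<D}" "Q \<in> extensional {..<D}"
        using x by (simp_all add: FQ PiE_def)
      then show ?thesis using Q unfolding FQ
        by (auto simp: fun_eq_iff extensional_def restrict_def)
    qed
  qed
  then have "card (flags 0) = card (SIGMA F:?Fam. ?V F)" by (rule bij_betw_same_card)
  also have "\<dots> = (\<Sum>F\<in>?Fam. card (?V F))"
  proof (rule card_SigmaI)
    show "finite ?Fam" by (rule finite_subset[of _ "{..<D} \<rightarrow>\<^sub>E Pow {..<n * D}"]) (auto intro!: finite_PiE)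
    show "\<forall>F\<in>?Fam. finite (?V F)" using finite_P by (auto intro!: finite_PiE)
  qed
  also have "\<dots> = (\<Sum>F\<in>?Fam. 2 ^ D)"
  proof (rule sum.cong[OF refl])
    fix F assume F: "F \<in> ?Fam"
    have "card {s \<in> P. zeros M s = F i} = 2" if "i < D" for i
    proof (rule card_vertices)
      have "F i \<subseteq> {..<n * D}" using F that by (auto simp: PiE_def)
      then show "F i \<subseteq> {..<M}" using M_gt by force
      show "card (F i) = n" using F that by simp
    qed
    then show "card (?V F) = 2 ^ D" by (simp add: card_PiE)
  qed
  also have "\<dots> = 2 ^ D * card ?Fam" by simp
  also have "card ?Fam = (\<Prod>i<D. (n * Suc i) choose n)"
    using n_ge_2 by (intro card_equal_size_families) auto
  finally show ?thesis .
qed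

lemma flags_0_alternating: "alternating_flags 0 = flags 0"
proof -
  have "alternating 1 (\<lambda>r. lab (c r)) {..0} \<or> alternating (- 1) (\<lambda>r. lab (c r)) {..0}"
    if "c \<in> flags 0" for c
  proof -
    have "lab (c 0) \<noteq> 0" using flagsD(1)[OF that] lab_nonzero by simp
    then have "sgn (lab (c 0)) = 1 \<or> sgn (lab (c 0)) = - 1" by (auto simp: sgn_if)
    moreover have "alternating (sgn (lab (c 0))) (\<lambda>r. lab (c r)) {..0}"
      unfolding alternating_def by (auto intro!: exI[of _ "[lab (c 0)]"])
    ultimately show ?thesis by metis
  qed
  then show ?thesis by (auto simp: alternating_flags_def)
qed

text \<open>After division by the group order the base count is odd, and each step changes the
  quotient by an even number.\<close>

lemma odd_alternating_flags:
  "k \<le> n * D \<Longrightarrow> \<exists>q. odd q \<and> card (alternating_flags k) = card signed_perms * q"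
proof (induction k)
  case 0
  obtain q where "odd q" "(\<Prod>i<D. (n * Suc i) choose n) = fact D * q"
    using odd_multinomial_div_fact[OF n_power] by blast
  then show ?case using card_flags_0 by (auto simp: flags_0_alternating card_signed_perms)
next
  case (Suc k)
  then obtain q where q: "odd q" "card (alternating_flags k) = card signed_perms * q" by auto
  obtain p where p: "card (alternating_flags (Suc k)) + card (alternating_flags k) = 2 * card signed_perms * p"
    using dvd_alternating_flags_step[OF Suc.prems] by (elim dvdE)
  have "card signed_perms > 0" by (simp add: card_signed_perms)
  then have le: "q \<le> 2 * p" using p q(2) by (metis le_add2 mult.assoc mult.left_commute nat_mult_le_cancel1)
  have "card (alternating_flags (Suc k)) = card signed_perms * (2 * p - q)"
    using p q(2) by (simp add: diff_mult_distrib2 algebra_simps)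
  moreover have "odd (2 * p - q)" using q(1) le by simp
  ultimately show ?case by blast
qed

theorem no_labelling: False
proof -
  obtain q where q: "odd q" "card (alternating_flags (n * D)) = card signed_perms * q"
    using odd_alternating_flags[of "n * D"] by auto
  have "alternating_flags (n * D) = {}"
  proof (rule ccontr)
    assume "alternating_flags (n * D) \<noteq> {}"
    then obtain c s where c: "c \<in> flags (n * D)" and alt: "alternating s (\<lambda>r. lab (c r)) {..n * D}"
      by (auto simp: alternating_flags_def)
    have "(\<lambda>r. \<bar>lab (c r)\<bar>) ` {..n * D} \<subseteq> {1..int (n * D)}"
      using flagsD(1)[OF c] lab_le lab_nonzero by force
    then have "card ((\<lambda>r. \<bar>lab (c r)\<bar>) ` {..n * D}) \<le> card {1..int (n * D)}"
      by (intro card_mono) auto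
    moreover have "card {1..int N} = N" for N by simp
    ultimately have "card ((\<lambda>r. \<bar>lab (c r)\<bar>) ` {..n * D}) \<le> n * D" by (simp only:)
    then show False using card_image[OF alternating_inj_abs[OF alt]] by simp
  qed
  then have "card signed_perms * q = 0" using q(2) by simp
  then have "q = 0" by (simp add: card_signed_perms)
  then show False using q(1) by simp
qed

end

section \<open>Sign vectors of points in general position\<close>

text \<open>Linear rather than affine general position, as the points are normals of hyperplanes
  through the origin. Injectivity is separate because \<open>independent\<close> speaks of the image
  set.\<close>

definition general_position :: "(nat \<Rightarrow> 'a::euclidean_space) \<Rightarrow> nat \<Rightarrow> bool" where
  "general_position p M \<longleftrightarrow>
     (\<forall>I\<subseteq>{..<M}. card I \<le> DIM('a) \<longrightarrow> inj_on p I \<and> independent (p ` I))"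

text \<open>A new point has to avoid the spans of fewer than \<open>DIM('a)\<close> earlier ones.
  These are finitely many negligible subspaces and cannot fill a ball.\<close>

lemma general_position_near:
  fixes u :: "nat \<Rightarrow> 'a::euclidean_space"
  assumes "e > 0"
  shows "\<exists>p. general_position p M \<and> (\<forall>j<M. dist (p j) (u j) < e)"
proof (induction M)
  case 0
  then show ?case by (auto simp: general_position_def independent_empty)
next
  case (Suc M)
  then obtain p where p: "general_position p M" "\<And>j. j < M \<Longrightarrow> dist (p j) (u j) < e" by blast
  let ?\<I> = "{I. I \<subseteq> {..<M} \<and> card I < DIM('a)}"
  let ?U = "\<Union>I\<in>?\<I>. span (p ` I)"
  have "negligible ?U"
  proof (rule negligible_Union)
    show "negligible T" if "T \<in> (\<lambda>I. span (p ` I)) ` ?\<I>" for T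
    proof (rule negligible_lowdim)
      obtain I where I: "I \<in> ?\<I>" "T = span (p ` I)" using \<open>T \<in> _\<close> by blast
      have "finite I" using I finite_subset by auto
      then have "dim (p ` I) \<le> card (p ` I)" by (intro dim_le_card') auto
      also have "\<dots> \<le> card I" using \<open>finite I\<close> by (rule card_image_le)
      finally show "dim T < DIM('a)" using I by simp
    qed
  qed simp
  moreover have "\<not> negligible (ball (u M) e)" using assms by (intro open_not_negligible) auto
  ultimately have "\<not> ball (u M) e \<subseteq> ?U" using negligible_subset by blast
  then obtain x where "x \<in> ball (u M) e" and xU: "x \<notin> ?U" by blast
  then have x: "dist (u M) x < e" by simp
  let ?p = "p(M := x)"
  have "inj_on ?p I \<and> independent (?p ` I)" if I: "I \<subseteq> {..<Suc M}" "card I \<le> DIM('a)" for I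
  proof (cases "M \<in> I")
    case False
    then have "I \<subseteq> {..<M}" using I(1) by (auto simp: less_Suc_eq)
    moreover have "?p ` I = p ` I" "inj_on ?p I = inj_on p I"
      using False by (auto simp: inj_on_def image_iff)
    ultimately show ?thesis using p(1) I(2) by (simp add: general_position_def)
  next
    case True
    let ?I = "I - {M}"
    have fin: "finite I" using I(1) finite_subset by auto
    have I': "?I \<subseteq> {..<M}" using I(1) by (auto simp: less_Suc_eq)
    have "card ?I < card I" using True fin by (meson card_Diff1_less)
    then have card: "card ?I < DIM('a)" using I(2) by simp
    have ind: "inj_on p ?I" "independent (p ` ?I)" using p(1) I' card by (auto simp: general_position_def)
    have xs: "x \<notin> span (p ` ?I)" using xU I' card by blast
    have im: "?p ` I = insert x (p ` ?I)" using True by auto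
    have "x \<notin> p ` ?I" using xs span_base[of x "p ` ?I"] by auto
    then have "inj_on ?p I" using ind(1) by (auto simp: inj_on_def)
    moreover have "independent (insert x (p ` ?I))" using xs ind(2) by (rule independent_insertI)
    ultimately show ?thesis using im by simp
  qed
  then have "general_position ?p (Suc M)" by (simp add: general_position_def)
  moreover have "\<forall>j<Suc M. dist (?p j) (u j) < e" using p(2) x by (auto simp: less_Suc_eq dist_commute)
  ultimately show ?case by blast
qed

lemma general_net:
  assumes "\<delta> > 0"
  obtains p :: "nat \<Rightarrow> 'a::euclidean_space" and M
  where "general_position p M" "M > N" "\<And>u. norm u = 1 \<Longrightarrow> \<exists>j<M. dist (p j) u < \<delta>"
proof -
  have "compact (sphere (0::'a) 1)" by simp
  then obtain K where K: "finite K" "sphere (0::'a) 1 \<subseteq> (\<Union>x\<in>K. ball x (\<delta> / 2))"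
    using assms unfolding compact_eq_totally_bounded by (meson half_gt_zero)
  obtain h where h: "bij_betw h {0..<card K} K" using ex_bij_betw_nat_finite[OF K(1)] by blast
  \<comment> \<open>The first \<open>card K\<close> points approximate the centres of the net, the
    others raise their number above \<open>N\<close>. Half of \<delta> is spent on the net, half on
    the perturbation.\<close>
  obtain p where p: "general_position p (card K + N + 1)"
    "\<And>j. j < card K + N + 1 \<Longrightarrow> dist (p j) (h j) < \<delta> / 2"
    using general_position_near[of "\<delta> / 2" "card K + N + 1" h] assms by auto
  show thesis
  proof (rule that[OF p(1)])
    show "\<exists>j<card K + N + 1. dist (p j) u < \<delta>" if "norm u = 1" for u
    proof -
      obtain x where x: "x \<in> K" "dist x u < \<delta> / 2" using K(2) \<open>norm u = 1\<close> by fastforce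
      then have "x \<in> h ` {0..<card K}" using bij_betw_imp_surj_on[OF h] by simp
      then obtain j where j: "j < card K" "h j = x" by auto
      have "dist (p j) u \<le> dist (p j) (h j) + dist x u" unfolding j(2) by (rule dist_triangle)
      also have "\<dots> < \<delta>" using p(2)[of j] j x by simp
      finally show ?thesis using j by (intro exI[of _ j]) auto
    qed
  qed auto
qed

definition sign_vector :: "(nat \<Rightarrow> 'a::real_inner) \<Rightarrow> nat \<Rightarrow> 'a \<Rightarrow> nat \<Rightarrow> int" where
  "sign_vector p M x j =
     (if j < M then if x \<bullet> p j > 0 then 1 else if x \<bullet> p j < 0 then - 1 else 0 else 0)"

lemma sign_vector_uminus: "sign_vector p M (- x) = (\<lambda>j. - sign_vector p M x j)"
  by (auto simp: sign_vector_def fun_eq_iff)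

lemma sign_vector_scale: "c > 0 \<Longrightarrow> sign_vector p M (c *\<^sub>R x) = sign_vector p M x"
  by (auto simp: sign_vector_def fun_eq_iff zero_less_mult_iff mult_less_0_iff)

lemma sign_vector_eq_0_iff: "j < M \<Longrightarrow> sign_vector p M x j = 0 \<longleftrightarrow> x \<bullet> p j = 0"
  by (auto simp: sign_vector_def)

lemma zeros_sign_vector: "zeros M (sign_vector p M x) = {j. j < M \<and> x \<bullet> p j = 0}"
  by (auto simp: zeros_def sign_vector_eq_0_iff)

text \<open>The minimum of finitely many quotients; adding 1 to the denominators avoids division by
  zero, and inserting 1 keeps the set nonempty.\<close>

lemma small_factor:
  fixes a b :: "'i \<Rightarrow> real"
  assumes "finite J" "\<And>j. j \<in> J \<Longrightarrow> a j > 0"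
  shows "\<exists>\<delta>>0. \<forall>j\<in>J. \<delta> * b j < a j"
proof -
  let ?A = "insert 1 ((\<lambda>j. a j / (1 + \<bar>b j\<bar>)) ` J)"
  define \<delta> where "\<delta> = Min ?A"
  have "\<delta> \<in> ?A" unfolding \<delta>_def using assms(1) by (intro Min_in) auto
  then have pos: "\<delta> > 0" using assms(2) by (auto intro!: divide_pos_pos add_pos_nonneg)
  have "\<delta> * b j < a j" if "j \<in> J" for j
  proof -
    have "\<delta> \<le> a j / (1 + \<bar>b j\<bar>)" unfolding \<delta>_def using assms(1) that by (intro Min_le) auto
    then have "\<delta> * (1 + \<bar>b j\<bar>) \<le> a j" by (simp add: pos_le_divide_eq)
    moreover have "\<delta> * b j \<le> \<delta> * \<bar>b j\<bar>" using pos by (intro mult_left_mono) auto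
    ultimately show ?thesis using pos unfolding distrib_left by linarith
  qed
  then show ?thesis using pos by blast
qed

section \<open>Faces of a central arrangement in general position\<close>

locale general_points =
  fixes p :: "nat \<Rightarrow> 'a::euclidean_space" and M :: nat
  assumes general_position: "general_position p M" and dim_le: "DIM('a) \<le> M"
begin

abbreviation "sv \<equiv> sign_vector p M"

text \<open>A functional with the prescribed values on independent vectors extends linearly and is
  represented by the vector \<open>y\<close>.\<close>

lemma dual_vector:
  assumes "I \<subseteq> {..<M}" "card I \<le> DIM('a)"
  shows "\<exists>y. \<forall>j\<in>I. y \<bullet> p j = e j"
proof -
  have ind: "inj_on p I" "independent (p ` I)"
    using general_position assms by (auto simp: general_position_def)
  obtain g where g: "linear g" "\<And>v. v \<in> p ` I \<Longrightarrow> g v = e (inv_into I p v)"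
    using linear_independent_extend[OF ind(2), of "\<lambda>v. e (inv_into I p v)"] by blast
  define y where "y = (\<Sum>b\<in>Basis. g b *\<^sub>R b)"
  have "y \<bullet> p j = e j" if "j \<in> I" for j
  proof -
    have "y \<bullet> p j = (\<Sum>b\<in>Basis. (p j \<bullet> b) *\<^sub>R g b)"
      unfolding y_def inner_sum_left
      by (intro sum.cong) (simp_all add: inner_commute[of _ "p j"] mult.commute)
    also have "\<dots> = g (\<Sum>b\<in>Basis. (p j \<bullet> b) *\<^sub>R b)"
      using g(1) by (simp add: linear_sum linear_scale)
    also have "\<dots> = e j" using g(2) ind(1) that by (simp add: euclidean_representation)
    finally show ?thesis .
  qed
  then show ?thesis by blast
qed

lemma orthogonal_eq_0:
  assumes "I \<subseteq> {..<M}" "card I = DIM('a)" "\<And>j. j \<in> I \<Longrightarrow> x \<bullet> p j = 0"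
  shows "x = 0"
proof -
  have ind: "inj_on p I" "independent (p ` I)"
    using general_position assms by (auto simp: general_position_def)
  have "UNIV \<subseteq> span (p ` I)"
    using ind assms(2) by (intro card_ge_dim_independent) (auto simp: card_image)
  then have "orthogonal x x"
    using assms(3) by (intro orthogonal_to_span[of x "p ` I"]) (auto simp: orthogonal_def)
  then show ?thesis by (simp add: orthogonal_def)
qed

lemma card_orthogonal:
  assumes "x \<noteq> 0"
  shows "card (zeros M (sv x)) < DIM('a)"
proof (rule ccontr)
  assume "\<not> ?thesis"
  then obtain I where I: "I \<subseteq> zeros M (sv x)" "card I = DIM('a)"
    by (meson not_less obtain_subset_with_card_n)
  then have "x = 0" by (intro orthogonal_eq_0[of I]) (auto simp: zeros_sign_vector)
  then show False using assms by simp
qed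

lemma sv_nonzero: "x \<noteq> 0 \<Longrightarrow> \<exists>j<M. sv x j \<noteq> 0"
proof (rule ccontr)
  assume "x \<noteq> 0" "\<not> (\<exists>j<M. sv x j \<noteq> 0)"
  then have "zeros M (sv x) = {..<M}" by (auto simp: zeros_def)
  then show False using card_orthogonal[OF \<open>x \<noteq> 0\<close>] dim_le by simp
qed

text \<open>The term is from oriented matroids. Without the origin, the sign vectors encode the
  faces cut out on the sphere.\<close>

definition covectors :: "(nat \<Rightarrow> int) set" where
  "covectors = sv ` (- {0})"

text \<open>Move \<open>x\<close> slightly in a direction \<open>y\<close> whose inner products at
  the zeros of \<open>s\<close> are the new signs; a small \<delta> preserves all other
  signs.\<close>

lemma covectors_fill:
  assumes s: "s \<in> covectors" and le: "face_le s t" and t: "\<And>j. t j \<in> {-1, 0, 1}" "\<And>j. j \<ge> M \<Longrightarrow> t j = 0"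
  shows "t \<in> covectors"
proof -
  obtain x where x: "x \<noteq> 0" "s = sv x" using s by (auto simp: covectors_def)
  let ?Z = "zeros M s"
  obtain y where y: "\<And>j. j \<in> ?Z \<Longrightarrow> y \<bullet> p j = real_of_int (t j)"
    using dual_vector[of ?Z "\<lambda>j. real_of_int (t j)"] card_orthogonal[OF x(1)]
    by (auto simp: x(2) zeros_def less_imp_le)
  obtain \<delta> where \<delta>: "\<delta> > 0" "\<And>j. j \<in> {..<M} - ?Z \<Longrightarrow> \<delta> * \<bar>y \<bullet> p j\<bar> < \<bar>x \<bullet> p j\<bar>"
    using small_factor[of "{..<M} - ?Z" "\<lambda>j. \<bar>x \<bullet> p j\<bar>" "\<lambda>j. \<bar>y \<bullet> p j\<bar>"]
    by (auto simp: x(2) zeros_sign_vector)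
  have "sv (x + \<delta> *\<^sub>R y) j = t j" for j
  proof (cases "j < M")
    case False
    then show ?thesis using t(2) by (simp add: sign_vector_def)
  next
    case jM: True
    have ip: "(x + \<delta> *\<^sub>R y) \<bullet> p j = x \<bullet> p j + \<delta> * (y \<bullet> p j)" by (simp add: inner_add_left)
    show ?thesis
    proof (cases "j \<in> ?Z")
      case True
      then have "x \<bullet> p j = 0" by (simp add: x(2) zeros_sign_vector)
      then show ?thesis using y[OF True] \<delta>(1) t(1)[of j] jM by (auto simp: sign_vector_def ip)
    next
      case False
      then have d: "\<bar>\<delta> * (y \<bullet> p j)\<bar> < \<bar>x \<bullet> p j\<bar>" using \<delta> jM by (simp add: abs_mult)
      have "s j \<noteq> 0" using False jM by (simp add: zeros_def)
      then have "t j = sv x j" using le by (simp add: face_le_def x(2))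
      moreover have "sv (x + \<delta> *\<^sub>R y) j = sv x j"
        using d unfolding sign_vector_def ip by (auto simp: abs_if split: if_splits)
      ultimately show ?thesis by simp
    qed
  qed
  then have eq: "t = sv (x + \<delta> *\<^sub>R y)" by auto
  obtain j where "s j \<noteq> 0" using sv_nonzero[OF x(1)] x(2) by auto
  then have "t j \<noteq> 0" using le by (simp add: face_le_def)
  moreover have "sv 0 j = 0" by (simp add: sign_vector_def)
  ultimately have "x + \<delta> *\<^sub>R y \<noteq> 0" unfolding eq by metis
  then show ?thesis unfolding covectors_def eq by blast
qed

text \<open>The hyperplanes in \<open>Z\<close> meet in a line, and its two rays are the vertices. A
  further hyperplane \<open>k\<close> serves to normalise a generator \<open>y\<close> of the
  line.\<close>

lemma card_covector_vertices:
  assumes Z: "Z \<subseteq> {..<M}" "Suc (card Z) = DIM('a)"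
  shows "card {s \<in> covectors. zeros M s = Z} = 2"
proof -
  have "card Z < card {..<M}" using Z(2) dim_le by simp
  then obtain k where k: "k < M" "k \<notin> Z" using Z(1) by (metis lessThan_iff order_less_irrefl subsetI subset_antisym)
  have finZ: "finite Z" using Z(1) finite_subset by blast
  have I: "insert k Z \<subseteq> {..<M}" "card (insert k Z) = DIM('a)" using k Z finZ by auto
  obtain y where y: "\<And>j. j \<in> insert k Z \<Longrightarrow> y \<bullet> p j = of_bool (j = k)"
    using dual_vector[OF I(1) eq_refl[OF I(2)], of "\<lambda>j. of_bool (j = k)"] by blast
  have yk: "y \<bullet> p k = 1" "\<And>j. j \<in> Z \<Longrightarrow> y \<bullet> p j = 0" using y k by auto
  have y0: "y \<noteq> 0" using yk(1) by auto
  have zy: "zeros M (sv y) = Z"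
  proof (rule sym, rule card_subset_eq)
    show sub: "Z \<subseteq> zeros M (sv y)" using Z(1) yk(2) by (auto simp: zeros_sign_vector)
    show "card Z = card (zeros M (sv y))"
      using card_mono[OF _ sub] card_orthogonal[OF y0] Z(2) by simp
  qed simp
  have "{s \<in> covectors. zeros M s = Z} = {sv y, sv (- y)}"
  proof (intro subset_antisym subsetI)
    fix s assume "s \<in> {s \<in> covectors. zeros M s = Z}"
    then obtain x where x: "x \<noteq> 0" "s = sv x" "zeros M (sv x) = Z" by (auto simp: covectors_def)
    define c where "c = x \<bullet> p k"
    have "k \<notin> zeros M (sv x)" using x k by simp
    then have "c \<noteq> 0" using k by (simp add: c_def zeros_sign_vector)
    have "x - c *\<^sub>R y = 0"
    proof (rule orthogonal_eq_0[OF I])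
      show "(x - c *\<^sub>R y) \<bullet> p j = 0" if "j \<in> insert k Z" for j
      proof (cases "j = k")
        case False
        then have "j \<in> zeros M (sv x)" using that x(3) by simp
        then show ?thesis using yk(2) that False by (simp add: inner_diff_left zeros_sign_vector)
      qed (simp add: inner_diff_left yk c_def)
    qed
    then have "x = c *\<^sub>R y" "x = (- c) *\<^sub>R (- y)" by auto
    then show "s \<in> {sv y, sv (- y)}"
      using \<open>c \<noteq> 0\<close> x(2) sign_vector_scale[of c p M y] sign_vector_scale[of "- c" p M "- y"]
      by (cases "c > 0") auto
  next
    fix s assume "s \<in> {sv y, sv (- y)}"
    moreover have "zeros M (sv (- y)) = Z" using zy by (simp add: zeros_sign_vector)
    ultimately show "s \<in> {s \<in> covectors. zeros M s = Z}" using y0 zy by (auto simp: covectors_def)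
  qed
  moreover have "sv y \<noteq> sv (- y)"
  proof
    assume "sv y = sv (- y)"
    then have "sv y k = sv (- y) k" by simp
    then show False using yk(1) k by (simp add: sign_vector_def)
  qed
  ultimately show ?thesis by simp
qed

text \<open>The hyperplanes in \<open>Z\<close> meet in a plane spanned by \<open>A\<close> and
  \<open>B\<close>, and the face of \<open>A\<close> is an open sector of it. Its two bounding rays
  are reached from \<open>A\<close> by tilting towards \<open>B\<close> and \<open>- B\<close> until
  another inner product vanishes.\<close>

lemma card_covector_endpoints:
  assumes s: "s \<in> covectors" and Z: "Suc (Suc (card (zeros M s))) = DIM('a)"
  shows "card {t \<in> covectors. face_le t s \<and> Suc (card (zeros M t)) = DIM('a)} = 2"
proof -
  obtain A where A: "A \<noteq> 0" "s = sv A" using s by (auto simp: covectors_def)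
  define Z where "Z = zeros M s"
  have ZM: "Z \<subseteq> {..<M}" and finZ: "finite Z" and cardZ: "Suc (Suc (card Z)) = DIM('a)"
    using Z by (auto simp: Z_def zeros_def)
  define J where "J = {..<M} - Z"
  have "card J \<ge> 2" using card_Diff_subset[OF finZ ZM] cardZ dim_le by (simp add: J_def)
  then obtain J2 where J2: "J2 \<subseteq> J" "card J2 = 2" by (metis obtain_subset_with_card_n)
  then obtain k1 k2 where k: "k1 \<in> J" "k2 \<in> J" "k1 \<noteq> k2" by (auto simp: card_2_iff)
  have finJ: "finite J" by (simp add: J_def)
  have AZ: "A \<bullet> p j = 0" if "j \<in> Z" for j using that by (simp add: Z_def A(2) zeros_sign_vector)
  have AJ: "A \<bullet> p j \<noteq> 0" if "j \<in> J" for j using that by (simp add: J_def Z_def A(2) zeros_sign_vector)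
  have "k1 \<notin> insert k2 Z" "k2 \<notin> Z" using k by (auto simp: J_def)
  then have I: "insert k1 (insert k2 Z) \<subseteq> {..<M}" "card (insert k1 (insert k2 Z)) = DIM('a)"
    using k ZM cardZ finZ by (auto simp: J_def)
  \<comment> \<open>\<open>B\<close> lies in the plane and is independent of \<open>A\<close>: it is
    orthogonal to \<open>p k1\<close>, which \<open>A\<close> is not, and nonzero because of
    \<open>k2\<close>.\<close>
  obtain B where B': "\<And>j. j \<in> insert k1 (insert k2 Z) \<Longrightarrow> B \<bullet> p j = of_bool (j = k2)"
    using dual_vector[OF I(1) eq_refl[OF I(2)], of "\<lambda>j. of_bool (j = k2)"] by blast
  have B: "B \<bullet> p k1 = 0" "B \<bullet> p k2 = 1" "\<And>j. j \<in> Z \<Longrightarrow> B \<bullet> p j = 0"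
    using B' k by (auto simp: J_def)
  define r where "r j = (B \<bullet> p j) / (A \<bullet> p j)" for j
  have Br: "B \<bullet> p j = r j * (A \<bullet> p j)" if "j \<in> J" for j using AJ[OF that] by (simp add: r_def)
  \<comment> \<open>The least coefficient for which all
    \<open>c \<epsilon> + \<epsilon> * r j\<close> are nonnegative, so that
    \<open>v \<epsilon>\<close> stays in the closed sector and touches its boundary.\<close>
  define c where "c \<epsilon> = Max ((\<lambda>j. - \<epsilon> * r j) ` J)" for \<epsilon>
  define v where "v \<epsilon> = c \<epsilon> *\<^sub>R A + \<epsilon> *\<^sub>R B" for \<epsilon>
  have c_ge: "- \<epsilon> * r j \<le> c \<epsilon>" if "j \<in> J" for \<epsilon> j
    unfolding c_def using finJ that by (intro Max_ge) auto
  have c_eq: "\<exists>j\<in>J. c \<epsilon> = - \<epsilon> * r j" for \<epsilon>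
  proof -
    have "c \<epsilon> \<in> (\<lambda>j. - \<epsilon> * r j) ` J" unfolding c_def using finJ k by (intro Max_in) auto
    then show ?thesis by blast
  qed
  have vJ: "v \<epsilon> \<bullet> p j = (c \<epsilon> + \<epsilon> * r j) * (A \<bullet> p j)" if "j \<in> J" for \<epsilon> j
    using Br[OF that] by (simp add: v_def inner_add_left algebra_simps)
  have v: "v \<epsilon> \<noteq> 0" "face_le (sv (v \<epsilon>)) s" "Suc (card (zeros M (sv (v \<epsilon>)))) = DIM('a)"
    if \<epsilon>: "\<epsilon> \<noteq> 0" for \<epsilon>
  proof -
    show v0: "v \<epsilon> \<noteq> 0"
    proof
      assume 0: "v \<epsilon> = 0"
      then have "v \<epsilon> \<bullet> p k1 = 0" by simp
      then have "c \<epsilon> = 0" using AJ[OF k(1)] B(1) by (simp add: v_def inner_add_left)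
      moreover have "v \<epsilon> \<bullet> p k2 = 0" using 0 by simp
      ultimately show False using B(2) \<epsilon> by (simp add: v_def)
    qed
    show "face_le (sv (v \<epsilon>)) s"
      unfolding face_le_def
    proof (intro allI impI)
      fix j assume nz: "sv (v \<epsilon>) j \<noteq> 0"
      then have jM: "j < M" by (auto simp: sign_vector_def split: if_splits)
      have "j \<in> J"
      proof (rule ccontr)
        assume "j \<notin> J"
        then have "j \<in> Z" using jM by (simp add: J_def)
        then show False using nz jM AZ B(3) by (simp add: sign_vector_eq_0_iff v_def inner_add_left)
      qed
      then have eq: "v \<epsilon> \<bullet> p j = (c \<epsilon> + \<epsilon> * r j) * (A \<bullet> p j)" and ge: "c \<epsilon> + \<epsilon> * r j \<ge> 0"
        using vJ c_ge[of j \<epsilon>] by auto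
      have "c \<epsilon> + \<epsilon> * r j \<noteq> 0" using nz jM eq by (auto simp: sign_vector_eq_0_iff)
      then have "c \<epsilon> + \<epsilon> * r j > 0" using ge by simp
      then show "s j = sv (v \<epsilon>) j"
        by (simp add: A(2) sign_vector_def eq zero_less_mult_iff mult_less_0_iff)
    qed
    obtain j where j: "j \<in> J" "c \<epsilon> = - \<epsilon> * r j" using c_eq by blast
    have "v \<epsilon> \<bullet> p i = 0" if "i \<in> insert j Z" for i
    proof (cases "i = j")
      case True
      then show ?thesis using vJ[OF j(1), of \<epsilon>] j(2) by simp
    next
      case False
      then show ?thesis using that AZ B(3) by (simp add: v_def inner_add_left)
    qed
    then have "insert j Z \<subseteq> zeros M (sv (v \<epsilon>))"
      using j(1) ZM by (auto simp: zeros_sign_vector J_def)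
    then have "card (insert j Z) \<le> card (zeros M (sv (v \<epsilon>)))" by (intro card_mono) auto
    moreover have "card (insert j Z) = Suc (card Z)" using j(1) finZ by (simp add: J_def)
    ultimately show "Suc (card (zeros M (sv (v \<epsilon>)))) = DIM('a)"
      using card_orthogonal[OF v0] cardZ by linarith
  qed
  have "{t \<in> covectors. face_le t s \<and> Suc (card (zeros M t)) = DIM('a)} = {sv (v 1), sv (v (- 1))}"
  proof (intro subset_antisym subsetI)
    fix t assume "t \<in> {t \<in> covectors. face_le t s \<and> Suc (card (zeros M t)) = DIM('a)}"
    then obtain x where x: "x \<noteq> 0" "t = sv x" and le: "face_le (sv x) s"
      and card: "Suc (card (zeros M (sv x))) = DIM('a)" by (auto simp: covectors_def)
    have Zx: "Z \<subseteq> zeros M (sv x)" unfolding Z_def by (rule zeros_antimono[OF le])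
    have xZ: "x \<bullet> p j = 0" if "j \<in> Z" for j using Zx that by (auto simp: zeros_sign_vector)
    define a where "a = (x \<bullet> p k1) / (A \<bullet> p k1)"
    define b where "b = x \<bullet> p k2 - a * (A \<bullet> p k2)"
    have "x - (a *\<^sub>R A + b *\<^sub>R B) = 0"
    proof (rule orthogonal_eq_0[OF I])
      show "(x - (a *\<^sub>R A + b *\<^sub>R B)) \<bullet> p j = 0" if "j \<in> insert k1 (insert k2 Z)" for j
        using that AJ[OF k(1)] B xZ AZ
        by (auto simp: inner_diff_left inner_add_left a_def b_def)
    qed
    then have xab: "x = a *\<^sub>R A + b *\<^sub>R B" by simp
    have "zeros M (sv x) \<noteq> Z" using card cardZ by auto
    then obtain j0 where j0: "j0 \<in> J" "x \<bullet> p j0 = 0" using Zx by (auto simp: zeros_sign_vector J_def)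
    have "b \<noteq> 0"
    proof
      assume "b = 0"
      then have "a = 0" using j0(2) AJ[OF j0(1)] by (simp add: xab)
      then show False using x(1) xab \<open>b = 0\<close> by simp
    qed
    \<comment> \<open>Up to a positive factor the coefficient of \<open>B\<close> is 1 or
      \<open>- 1\<close>; it remains to identify \<open>a'\<close> with the maximum
      \<open>c \<epsilon>\<close>.\<close>
    define a' where "a' = a / \<bar>b\<bar>"
    define \<epsilon> where "\<epsilon> = sgn b"
    have x': "x = \<bar>b\<bar> *\<^sub>R (a' *\<^sub>R A + \<epsilon> *\<^sub>R B)"
      using \<open>b \<noteq> 0\<close> by (simp add: xab a'_def \<epsilon>_def scaleR_add_right abs_mult_sgn mult.commute)
    have xJ: "x \<bullet> p j = \<bar>b\<bar> * ((a' + \<epsilon> * r j) * (A \<bullet> p j))" if "j \<in> J" for j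
      using Br[OF that] by (simp add: x' inner_add_left algebra_simps)
    have ge: "a' + \<epsilon> * r j \<ge> 0" if j: "j \<in> J" for j
    proof (rule ccontr)
      assume neg: "\<not> a' + \<epsilon> * r j \<ge> 0"
      have jM: "j < M" using j by (simp add: J_def)
      have "x \<bullet> p j \<noteq> 0" using neg xJ[OF j] AJ[OF j] \<open>b \<noteq> 0\<close> by simp
      then have "sv x j = s j" using le jM by (simp add: face_le_def sign_vector_eq_0_iff)
      moreover have "sv x j = - s j"
      proof -
        have "\<bar>b\<bar> * (a' + \<epsilon> * r j) < 0" using neg \<open>b \<noteq> 0\<close> by (simp add: mult_less_0_iff)
        then show ?thesis unfolding A(2) sign_vector_def xJ[OF j] mult.assoc[symmetric]
          using jM by (auto simp: zero_less_mult_iff mult_less_0_iff)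
      qed
      ultimately show False using AJ[OF j] jM by (auto simp: A(2) sign_vector_eq_0_iff)
    qed
    have "a' + \<epsilon> * r j0 = 0" using j0 xJ[OF j0(1)] AJ[OF j0(1)] \<open>b \<noteq> 0\<close> by simp
    then have "a' = c \<epsilon>"
      unfolding c_def using finJ j0(1) ge by (intro Max_eqI[symmetric]) (force simp: image_iff)+
    then have "sv x = sv (v \<epsilon>)" using sign_vector_scale[of "\<bar>b\<bar>" p M] \<open>b \<noteq> 0\<close> x' by (simp add: v_def)
    moreover have "\<epsilon> = 1 \<or> \<epsilon> = - 1" using \<open>b \<noteq> 0\<close> by (auto simp: \<epsilon>_def sgn_if)
    ultimately show "t \<in> {sv (v 1), sv (v (- 1))}" using x(2) by auto
  next
    fix t assume "t \<in> {sv (v 1), sv (v (- 1))}"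
    then show "t \<in> {t \<in> covectors. face_le t s \<and> Suc (card (zeros M t)) = DIM('a)}"
      using v[of 1] v[of "- 1"] by (auto simp: covectors_def)
  qed
  moreover have "sv (v 1) \<noteq> sv (v (- 1))"
  proof
    assume eq: "sv (v 1) = sv (v (- 1))"
    \<comment> \<open>If both ends agreed, \<open>r\<close> would be bounded above and below by
      \<open>r j\<close>, hence constant on \<open>J\<close>, but \<open>r k1 = 0\<close> and
      \<open>r k2\<close> is nonzero.\<close>
    obtain j where j: "j \<in> J" "c 1 = - 1 * r j" using c_eq by blast
    have jM: "j < M" using j by (simp add: J_def)
    have "v 1 \<bullet> p j = 0" using vJ[OF j(1), of 1] j(2) by simp
    then have "sv (v (- 1)) j = 0" using jM eq[symmetric] by (simp add: sign_vector_eq_0_iff)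
    then have "v (- 1) \<bullet> p j = 0" using jM by (simp add: sign_vector_eq_0_iff)
    then have "c (- 1) = r j" using vJ[OF j(1), of "- 1"] AJ[OF j(1)] by simp
    moreover have "r k1 = 0" "r k2 \<noteq> 0" using B AJ[OF k(2)] by (auto simp: r_def)
    ultimately show False
      using c_ge[OF k(1), of 1] c_ge[OF k(1), of "- 1"] c_ge[OF k(2), of 1] c_ge[OF k(2), of "- 1"] j(2)
      by simp
  qed
  ultimately show ?thesis by simp
qed

lemma sign_system_covectors:
  assumes "n = 2 ^ l" "n \<ge> 2" "D > 0" "n * D < M" "DIM('a) = Suc n"
  shows "sign_system n l D M covectors"
proof
  show "s j \<in> {-1, 0, 1}" if "s \<in> covectors" for s j
    using that by (auto simp: covectors_def sign_vector_def)
  show "s j = 0" if "s \<in> covectors" "j \<ge> M" for s j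
    using that by (auto simp: covectors_def sign_vector_def)
  show "card (zeros M s) \<le> n" if "s \<in> covectors" for s
    using that card_orthogonal assms(5) by (auto simp: covectors_def less_Suc_eq_le)
  show "(\<lambda>j. - s j) \<in> covectors" if "s \<in> covectors" for s
    using that by (auto simp: covectors_def sign_vector_uminus[symmetric])
  show "card {s \<in> covectors. zeros M s = Z} = 2" if "Z \<subseteq> {..<M}" "card Z = n" for Z
    using card_covector_vertices[OF that(1)] that(2) assms(5) by simp
  show "card {t \<in> covectors. face_le t s \<and> card (zeros M t) = n} = 2"
    if "s \<in> covectors" "card (zeros M s) = n - 1" for s
    using card_covector_endpoints[OF that(1)] that(2) assms(2,5) by simp
qed (use assms covectors_fill in auto)

end

section \<open>Common zeros of equivariant functions\<close>

lemma subsequence_finitely_many: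
  fixes A :: "nat \<Rightarrow> nat \<Rightarrow> 'a::euclidean_space"
  assumes "\<And>m i. i < D \<Longrightarrow> norm (A m i) = 1"
  shows "\<exists>r L. strict_mono r \<and> (\<forall>i<D. norm (L i) = 1 \<and> (\<lambda>m. A (r m) i) \<longlonglongrightarrow> L i)"
  using assms
proof (induction D)
  case 0
  then show ?case by (auto intro!: exI[of _ id] strict_mono_id)
next
  case (Suc D)
  then obtain r L where r: "strict_mono r"
    "\<And>i. i < D \<Longrightarrow> norm (L i) = 1 \<and> (\<lambda>m. A (r m) i) \<longlonglongrightarrow> L i" by (metis less_SucI)
  have "compact (sphere (0::'a) 1)" by simp
  then have "seq_compact (sphere (0::'a) 1)" by (simp add: compact_eq_seq_compact_metric)
  moreover have "\<forall>m. A (r m) D \<in> sphere 0 1" using Suc.prems by simp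
  ultimately obtain l r' where l: "l \<in> sphere 0 1" "strict_mono r'" "((\<lambda>m. A (r m) D) \<circ> r') \<longlonglongrightarrow> l"
    by (rule seq_compactE)
  have "(\<lambda>m. A ((r \<circ> r') m) i) \<longlonglongrightarrow> L i" if "i < D" for i
    using LIMSEQ_subseq_LIMSEQ[OF conjunct2[OF r(2)[OF that]] l(2)] by (simp add: o_def)
  then have "\<forall>i<Suc D. norm ((L(D := l)) i) = 1 \<and> (\<lambda>m. A ((r \<circ> r') m) i) \<longlonglongrightarrow> (L(D := l)) i"
    using l r(2) by (auto simp: less_Suc_eq o_def)
  moreover have "strict_mono (r \<circ> r')" using r(1) l(2) by (rule strict_mono_o)
  ultimately show ?case by blast
qed

text \<open>Some \<open>p j\<close> is close to the unit vector \<open>u\<close> along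
  \<open>x - y\<close>. Both \<open>x \<bullet> u\<close> and \<open>- (y \<bullet> u)\<close> equal
  half the distance, so if this exceeds \<delta>, the hyperplane of \<open>p j\<close> separates the
  two points.\<close>

lemma close_of_face_le:
  assumes net: "\<And>u. norm u = 1 \<Longrightarrow> \<exists>j<M. dist (p j) u < \<delta>"
    and xy: "norm x = 1" "norm y = (1::real)" and le: "face_le (sign_vector p M x) (sign_vector p M y)"
  shows "dist x y \<le> 2 * \<delta>"
proof (rule ccontr)
  assume "\<not> ?thesis"
  then have far: "norm (x - y) > 2 * \<delta>" by (simp add: dist_norm)
  obtain j0 where "dist (p j0) x < \<delta>" using net[OF xy(1)] by blast
  then have "\<delta> > 0" using zero_le_dist[of "p j0" x] by linarith
  then have pos: "norm (x - y) > 0" using far by linarith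
  define u where "u = (1 / norm (x - y)) *\<^sub>R (x - y)"
  have "norm u = 1" using pos by (simp add: u_def)
  then obtain j where j: "j < M" "dist (p j) u < \<delta>" using net by blast
  have sq: "(x - y) \<bullet> (x - y) = 2 - 2 * (x \<bullet> y)"
    using xy by (simp add: inner_diff_left inner_diff_right inner_commute norm_eq_1)
  have "x \<bullet> (x - y) = (norm (x - y))\<^sup>2 / 2" "y \<bullet> (x - y) = - (norm (x - y))\<^sup>2 / 2"
    unfolding power2_norm_eq_inner sq using xy by (simp_all add: inner_diff_right inner_commute norm_eq_1)
  then have u: "x \<bullet> u = norm (x - y) / 2" "y \<bullet> u = - norm (x - y) / 2"
    using pos by (simp_all add: u_def power2_eq_square)
  have near: "\<bar>z \<bullet> p j - z \<bullet> u\<bar> < \<delta>" if "norm z = 1" for z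
  proof -
    have "\<bar>z \<bullet> (p j - u)\<bar> \<le> norm z * norm (p j - u)" by (rule Cauchy_Schwarz_ineq2)
    also have "\<dots> < \<delta>" using j(2) that by (simp add: dist_norm)
    finally show ?thesis by (simp add: inner_diff_right)
  qed
  have "x \<bullet> p j > 0" "y \<bullet> p j < 0"
    using near[OF xy(1)] near[OF xy(2)] u far by (auto simp: abs_less_iff)
  then have "sign_vector p M x j = 1" "sign_vector p M y j = - 1" using j(1) by (auto simp: sign_vector_def)
  then show False using le by (auto simp: face_le_def)
qed

text \<open>The sign of the first nonzero entry decides which of \<open>s\<close> and its negative
  uses its own chosen vector; the other one takes the negative of that vector.\<close>

lemma (in general_points) equivariant_representatives:
  obtains rep where "\<And>s. s \<in> covectors \<Longrightarrow> norm (rep s) = 1 \<and> sv (rep s) = s"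
    "\<And>s. s \<in> covectors \<Longrightarrow> rep (\<lambda>j. - s j) = - rep s"
proof -
  define unit where "unit s = (SOME x. norm x = 1 \<and> sv x = s)" for s
  have unit: "norm (unit s) = 1 \<and> sv (unit s) = s" if s: "s \<in> covectors" for s
  proof -
    obtain x where x: "x \<noteq> 0" "sv x = s" using s by (auto simp: covectors_def)
    have "norm ((1 / norm x) *\<^sub>R x) = 1 \<and> sv ((1 / norm x) *\<^sub>R x) = s"
      using x sign_vector_scale[of "1 / norm x" p M x] by simp
    then show ?thesis unfolding unit_def by (rule someI)
  qed
  define lead where "lead s = s (LEAST j. s j \<noteq> 0)" for s :: "nat \<Rightarrow> int"
  have lead_uminus: "lead (\<lambda>j. - s j) = - lead s" for s by (simp add: lead_def)
  have lead: "lead s = 1 \<or> lead s = - 1" if s: "s \<in> covectors" for s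
  proof -
    obtain x where x: "x \<noteq> 0" "s = sv x" using s by (auto simp: covectors_def)
    obtain j where "s j \<noteq> 0" using sv_nonzero[OF x(1)] x(2) by auto
    then have "lead s \<noteq> 0" unfolding lead_def by (rule LeastI)
    moreover have "s j \<in> {-1, 0, 1}" for j by (simp add: x(2) sign_vector_def)
    then have "lead s \<in> {-1, 0, 1}" unfolding lead_def .
    ultimately show ?thesis by auto
  qed
  have neg: "(\<lambda>j. - s j) \<in> covectors" if "s \<in> covectors" for s
    using that by (auto simp: covectors_def sign_vector_uminus[symmetric])
  define rep where "rep s = (if lead s = 1 then unit s else - unit (\<lambda>j. - s j))" for s
  show thesis
  proof (rule that)
    show "norm (rep s) = 1 \<and> sv (rep s) = s" if "s \<in> covectors" for s
      using unit[OF that] unit[OF neg[OF that]] by (simp add: rep_def sign_vector_uminus)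
    show "rep (\<lambda>j. - s j) = - rep s" if "s \<in> covectors" for s
      using lead[OF that] by (auto simp: rep_def lead_uminus)
  qed
qed

text \<open>
  A cell is labelled by the first function whose absolute value is at least \<open>e\<close>, with its sign; the
  second alternative comes from a complementary pair of neighbours.
\<close>

lemma approximate_zero_or_jump:
  fixes f :: "nat \<Rightarrow> (nat \<Rightarrow> 'a::euclidean_space) \<Rightarrow> real"
  assumes n: "n = 2 ^ l" "n \<ge> 2" and D: "D > 0" and dim: "DIM('a) = Suc n"
    and local: "\<And>j A B. j < n * D \<Longrightarrow> (\<And>i. i < D \<Longrightarrow> A i = B i) \<Longrightarrow> f j A = f j B"
    and equiv: "\<And>j A \<pi> \<epsilon>. j < n * D \<Longrightarrow> \<pi> permutes {..<D} \<Longrightarrow> (\<And>i. i < D \<Longrightarrow> \<epsilon> i \<in> {1, -1}) \<Longrightarrow>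
      f j (\<lambda>i. \<epsilon> i *\<^sub>R A (\<pi> i)) = (\<Prod>i<D. \<epsilon> i) * f j A"
    and e: "e > 0" and \<delta>: "\<delta> > 0"
  shows "(\<exists>A. (\<forall>i<D. norm (A i) = 1) \<and> (\<forall>j<n * D. \<bar>f j A\<bar> < e)) \<or>
    (\<exists>A B. (\<forall>i<D. norm (A i) = 1 \<and> norm (B i) = 1 \<and> dist (A i) (B i) \<le> \<delta>) \<and>
       (\<exists>j<n * D. \<bar>f j A - f j B\<bar> \<ge> e))"
proof (rule ccontr)
  assume neg: "\<not> ?thesis"
  have big: "\<exists>j<n * D. \<bar>f j A\<bar> \<ge> e" if "\<And>i. i < D \<Longrightarrow> norm (A i) = 1" for A
    using neg that by (meson not_le)
  \<comment> \<open>Representatives of comparable faces are within twice the mesh of the net, hence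
    the mesh \<open>\<delta> / 2\<close>.\<close>
  obtain p :: "nat \<Rightarrow> 'a" and M where p: "general_position p M" "M > n * D + DIM('a)"
    "\<And>u. norm u = 1 \<Longrightarrow> \<exists>j<M. dist (p j) u < \<delta> / 2"
    using general_net[of "\<delta> / 2"] \<delta> by (metis half_gt_zero)
  interpret general_points p M using p by unfold_locales auto
  interpret sign_system n l D M covectors
    using n D dim p(2) by (intro sign_system_covectors) auto
  obtain rep where rep: "\<And>s. s \<in> covectors \<Longrightarrow> norm (rep s) = 1 \<and> sv (rep s) = s"
    "\<And>s. s \<in> covectors \<Longrightarrow> rep (\<lambda>j. - s j) = - rep s"
    using equivariant_representatives by blast
  define T where "T Q = (\<lambda>i. rep (Q i))" for Q :: "nat \<Rightarrow> nat \<Rightarrow> int"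
  have T: "norm (T Q i) = 1" "sv (T Q i) = Q i" if "Q \<in> cells" "i < D" for Q i
    using rep(1) that by (auto simp: T_def cells_def)
  define ind where "ind Q = (LEAST j. j < n * D \<and> \<bar>f j (T Q)\<bar> \<ge> e)" for Q
  have ind: "ind Q < n * D" "\<bar>f (ind Q) (T Q)\<bar> \<ge> e" if "Q \<in> cells" for Q
  proof -
    have "\<exists>j. j < n * D \<and> \<bar>f j (T Q)\<bar> \<ge> e" using big[of "T Q"] T(1)[OF that] by blast
    from LeastI_ex[OF this] show "ind Q < n * D" "\<bar>f (ind Q) (T Q)\<bar> \<ge> e" by (auto simp: ind_def)
  qed
  \<comment> \<open>The index is shifted by one because a label must be nonzero to carry a
    sign.\<close>
  define lab where "lab Q = (if f (ind Q) (T Q) > 0 then 1 else - 1) * int (Suc (ind Q))" for Q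
  have f_act: "f j (T (act g Q)) = real_of_int (chi g) * f j (T Q)"
    if j: "j < n * D" and g: "g \<in> signed_perms" and Q: "Q \<in> cells" for j g Q
  proof -
    have "T (act g Q) i = real_of_int (snd g i) *\<^sub>R T Q (fst g i)" if i: "i < D" for i
    proof -
      have "Q (fst g i) \<in> covectors" using Q signed_permsD(3)[OF g i] by (simp add: cells_def)
      moreover have "act g Q i = (\<lambda>j. snd g i * Q (fst g i) j)" using i by (simp add: act_def)
      ultimately show ?thesis using signed_permsD(2)[OF g i] rep(2) by (auto simp: T_def)
    qed
    then have "f j (T (act g Q)) = f j (\<lambda>i. real_of_int (snd g i) *\<^sub>R T Q (fst g i))"
      by (intro local j) auto
    also have "\<dots> = (\<Prod>i<D. real_of_int (snd g i)) * f j (T Q)"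
      using signed_permsD(2)[OF g] by (intro equiv j signed_permsD(1)[OF g]) force
    finally show ?thesis by (simp add: chi_def)
  qed
  interpret labelled_sign_system n l D M covectors lab
  proof
    show "lab Q \<noteq> 0" for Q by (simp add: lab_def)
    show "\<bar>lab Q\<bar> \<le> int (n * D)" if "Q \<in> cells" for Q
    proof -
      have "\<bar>lab Q\<bar> = int (Suc (ind Q))" by (simp add: lab_def)
      also have "\<dots> \<le> int (n * D)" using ind(1)[OF that] by (simp only: of_nat_le_iff Suc_le_eq)
      finally show ?thesis .
    qed
    show "lab (act g Q) = chi g * lab Q" if g: "g \<in> signed_perms" and Q: "Q \<in> cells" for g Q
    proof -
      \<comment> \<open>Absolute values are invariant under the group, so the index is too, and the
        label changes only in sign.\<close>
      have "\<bar>f j (T (act g Q))\<bar> = \<bar>f j (T Q)\<bar>" if "j < n * D" for j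
        using f_act[OF that g Q] chi_sign[OF g] by auto
      then have same: "ind (act g Q) = ind Q" by (simp add: ind_def cong: conj_cong)
      have "f (ind Q) (T Q) \<noteq> 0" using ind(2)[OF Q] e by auto
      then show ?thesis using chi_sign[OF g] f_act[OF ind(1)[OF Q] g Q] by (auto simp: lab_def same)
    qed
    show "lab Q + lab R \<noteq> 0" if Q: "Q \<in> cells" and R: "R \<in> cells" and le: "cell_le Q R" for Q R
    proof
      assume 0: "lab Q + lab R = 0"
      have idx: "ind Q = ind R" and opp: "f (ind Q) (T Q) > 0 \<longleftrightarrow> \<not> f (ind R) (T R) > 0"
        using 0 by (auto simp: lab_def split: if_splits)
      have "\<bar>f (ind Q) (T Q) - f (ind Q) (T R)\<bar> \<ge> e"
        using ind(2)[OF Q] ind(2)[OF R] opp unfolding idx by (auto simp: abs_if split: if_splits)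
      moreover have "dist (T Q i) (T R i) \<le> \<delta>" if "i < D" for i
        using close_of_face_le[OF p(3), of "T Q i" "T R i"] T[OF Q that] T[OF R that] le
        by (simp add: cell_le_def)
      ultimately show False using neg T(1)[OF Q] T(1)[OF R] ind(1)[OF Q] by blast
    qed
  qed
  show False by (rule no_labelling)
qed

text \<open>Compactness enters twice: jumps of a fixed size over distances tending to 0 contradict
  continuity at a limit point, so approximate zeros exist, and these accumulate at a zero.\<close>

theorem common_zero:
  fixes f :: "nat \<Rightarrow> (nat \<Rightarrow> 'a::euclidean_space) \<Rightarrow> real"
  assumes n: "n = 2 ^ l" "n \<ge> 2" and D: "D > 0" and dim: "DIM('a) = Suc n"
    and cont: "\<And>j A L. j < n * D \<Longrightarrow> (\<And>i. i < D \<Longrightarrow> (\<lambda>m. A m i) \<longlonglongrightarrow> L i) \<Longrightarrow> (\<lambda>m. f j (A m)) \<longlonglongrightarrow> f j L"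
    and equiv: "\<And>j A \<pi> \<epsilon>. j < n * D \<Longrightarrow> \<pi> permutes {..<D} \<Longrightarrow> (\<And>i. i < D \<Longrightarrow> \<epsilon> i \<in> {1, -1}) \<Longrightarrow>
      f j (\<lambda>i. \<epsilon> i *\<^sub>R A (\<pi> i)) = (\<Prod>i<D. \<epsilon> i) * f j A"
  shows "\<exists>A. (\<forall>i<D. norm (A i) = 1) \<and> (\<forall>j<n * D. f j A = 0)"
proof -
  \<comment> \<open>Continuity only refers to rows below \<open>D\<close>; for constant sequences it
    says that \<open>f j\<close> ignores the other rows.\<close>
  have local: "f j A = f j B" if "j < n * D" "\<And>i. i < D \<Longrightarrow> A i = B i" for j A B
  proof -
    have "(\<lambda>m::nat. f j A) \<longlonglongrightarrow> f j B" using that by (intro cont) auto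
    then show ?thesis by (simp add: LIMSEQ_const_iff)
  qed
  have "\<exists>A. (\<forall>i<D. norm (A i) = 1) \<and> (\<forall>j<n * D. \<bar>f j A\<bar> < e)" if e: "e > 0" for e
  proof (rule ccontr)
    assume none: "\<not> ?thesis"
    have "\<exists>A B. (\<forall>i<D. norm (A i) = 1 \<and> norm (B i) = 1 \<and> dist (A i) (B i) \<le> inverse (real (Suc m))) \<and>
       (\<exists>j<n * D. \<bar>f j A - f j B\<bar> \<ge> e)" for m
    proof -
      have "inverse (real (Suc m)) > 0" by simp
      then have "(\<exists>A. (\<forall>i<D. norm (A i) = 1) \<and> (\<forall>j<n * D. \<bar>f j A\<bar> < e)) \<or> ?thesis"
        by (intro approximate_zero_or_jump[OF n D dim] local equiv e)
      then show ?thesis using none by blast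
    qed
    then obtain A B where AB: "\<And>m i. i < D \<Longrightarrow> norm (A m i) = 1"
      "\<And>m i. i < D \<Longrightarrow> dist (A m i) (B m i) \<le> inverse (real (Suc m))"
      "\<And>m. \<exists>j<n * D. \<bar>f j (A m) - f j (B m)\<bar> \<ge> e" by metis
    obtain r L where r: "strict_mono r" "\<And>i. i < D \<Longrightarrow> (\<lambda>m. A (r m) i) \<longlonglongrightarrow> L i"
      using subsequence_finitely_many[of D A] AB(1) by blast
    have B: "(\<lambda>m. B (r m) i) \<longlonglongrightarrow> L i" if i: "i < D" for i
    proof (rule Lim_transform[OF r(2)[OF i]])
      have "(\<lambda>m. inverse (real (Suc (r m)))) \<longlonglongrightarrow> 0"
        using LIMSEQ_subseq_LIMSEQ[OF LIMSEQ_inverse_real_of_nat r(1)] by (simp add: o_def)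
      then show "(\<lambda>m. B (r m) i - A (r m) i) \<longlonglongrightarrow> 0"
        by (rule Lim_null_comparison[rotated]) (use AB(2)[OF i] in \<open>simp add: dist_norm norm_minus_commute\<close>)
    qed
    have "\<forall>\<^sub>F m in sequentially. \<bar>f j (A (r m)) - f j (B (r m))\<bar> < e" if j: "j < n * D" for j
    proof -
      have "(\<lambda>m. f j (A (r m)) - f j (B (r m))) \<longlonglongrightarrow> f j L - f j L"
        using r(2) B by (intro tendsto_diff cont j) auto
      then show ?thesis using e by (auto simp: tendsto_iff dist_real_def)
    qed
    then have "\<forall>\<^sub>F m in sequentially. \<forall>j\<in>{..<n * D}. \<bar>f j (A (r m)) - f j (B (r m))\<bar> < e"
      by (intro eventually_ball_finite) auto
    then obtain m where "\<forall>j\<in>{..<n * D}. \<bar>f j (A (r m)) - f j (B (r m))\<bar> < e"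
      by (auto simp: eventually_sequentially)
    then show False using AB(3)[of "r m"] by force
  qed
  then have "\<exists>A. (\<forall>i<D. norm (A i) = 1) \<and> (\<forall>j<n * D. \<bar>f j A\<bar> < inverse (real (Suc m)))" for m
    by simp
  then obtain A where A: "\<And>m i. i < D \<Longrightarrow> norm (A m i) = 1"
    "\<And>m j. j < n * D \<Longrightarrow> \<bar>f j (A m)\<bar> < inverse (real (Suc m))" by metis
  obtain r L where r: "strict_mono r" "\<And>i. i < D \<Longrightarrow> norm (L i) = 1 \<and> (\<lambda>m. A (r m) i) \<longlonglongrightarrow> L i"
    using subsequence_finitely_many[of D A] A(1) by blast
  have "f j L = 0" if j: "j < n * D" for j
  proof -
    have "(\<lambda>m. inverse (real (Suc (r m)))) \<longlonglongrightarrow> 0"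
      using LIMSEQ_subseq_LIMSEQ[OF LIMSEQ_inverse_real_of_nat r(1)] by (simp add: o_def)
    then have "(\<lambda>m. f j (A (r m))) \<longlonglongrightarrow> 0"
      by (rule Lim_null_comparison[rotated]) (use A(2)[OF j] in \<open>simp add: less_imp_le\<close>)
    moreover have "(\<lambda>m. f j (A (r m))) \<longlonglongrightarrow> f j L" using r(2) by (intro cont j) auto
    ultimately show ?thesis using LIMSEQ_unique by blast
  qed
  then show ?thesis using r(2) by blast
qed

section \<open>Bisection of measures\<close>

text \<open>Replacing \<open>g m\<close> outside \<open>B\<close> by its lower bound
  \<open>- 1\<close> does not increase the integral. In the limit, the function equal to 1 on
  \<open>B\<close> and \<open>- 1\<close> elsewhere has integral at most 0.\<close>

lemma (in finite_measure) measure_le_half: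
  fixes g :: "nat \<Rightarrow> 'a \<Rightarrow> real"
  assumes B: "B \<in> sets M" and g: "\<And>m. g m \<in> borel_measurable M" "\<And>m x. \<bar>g m x\<bar> \<le> 1"
    and zero: "\<And>m. integral\<^sup>L M (g m) = 0" and lim: "\<And>x. x \<in> B \<Longrightarrow> (\<lambda>m. g m x) \<longlonglongrightarrow> 1"
  shows "measure M B \<le> measure M (space M) / 2"
proof -
  let ?h = "\<lambda>m x. if x \<in> B then g m x else - 1"
  let ?k = "\<lambda>x. 2 * indicator B x - 1 :: real"
  have int: "integrable M (\<lambda>x. if x \<in> B then g m x else - 1)" "integrable M (g m)" for m
    using B g by (auto intro!: integrable_const_bound[where B = 1])
  have "(\<lambda>m. integral\<^sup>L M (?h m)) \<longlonglongrightarrow> integral\<^sup>L M ?k"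
  proof (rule integral_dominated_convergence[where w = "\<lambda>_. 1"])
    show "AE x in M. (\<lambda>m. ?h m x) \<longlonglongrightarrow> ?k x"
      using lim by (intro AE_I2) (auto simp: indicator_def)
    show "AE x in M. norm (?h m x) \<le> 1" for m using g(2) by (intro AE_I2) auto
  qed (use B g in auto)
  moreover have "integral\<^sup>L M (?h m) \<le> 0" for m
  proof -
    have "integral\<^sup>L M (?h m) \<le> integral\<^sup>L M (g m)"
      using g(2) by (intro integral_mono int) (auto simp: abs_le_iff minus_le_iff)
    then show ?thesis using zero by simp
  qed
  ultimately have "integral\<^sup>L M ?k \<le> 0" by (intro LIMSEQ_le_const2) auto
  moreover have "integral\<^sup>L M ?k = 2 * measure M B - measure M (space M)"
    using B by (simp add: less_top[symmetric])
  ultimately show ?thesis by simp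
qed

text \<open>A pair \<open>(a, b)\<close> stands for the affine function \<open>x \<mapsto> a \<bullet> x + b\<close>; for \<open>a = 0\<close> this is the hyperplane at infinity.\<close>

definition affine_prod :: "nat \<Rightarrow> (nat \<Rightarrow> 'a::real_inner \<times> real) \<Rightarrow> 'a \<Rightarrow> real" where
  "affine_prod D A x = (\<Prod>i<D. A i \<bullet> (x, 1))"

lemma affine_prod_measurable [measurable]:
  "affine_prod D A \<in> borel_measurable (borel :: 'a::euclidean_space measure)"
  unfolding affine_prod_def inner_prod_def fst_conv snd_conv by measurable

lemma tendsto_affine_prod:
  assumes "\<And>i. i < D \<Longrightarrow> (\<lambda>m. A m i) \<longlonglongrightarrow> L i"
  shows "(\<lambda>m. affine_prod D (A m) x) \<longlonglongrightarrow> affine_prod D L x"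
  unfolding affine_prod_def using assms by (intro tendsto_prod tendsto_inner tendsto_const) auto

lemma affine_prod_act:
  assumes "\<pi> permutes {..<D}"
  shows "affine_prod D (\<lambda>i. \<epsilon> i *\<^sub>R A (\<pi> i)) x = (\<Prod>i<D. \<epsilon> i) * affine_prod D A x"
  using prod.permute[OF assms, of "\<lambda>i. A i \<bullet> (x, 1)"]
  by (simp add: affine_prod_def prod.distrib o_def)

text \<open>For each multiplier, \<open>common_zero\<close> in dimension \<open>n + 1\<close> gives
  a tuple with vanishing integrals. Along a convergent subsequence the integrands tend to the sign
  of the limit product wherever it is nonzero, which gives both inequalities.\<close>

lemma halving_tuple:
  fixes \<mu> :: "nat \<Rightarrow> 'a::euclidean_space measure"
  assumes D: "D > 0" and n: "n = DIM('a)" "n = 2 ^ l" "n \<ge> 2"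
    and fin: "\<And>j. j < n * D \<Longrightarrow> finite_measure (\<mu> j)"
    and borel: "\<And>j. j < n * D \<Longrightarrow> sets (\<mu> j) = sets borel"
  shows "\<exists>A :: nat \<Rightarrow> 'a \<times> real. (\<forall>i<D. norm (A i) = 1) \<and>
    (\<forall>j<n * D. measure (\<mu> j) {x. affine_prod D A x > 0} \<le> measure (\<mu> j) UNIV / 2 \<and>
       measure (\<mu> j) {x. affine_prod D A x < 0} \<le> measure (\<mu> j) UNIV / 2)"
proof -
  define clamp where "clamp t = max (- 1) (min 1 t)" for t :: real
  have clamp_le: "\<bar>clamp t\<bar> \<le> 1" for t by (auto simp: clamp_def)
  have clamp_minus: "clamp (- t) = - clamp t" for t by (auto simp: clamp_def)
  have clamp_meas: "clamp \<in> borel_measurable borel" unfolding clamp_def by measurable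
  have meas: "(\<lambda>x. clamp (c * affine_prod D A x)) \<in> borel_measurable (\<mu> j)" if "j < n * D" for c A j
  proof -
    have "(\<lambda>x. clamp (c * affine_prod D A x)) \<in> borel_measurable borel"
      using clamp_meas by measurable
    then show ?thesis unfolding measurable_cong_sets[OF borel[OF that] refl] .
  qed
  define f where "f m j A = (\<integral>x. clamp (real (Suc m) * affine_prod D A x) \<partial>\<mu> j)" for m j and A :: "nat \<Rightarrow> 'a \<times> real"
  have "\<exists>A. (\<forall>i<D. norm (A i) = 1) \<and> (\<forall>j<n * D. f m j A = 0)" for m
  proof (rule common_zero[OF n(2,3) D])
    show "DIM('a \<times> real) = Suc n" by (simp add: n(1))
    show "(\<lambda>k. f m j (A k)) \<longlonglongrightarrow> f m j L" if j: "j < n * D" and lim: "\<And>i. i < D \<Longrightarrow> (\<lambda>k. A k i) \<longlonglongrightarrow> L i" for j A L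
      unfolding f_def
    proof (rule integral_dominated_convergence[where w = "\<lambda>_. 1"])
      interpret finite_measure "\<mu> j" by (rule fin[OF j])
      show "integrable (\<mu> j) (\<lambda>_. 1 :: real)" by simp
      show "AE x in \<mu> j. (\<lambda>k. clamp (real (Suc m) * affine_prod D (A k) x)) \<longlonglongrightarrow> clamp (real (Suc m) * affine_prod D L x)"
        unfolding clamp_def
        by (intro AE_I2 tendsto_max tendsto_min tendsto_mult tendsto_const tendsto_affine_prod lim)
    qed (use meas[OF j] clamp_le in auto)
    show "f m j (\<lambda>i. \<epsilon> i *\<^sub>R A (\<pi> i)) = (\<Prod>i<D. \<epsilon> i) * f m j A"
      if "j < n * D" "\<pi> permutes {..<D}" "\<And>i. i < D \<Longrightarrow> \<epsilon> i \<in> {1, - 1}" for j A \<pi> \<epsilon>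
    proof -
      have "\<bar>\<Prod>i<D. \<epsilon> i\<bar> = 1" using that(3) by (simp add: abs_prod) (intro prod.neutral, force)
      then have "(\<Prod>i<D. \<epsilon> i) = 1 \<or> (\<Prod>i<D. \<epsilon> i) = - 1" by linarith
      then show ?thesis
        using clamp_minus by (auto simp: f_def affine_prod_act[OF that(2)])
    qed
  qed
  then obtain A where A: "\<And>m i. i < D \<Longrightarrow> norm (A m i) = 1" "\<And>m j. j < n * D \<Longrightarrow> f m j (A m) = 0" by metis
  obtain r L where r: "strict_mono r" "\<And>i. i < D \<Longrightarrow> norm (L i) = 1 \<and> (\<lambda>m. A (r m) i) \<longlonglongrightarrow> L i"
    using subsequence_finitely_many[of D A] A(1) by blast
  define G where "G = (\<lambda>m x. clamp (real (Suc (r m)) * affine_prod D (A (r m)) x))"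
  have lim: "(\<lambda>m. affine_prod D (A (r m)) x) \<longlonglongrightarrow> affine_prod D L x" for x
    using r(2) by (intro tendsto_affine_prod) auto
  \<comment> \<open>With a multiplier tending to infinity, any positive limit makes the argument
    eventually at least 1.\<close>
  have clamp_lim: "(\<lambda>m. clamp (real (Suc (r m)) * P m)) \<longlonglongrightarrow> 1" if P: "P \<longlonglongrightarrow> c" "c > 0" for P c
  proof -
    have "filterlim (\<lambda>m. real (Suc (r m))) at_top sequentially"
      using filterlim_compose[OF filterlim_compose[OF filterlim_real_sequentially filterlim_Suc] filterlim_subseq[OF r(1)]]
      by simp
    then have "filterlim (\<lambda>m. real (Suc (r m)) * P m) at_top sequentially"
      using P by (subst mult.commute) (intro filterlim_tendsto_pos_mult_at_top)
    then have "\<forall>\<^sub>F m in sequentially. real (Suc (r m)) * P m \<ge> 1" unfolding filterlim_at_top by blast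
    then have "\<forall>\<^sub>F m in sequentially. clamp (real (Suc (r m)) * P m) = 1"
      by (rule eventually_mono) (auto simp: clamp_def)
    then show ?thesis by (rule tendsto_eventually)
  qed
  have "measure (\<mu> j) {x. affine_prod D L x > 0} \<le> measure (\<mu> j) UNIV / 2 \<and>
      measure (\<mu> j) {x. affine_prod D L x < 0} \<le> measure (\<mu> j) UNIV / 2" if j: "j < n * D" for j
  proof -
    interpret finite_measure "\<mu> j" by (rule fin[OF j])
    have space: "space (\<mu> j) = UNIV" using sets_eq_imp_space_eq[OF borel[OF j]] by simp
    have G: "G m \<in> borel_measurable (\<mu> j)" "integral\<^sup>L (\<mu> j) (G m) = 0" for m
      using meas[OF j] A(2)[OF j, of "r m"] by (simp_all only: G_def f_def)
    have G_le: "\<bar>G m x\<bar> \<le> 1" for m x by (simp only: G_def clamp_le)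
    have "measure (\<mu> j) {x. affine_prod D L x > 0} \<le> measure (\<mu> j) (space (\<mu> j)) / 2"
    proof (rule measure_le_half[where g = G])
      show "{x. affine_prod D L x > 0} \<in> sets (\<mu> j)" unfolding borel[OF j] by measurable
      show "(\<lambda>m. G m x) \<longlonglongrightarrow> 1" if "x \<in> {x. affine_prod D L x > 0}" for x
        unfolding G_def using lim that by (intro clamp_lim) auto
    qed (use G G_le in auto)
    moreover have "measure (\<mu> j) {x. affine_prod D L x < 0} \<le> measure (\<mu> j) (space (\<mu> j)) / 2"
    proof (rule measure_le_half[where g = "\<lambda>m x. - G m x"])
      show "{x. affine_prod D L x < 0} \<in> sets (\<mu> j)" unfolding borel[OF j] by measurable
      show "(\<lambda>m. - G m x) \<longlonglongrightarrow> 1" if "x \<in> {x. affine_prod D L x < 0}" for x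
      proof -
        have "(\<lambda>m. clamp (real (Suc (r m)) * - affine_prod D (A (r m)) x)) \<longlonglongrightarrow> 1"
          using tendsto_minus[OF lim[of x]] that by (intro clamp_lim) auto
        then show ?thesis by (simp add: G_def clamp_minus)
      qed
    qed (use G G_le in auto)
    ultimately show ?thesis by (simp add: space)
  qed
  then show ?thesis using r(2) by blast
qed

theorem theorem1:
  fixes D :: nat and \<mu> :: "nat \<Rightarrow> (real ^ 'n) measure"
  assumes "D > 0"
    and "CARD('n) > 1"
    and "\<exists>k. CARD('n) = 2 ^ k"
    and "\<And>i. i \<in> {1..CARD('n) * D} \<Longrightarrow> finite_measure (\<mu> i)"
    and "\<And>i. i \<in> {1..CARD('n) * D} \<Longrightarrow> sets (\<mu> i) = sets borel"
  shows "\<exists>Hs :: (real ^ 'n) set list. arrangement D Hs \<and>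
           (\<forall>i\<in>{1..CARD('n) * D}. bisected_by (\<mu> i) Hs)"
proof -
  obtain l where l: "CARD('n) = 2 ^ l" using assms(3) by blast
  \<comment> \<open>The measures are numbered from 1, the test functions from 0.\<close>
  obtain A :: "nat \<Rightarrow> (real ^ 'n) \<times> real" where A: "\<And>i. i < D \<Longrightarrow> norm (A i) = 1"
    and half: "\<And>j. j < CARD('n) * D \<Longrightarrow>
      measure (\<mu> (Suc j)) {x. affine_prod D A x > 0} \<le> measure (\<mu> (Suc j)) UNIV / 2 \<and>
      measure (\<mu> (Suc j)) {x. affine_prod D A x < 0} \<le> measure (\<mu> (Suc j)) UNIV / 2"
    using halving_tuple[of D "CARD('n)" l "\<lambda>j. \<mu> (Suc j)"] assms l by fastforce
  have half: "measure (\<mu> j) {x. affine_prod D A x > 0} \<le> measure (\<mu> j) UNIV / 2"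
    "measure (\<mu> j) {x. affine_prod D A x < 0} \<le> measure (\<mu> j) UNIV / 2" if "j \<in> {1..CARD('n) * D}" for j
    using half[of "j - 1"] that by auto
  \<comment> \<open>The factors outside \<open>I\<close> have linear part 0 and, being unit vectors,
    are nonzero constants with product \<open>c\<close>; they define no hyperplane.\<close>
  define I where "I = {i. i < D \<and> fst (A i) \<noteq> 0}"
  have finI: "finite I" by (simp add: I_def)
  define c where "c = (\<Prod>i\<in>{..<D} - I. snd (A i))"
  have "c \<noteq> 0"
  proof -
    have "snd (A i) \<noteq> 0" if "i \<in> {..<D} - I" for i
    proof
      assume "snd (A i) = 0"
      then have "A i = 0" using that by (simp add: I_def prod_eq_iff)
      then show False using A[of i] that by simp
    qed
    then show ?thesis by (simp add: c_def)
  qed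
  have prod: "affine_prod D A x = c * (\<Prod>i\<in>I. A i \<bullet> (x, 1))" for x
  proof -
    have "affine_prod D A x = (\<Prod>i\<in>{..<D} - I. A i \<bullet> (x, 1)) * (\<Prod>i\<in>I. A i \<bullet> (x, 1))"
      unfolding affine_prod_def by (rule prod.subset_diff) (auto simp: I_def)
    also have "(\<Prod>i\<in>{..<D} - I. A i \<bullet> (x, 1)) = c"
      unfolding c_def by (rule prod.cong) (auto simp: I_def inner_prod_def)
    finally show ?thesis .
  qed
  show ?thesis
  proof (cases "I = {}")
    case True
    \<comment> \<open>The product is a nonzero constant, so one of its two sign sets is the whole
      space and all the measures vanish; an arbitrary hyperplane will do.\<close>
    define a :: "real ^ 'n" where "a = axis undefined 1"
    have "a \<noteq> 0" by (simp add: a_def axis_eq_0_iff)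
    have "bisected_by (\<mu> j) [{x. a \<bullet> x = 0}]" if j: "j \<in> {1..CARD('n) * D}" for j
    proof -
      interpret finite_measure "\<mu> j" using assms(4) j .
      have space: "space (\<mu> j) = UNIV" using sets_eq_imp_space_eq[OF assms(5)[OF j]] by simp
      have "{x. affine_prod D A x > 0} = UNIV \<or> {x. affine_prod D A x < 0} = UNIV"
        using \<open>c \<noteq> 0\<close> by (auto simp: prod True)
      then have "measure (\<mu> j) UNIV \<le> measure (\<mu> j) UNIV / 2" using half[OF j] by auto
      then have "measure (\<mu> j) UNIV = 0" using measure_nonneg[of "\<mu> j" UNIV] by linarith
      then have "measure (\<mu> j) S = 0" for S using bounded_measure[of S] measure_nonneg[of "\<mu> j" S] space by simp
      moreover have "affine_function (\<lambda>x. a \<bullet> x)"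
        unfolding affine_function_def by (intro exI[of _ a] exI[of _ 0]) simp
      ultimately show ?thesis
        unfolding bisected_by_def defining_functions_def by (intro exI[of _ "[\<lambda>x. a \<bullet> x]"]) simp
    qed
    moreover have "arrangement D [{x. a \<bullet> x = 0}]"
      using assms(1) \<open>a \<noteq> 0\<close> by (auto simp: arrangement_def hyperplane_def)
    ultimately show ?thesis by blast
  next
    case False
    define As where "As = map (\<lambda>i x. A i \<bullet> (x, 1)) (sorted_list_of_set I)"
    define Hs where "Hs = map (\<lambda>i. {x. A i \<bullet> (x, 1) = 0}) (sorted_list_of_set I)"
    have "card I \<le> D" using card_mono[of "{..<D}" I] by (auto simp: I_def)
    moreover have "card I \<ge> 1" using False finI by (simp add: Suc_le_eq card_gt_0_iff)
    moreover have "hyperplane {x. A i \<bullet> (x, 1) = 0}" if "i \<in> I" for i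
    proof -
      have "{x. A i \<bullet> (x, 1) = 0} = {x. fst (A i) \<bullet> x = - snd (A i)}"
        by (auto simp: inner_prod_def eq_neg_iff_add_eq_0)
      then show ?thesis using that unfolding hyperplane_def I_def by blast
    qed
    ultimately have "arrangement D Hs" using finI by (simp add: arrangement_def Hs_def)
    moreover have "bisected_by (\<mu> j) Hs" if j: "j \<in> {1..CARD('n) * D}" for j
    proof -
      have "affine_function (\<lambda>x. A i \<bullet> (x, 1))" for i
        unfolding affine_function_def by (intro exI[of _ "fst (A i)"] exI[of _ "snd (A i)"]) (simp add: inner_prod_def)
      then have def: "defining_functions As Hs"
        by (simp add: defining_functions_def As_def Hs_def list_all2_map1 list_all2_map2 list_all2_same)
      have eq: "(\<Prod>B\<leftarrow>As. B x) = (\<Prod>i\<in>I. A i \<bullet> (x, 1))" for x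
        using prod.distinct_set_conv_list[of "sorted_list_of_set I" "\<lambda>i. A i \<bullet> (x, 1)"] finI
        by (simp add: As_def o_def)
      show ?thesis
      proof (cases "c > 0")
        case True
        then have "{x. (\<Prod>B\<leftarrow>As. B x) > 0} = {x. affine_prod D A x > 0}"
          "{x. (\<Prod>B\<leftarrow>As. B x) < 0} = {x. affine_prod D A x < 0}"
          by (auto simp: prod eq zero_less_mult_iff mult_less_0_iff)
        then show ?thesis unfolding bisected_by_def using def half[OF j] by auto
      next
        case False
        \<comment> \<open>A negative constant exchanges the two sides.\<close>
        then have "c < 0" using \<open>c \<noteq> 0\<close> by simp
        then have "{x. (\<Prod>B\<leftarrow>As. B x) > 0} = {x. affine_prod D A x < 0}"
          "{x. (\<Prod>B\<leftarrow>As. B x) < 0} = {x. affine_prod D A x > 0}"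
          by (auto simp: prod eq zero_less_mult_iff mult_less_0_iff)
        then show ?thesis unfolding bisected_by_def using def half[OF j] by auto
      qed
    qed
    ultimately show ?thesis by blast
  qed
qed

end
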